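(* Let $T>0$. Suppose that $u,b\in L^3(\mathbb{T}^3\times(0,T);\mathbb{R}^3)$, $S\in L^1_{loc}(\mathbb{T}^3\times(0,T);\mathcal{S}^{3\times3})$ and $a\in L^{3/2}(\mathbb{T}^3\times(0,T);\mathbb{R}^3)$ satisfy $$\operatorname{div}u=\operatorname{div}b=0,\qquad \partial_tu+\operatorname{div}S=0,\qquad \partial_tb+\nabla\times a=0$$ in the sense of distributions in $\mathbb{T}^3\times(0,T)$, that $\int_{\mathbb{T}^3}u(x,t)\,dx=\int_{\mathbb{T}^3}b(x,t)\,dx=0$ for a.e. $t$, and that $(u,b,S,a)(x,t)\in K^\Lambda$ for a.e. $(x,t)\in\mathbb{T}^3\times(0,T)$. Let $\Psi$ be the mean-zero, divergence-free vector potential of $b$. Then the magnetic helicity $\int_{\mathbb{T}^3}\Psi(x,t)\cdot b(x,t)\,dx$ is constant for a.e. $t\in(0,T)$ (i.e. a.e. equal to a constant).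
   Context: $\mathbb{T}^3=[0,1]^3$ is the flat torus; $\mathcal{S}^{3\times3}$ is the space of symmetric real $3\times3$ matrices; $(v\otimes w)_{ij}=v_iw_j$; $(\operatorname{div}M)_i=\sum_j\partial_jM_{ij}$. Constraint set: $K=\{(u,b,S,a)\in\mathbb{R}^3\times\mathbb{R}^3\times\mathcal{S}^{3\times3}\times\mathbb{R}^3: S=u\otimes u-b\otimes b+\Pi I\text{ for some }\Pi\in\mathbb{R},\ a=b\times u\}$. Wave cone: $\Lambda$ is the set of $(u,b,S,a)\in\mathbb{R}^3\times\mathbb{R}^3\times\mathcal{S}^{3\times3}\times\mathbb{R}^3$ for which there is $(\xi,c)\in(\mathbb{R}^3\setminus\{0\})\times\mathbb{R}$ with $S\xi+cu=0$, $\xi\times a+cb=0$, $u\cdot\xi=b\cdot\xi=0$. A function $f:\mathbb{R}^3\times\mathbb{R}^3\times\mathcal{S}^{3\times3}\times\mathbb{R}^3\to\mathbb{R}$ is $\Lambda$-convex if $t\mapsto f(V+tW)$ is convex on $\mathbb{R}$ for every $V$ and every $W\in\Lambda$. The $\Lambda$-convex hull $K^\Lambda$ is the set of points $W$ such that $f(W)\le0$ for every $\Lambda$-convex $f$ with $f|_K\le0$. The vector potential of $b$ is the unique $\Psi\in L^3_tW^{1,3}_x(\mathbb{T}^3\times(0,T);\mathbb{R}^3)$ with $\nabla\times\Psi=b$, $\operatorname{div}\Psi=0$ and $\int_{\mathbb{T}^3}\Psi(x,t)\,dx=0$ for a.e. $t$. *)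

theory Defs
  imports "HOL-Analysis.Analysis"
begin

section \<open>Periodic functions and test functions\<close>

text \<open>Functions on the flat torus are represented by their restriction to the unit cube; values
  elsewhere are irrelevant. Test functions on the torus are periodic functions on the whole space.\<close>

abbreviation torus3 :: "(real^3) set" where
  "torus3 \<equiv> cbox 0 One"

abbreviation cylinder :: "real \<Rightarrow> ((real^3) \<times> real) set" where
  "cylinder T \<equiv> torus3 \<times> {0<..<T}"

abbreviation dir_x :: "3 \<Rightarrow> (real^3) \<times> real" where
  "dir_x j \<equiv> (axis j 1, 0)"

abbreviation dir_t :: "(real^3) \<times> real" where
  "dir_t \<equiv> (0, 1)"

primrec C_k :: "nat \<Rightarrow> ('a::euclidean_space \<Rightarrow> real) \<Rightarrow> bool" where
  "C_k 0 f \<longleftrightarrow> continuous_on UNIV f"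
| "C_k (Suc k) f \<longleftrightarrow> (\<forall>x. f differentiable (at x)) \<and>
     (\<forall>v\<in>Basis. C_k k (\<lambda>x. frechet_derivative f (at x) v))"

definition C_infinity :: "('a::euclidean_space \<Rightarrow> real) \<Rightarrow> bool" where
  "C_infinity f \<longleftrightarrow> (\<forall>k. C_k k f)"

definition torus_test_function :: "(real^3 \<Rightarrow> real) \<Rightarrow> bool" where
  "torus_test_function \<phi> \<longleftrightarrow> C_infinity \<phi> \<and> (\<forall>x i. \<phi> (x + axis i 1) = \<phi> x)"

text \<open>Since the torus is compact, compact support in the cylinder only restricts the time variable;
  the test functions are extended by zero to all times.\<close>

definition cylinder_test_function :: "real \<Rightarrow> ((real^3) \<times> real \<Rightarrow> real) \<Rightarrow> bool" where
  "cylinder_test_function T \<phi> \<longleftrightarrow> C_infinity \<phi> \<and>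
     (\<forall>x t i. \<phi> (x + axis i 1, t) = \<phi> (x, t)) \<and>
     (\<exists>r s. 0 < r \<and> r \<le> s \<and> s < T \<and> (\<forall>x t. t \<notin> {r..s} \<longrightarrow> \<phi> (x, t) = 0))"

section \<open>Function spaces\<close>

definition Lp_on :: "real \<Rightarrow> 'a::euclidean_space set \<Rightarrow> ('a \<Rightarrow> 'b::euclidean_space) \<Rightarrow> bool" where
  "Lp_on p \<Omega> f \<longleftrightarrow> f \<in> borel_measurable (lebesgue_on \<Omega>) \<and>
     integrable (lebesgue_on \<Omega>) (\<lambda>z. norm (f z) powr p)"

definition L1_loc_on :: "'a::euclidean_space set \<Rightarrow> ('a \<Rightarrow> 'b::euclidean_space) \<Rightarrow> bool" where
  "L1_loc_on \<Omega> f \<longleftrightarrow> (\<forall>C. compact C \<and> C \<subseteq> \<Omega> \<longrightarrow> integrable (lebesgue_on C) f)"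

section \<open>Distributional derivatives\<close>

text \<open>Gradients follow the convention that row \<open>i\<close>, column \<open>j\<close> holds the derivative of the
  \<open>i\<close>-th component in the \<open>j\<close>-th direction; the divergence of a vector field is then the trace of
  its gradient and the curl is the following function of it.\<close>

definition curl_of_grad :: "real^3^3 \<Rightarrow> real^3" where
  "curl_of_grad G = vector [G$3$2 - G$2$3, G$1$3 - G$3$1, G$2$1 - G$1$2]"

text \<open>The directional derivative of \<open>f\<close> along \<open>v\<close> as a distribution on the cylinder, applied to the
  test function \<open>\<phi>\<close>. The operators below pair each component with the same scalar \<open>\<phi>\<close>.\<close>

definition dist_deriv ::
    "real \<Rightarrow> (real^3) \<times> real \<Rightarrow> ((real^3) \<times> real \<Rightarrow> real) \<Rightarrow> ((real^3) \<times> real \<Rightarrow> real) \<Rightarrow> real" where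
  "dist_deriv T v f \<phi> =
     - (LINT z|lebesgue_on (cylinder T). f z * frechet_derivative \<phi> (at z) v)"

definition dist_grad ::
    "real \<Rightarrow> ((real^3) \<times> real \<Rightarrow> real^3) \<Rightarrow> ((real^3) \<times> real \<Rightarrow> real) \<Rightarrow> real^3^3" where
  "dist_grad T w \<phi> = (\<chi> i j. dist_deriv T (dir_x j) (\<lambda>z. w z $ i) \<phi>)"

definition dist_div ::
    "real \<Rightarrow> ((real^3) \<times> real \<Rightarrow> real^3) \<Rightarrow> ((real^3) \<times> real \<Rightarrow> real) \<Rightarrow> real" where
  "dist_div T w \<phi> = trace (dist_grad T w \<phi>)"

definition dist_curl ::
    "real \<Rightarrow> ((real^3) \<times> real \<Rightarrow> real^3) \<Rightarrow> ((real^3) \<times> real \<Rightarrow> real) \<Rightarrow> real^3" where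
  "dist_curl T w \<phi> = curl_of_grad (dist_grad T w \<phi>)"

definition dist_dt ::
    "real \<Rightarrow> ((real^3) \<times> real \<Rightarrow> real^3) \<Rightarrow> ((real^3) \<times> real \<Rightarrow> real) \<Rightarrow> real^3" where
  "dist_dt T w \<phi> = (\<chi> i. dist_deriv T dir_t (\<lambda>z. w z $ i) \<phi>)"

definition dist_div_matrix ::
    "real \<Rightarrow> ((real^3) \<times> real \<Rightarrow> real^3^3) \<Rightarrow> ((real^3) \<times> real \<Rightarrow> real) \<Rightarrow> real^3" where
  "dist_div_matrix T M \<phi> = (\<chi> i. \<Sum>j\<in>UNIV. dist_deriv T (dir_x j) (\<lambda>z. M z $ i $ j) \<phi>)"

section \<open>The vector potential\<close>

definition weak_gradient_on_torus :: "(real^3 \<Rightarrow> real^3) \<Rightarrow> (real^3 \<Rightarrow> real^3^3) \<Rightarrow> bool" where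
  "weak_gradient_on_torus w G \<longleftrightarrow>
     (\<forall>\<phi> i j. torus_test_function \<phi> \<longrightarrow>
        (LINT x|lebesgue_on torus3. w x $ i * frechet_derivative \<phi> (at x) (axis j 1)) =
        - (LINT x|lebesgue_on torus3. G x $ i $ j * \<phi> x))"

text \<open>\<open>\<Psi>\<close> belongs to \<open>L\<^sup>p\<close> in time with values in \<open>W\<^sup>1\<^sup>,\<^sup>p\<close> of the torus, and \<open>G\<close> is its spatial
  weak gradient. As both exponents agree, the mixed norm is the norm of \<open>\<Psi>\<close> and \<open>G\<close> in \<open>L\<^sup>p\<close> of the
  cylinder.\<close>

definition Lp_W1p_with_gradient ::
    "real \<Rightarrow> real \<Rightarrow> ((real^3) \<times> real \<Rightarrow> real^3) \<Rightarrow> ((real^3) \<times> real \<Rightarrow> real^3^3) \<Rightarrow> bool" where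
  "Lp_W1p_with_gradient p T \<Psi> G \<longleftrightarrow>
     Lp_on p (cylinder T) \<Psi> \<and> Lp_on p (cylinder T) G \<and>
     (AE t in lebesgue_on {0<..<T}. weak_gradient_on_torus (\<lambda>x. \<Psi> (x, t)) (\<lambda>x. G (x, t)))"

definition mean_zero :: "real \<Rightarrow> ((real^3) \<times> real \<Rightarrow> real^3) \<Rightarrow> bool" where
  "mean_zero T w \<longleftrightarrow> (AE t in lebesgue_on {0<..<T}. (LINT x|lebesgue_on torus3. w (x, t)) = 0)"

definition vector_potential ::
    "real \<Rightarrow> ((real^3) \<times> real \<Rightarrow> real^3) \<Rightarrow> ((real^3) \<times> real \<Rightarrow> real^3) \<Rightarrow> bool" where
  "vector_potential T b \<Psi> \<longleftrightarrow>
     (\<exists>G. Lp_W1p_with_gradient 3 T \<Psi> G \<and>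
          (AE z in lebesgue_on (cylinder T). curl_of_grad (G z) = b z) \<and>
          (AE z in lebesgue_on (cylinder T). trace (G z) = 0)) \<and>
     mean_zero T \<Psi>"

definition magnetic_helicity ::
    "((real^3) \<times> real \<Rightarrow> real^3) \<Rightarrow> ((real^3) \<times> real \<Rightarrow> real^3) \<Rightarrow> real \<Rightarrow> real" where
  "magnetic_helicity \<Psi> b t = (LINT x|lebesgue_on torus3. \<Psi> (x, t) \<bullet> b (x, t))"

section \<open>The constraint set and its hull\<close>

type_synonym state = "(real^3) \<times> (real^3) \<times> (real^3^3) \<times> (real^3)"

definition symmetric_matrices :: "(real^3^3) set" where
  "symmetric_matrices = {S. transpose S = S}"

text \<open>The type \<open>state\<close> contains all matrices; the actual state space is this linear subspace.\<close>

definition state_space :: "state set" where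
  "state_space = {(u, b, S, a). S \<in> symmetric_matrices}"

definition tensor :: "real^3 \<Rightarrow> real^3 \<Rightarrow> real^3^3" where
  "tensor v w = (\<chi> i j. v $ i * w $ j)"

definition constraint_set :: "state set" where
  "constraint_set = {(u, b, S, a). (u, b, S, a) \<in> state_space \<and>
     (\<exists>p::real. S = tensor u u - tensor b b + p *\<^sub>R mat 1) \<and> a = cross3 b u}"

definition wave_cone :: "state set" where
  "wave_cone = {(u, b, S, a). (u, b, S, a) \<in> state_space \<and>
     (\<exists>\<xi> c::real. \<xi> \<noteq> 0 \<and> S *v \<xi> + c *\<^sub>R u = 0 \<and> cross3 \<xi> a + c *\<^sub>R b = 0 \<and>
        u \<bullet> \<xi> = 0 \<and> b \<bullet> \<xi> = 0)}"

text \<open>Only the values of \<open>f\<close> on the state space matter here and in the hull.\<close>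

definition Lambda_convex :: "(state \<Rightarrow> real) \<Rightarrow> bool" where
  "Lambda_convex f \<longleftrightarrow>
     (\<forall>V\<in>state_space. \<forall>W\<in>wave_cone. convex_on UNIV (\<lambda>t::real. f (V + t *\<^sub>R W)))"

definition Lambda_convex_hull :: "state set \<Rightarrow> state set" where
  "Lambda_convex_hull A = {W \<in> state_space.
     \<forall>f. Lambda_convex f \<and> (\<forall>V\<in>A. f V \<le> 0) \<longrightarrow> f W \<le> 0}"

end

theory Submission
  imports Defs
begin

text \<open>The quadratic form \<open>a \<bullet> b\<close> vanishes on the wave cone and on \<open>K\<close>, so it is \<open>\<Lambda>\<close>-affine and hence
  vanishes on the hull. It is the flux of magnetic helicity: pairing \<open>\<Psi>\<close> with \<open>b\<close> through a trigonometric
  kernel \<open>k(x - y)\<close> involves finitely many Fourier modes, for which \<open>\<partial>\<^sub>t b = - curl a\<close> is an ordinary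
  differential equation in time, and each mode satisfies \<open>(\<Psi> \<bullet> b)' = - 2 a \<bullet> b\<close>. For a
  positive trigonometric approximate identity both regularised quantities converge in \<open>L\<^sup>1\<close> in time,
  because \<open>a\<close> and \<open>b\<close> lie in the dual spaces \<open>L\<^sup>3\<^sup>/\<^sup>2\<close> and \<open>L\<^sup>3\<close>; the flux tends to
  \<open>- 2 \<integral> a \<bullet> b = 0\<close>.\<close>

section \<open>Orthogonality on the hull and smooth functions\<close>

text \<open>Neither \<open>\<Psi>\<close> nor \<open>b\<close> has any regularity in time, so the
  product \<open>\<Psi> \<bullet> b\<close> cannot be differentiated directly. Restricting to one
  frequency removes this obstacle: on divergence-free modes the square of curl is multiplication by
  \<open>\<kappa> \<bullet> \<kappa>\<close>, so the potential is recovered from \<open>b\<close> by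
  algebra. The helicity of a mode is then a quadratic form in \<open>b\<close> alone, only
  \<open>b\<close> is ever differentiated, and the factor 2 reflects the symmetry of curl. Powers of
  a nonnegative cosine product serve as kernels instead of sharp Fourier cutoffs: nonnegativity,
  evenness and unit mass make averaging bounded in each variable separately, which is what the Young
  estimate of the error requires. Every kernel brings its own constant of integration. These
  constants are not shown to converge; a function that is close in mean to some sequence of
  constants is itself constant.\<close>

lemma inner_mult_eq_zero_on_wave_cone:
  assumes "(u, b, S, a) \<in> wave_cone"
  shows "a \<bullet> b = 0"
proof -
  obtain \<xi> and c :: real where \<xi>: "\<xi> \<noteq> 0" "cross3 \<xi> a + c *\<^sub>R b = 0" "b \<bullet> \<xi> = 0"
    using assms by (auto simp: wave_cone_def)
  show ?thesis
  proof (cases "c = 0")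
    case True
    \<comment> \<open>With \<open>c = 0\<close> the vector \<open>a\<close> is parallel to
      \<open>\<xi>\<close>, and \<open>b\<close> is orthogonal to \<open>\<xi>\<close>.\<close>
    then have "collinear {0, \<xi>, a}"
      using \<xi> by (simp add: cross_eq_0)
    then obtain r where "a = r *\<^sub>R \<xi>"
      using \<xi>(1) by (auto simp: collinear_lemma)
    then show ?thesis
      using \<xi>(3) by (simp add: inner_commute)
  next
    case False
    \<comment> \<open>Pairing the cone relation with \<open>a\<close> removes the triple
      product.\<close>
    have "c * (a \<bullet> b) = a \<bullet> (cross3 \<xi> a + c *\<^sub>R b)"
      by (simp add: inner_add_right dot_cross_self)
    then show ?thesis
      using \<xi>(2) False by simp
  qed
qed

text \<open>A function that is affine along the wave cone is \<open>\<Lambda>\<close>-convex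
  together with its negative, so the one-sided condition defining the hull applies with both signs.
  On \<open>constraint_set\<close> the vector \<open>a\<close> is a cross product with
  \<open>b\<close>, hence orthogonal to it.\<close>

lemma inner_eq_zero_on_hull:
  assumes "(u, b, S, a) \<in> Lambda_convex_hull constraint_set"
  shows "a \<bullet> b = 0"
proof -
  define f :: "state \<Rightarrow> real" where "f = (\<lambda>(u, b, S, a). a \<bullet> b)"
  have aff: "\<exists>p q. \<forall>t. f (V + t *\<^sub>R W) = p + t * q" if "W \<in> wave_cone" for V W
  proof -
    obtain u b S a u' b' S' a' where [simp]: "V = (u, b, S, a)" "W = (u', b', S', a')"
      by (metis prod_cases4)
    have "a' \<bullet> b' = 0"
      using that inner_mult_eq_zero_on_wave_cone by simp
    \<comment> \<open>The coefficient of the square of \<open>t\<close> is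
      \<open>a' \<bullet> b'\<close>, which vanishes on the wave cone.\<close>
    then have "\<forall>t. f (V + t *\<^sub>R W) = a \<bullet> b + t * (a \<bullet> b' + a' \<bullet> b)"
      by (simp add: f_def inner_add_left inner_add_right algebra_simps)
    then show ?thesis by blast
  qed
  have "Lambda_convex (\<lambda>V. s * f V)" for s
    unfolding Lambda_convex_def
  proof (intro ballI)
    fix V W :: state
    assume "W \<in> wave_cone"
    then obtain p q where "\<forall>t. f (V + t *\<^sub>R W) = p + t * q"
      using aff by blast
    then show "convex_on UNIV (\<lambda>t. s * f (V + t *\<^sub>R W))"
      by (auto intro!: convex_onI simp: algebra_simps)
  qed
  moreover have "s * f V \<le> 0" if "V \<in> constraint_set" for s V
    using that by (auto simp: constraint_set_def f_def dot_cross_self)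
  ultimately have "s * f (u, b, S, a) \<le> 0" for s
    using assms unfolding Lambda_convex_hull_def by fastforce
  from this[of 1] this[of "-1"] show ?thesis
    by (simp add: f_def)
qed

section \<open>Closure rules for the recursive smoothness predicate\<close>

lemma C_k_Suc_imp: "C_k (Suc k) f \<Longrightarrow> C_k k f"
proof (induction k arbitrary: f)
  case 0
  then show ?case
    by (auto simp: continuous_on_eq_continuous_at differentiable_imp_continuous_within)
qed auto

text \<open>Smoothness as a fixed point, so that later arguments need not count orders. From right
  to left only the positive orders are immediate; order zero follows because \<open>C_k\<close>
  decreases in \<open>k\<close>.\<close>

lemma C_infinity_iff:
  "C_infinity f \<longleftrightarrow> (\<forall>x. f differentiable (at x)) \<and>
     (\<forall>v\<in>Basis. C_infinity (\<lambda>x. frechet_derivative f (at x) v))"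
  (is "?l \<longleftrightarrow> ?r")
proof
  assume ?l
  then have "C_k (Suc k) f" for k
    unfolding C_infinity_def by blast
  then show ?r
    unfolding C_infinity_def by simp
next
  assume ?r
  then have "C_k (Suc k) f" for k
    unfolding C_infinity_def by simp
  then show ?l
    unfolding C_infinity_def using C_k_Suc_imp by blast
qed

lemma C_infinity_const: "C_infinity (\<lambda>x. c)"
proof -
  have "C_k k (\<lambda>x::'a. c)" for k c
    by (induction k arbitrary: c) (auto simp: frechet_derivative_const)
  then show ?thesis
    by (simp add: C_infinity_def)
qed

lemma C_k_add: "C_k k f \<Longrightarrow> C_k k g \<Longrightarrow> C_k k (\<lambda>x. f x + g x)"
proof (induction k arbitrary: f g)
  case (Suc k)
  have "frechet_derivative (\<lambda>x. f x + g x) (at x) =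
      (\<lambda>v. frechet_derivative f (at x) v + frechet_derivative g (at x) v)" for x
    using Suc.prems frechet_derivative_works
    by (intro frechet_derivative_at[symmetric] has_derivative_add) auto
  then show ?case
    using Suc by auto
qed (auto intro: continuous_on_add)

lemma C_k_mult: "C_k k f \<Longrightarrow> C_k k g \<Longrightarrow> C_k k (\<lambda>x. f x * g x)"
proof (induction k arbitrary: f g)
  case (Suc k)
  have "frechet_derivative (\<lambda>x. f x * g x) (at x) =
      (\<lambda>v. f x * frechet_derivative g (at x) v + frechet_derivative f (at x) v * g x)" for x
    using Suc.prems frechet_derivative_works
    by (intro frechet_derivative_at[symmetric] has_derivative_mult) auto
  then show ?case
    using Suc C_k_Suc_imp[OF Suc.prems(1)] C_k_Suc_imp[OF Suc.prems(2)]
    by (auto intro!: C_k_add)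
qed (auto intro: continuous_on_mult)

lemma C_infinity_add: "C_infinity f \<Longrightarrow> C_infinity g \<Longrightarrow> C_infinity (\<lambda>x. f x + g x)"
  by (simp add: C_infinity_def C_k_add)

lemma C_infinity_mult: "C_infinity f \<Longrightarrow> C_infinity g \<Longrightarrow> C_infinity (\<lambda>x. f x * g x)"
  by (simp add: C_infinity_def C_k_mult)

lemma frechet_derivative_real:
  assumes "(f has_real_derivative d) (at x)"
  shows "frechet_derivative f (at x) v = d * v"
  using frechet_derivative_at[OF assms[unfolded has_field_derivative_def]] by metis

lemma C_infinity_real_iff:
  fixes h h' :: "real \<Rightarrow> real"
  assumes "\<And>x. (h has_real_derivative h' x) (at x)"
  shows "C_infinity h \<longleftrightarrow> C_infinity h'"
  using frechet_derivative_real[OF assms] assms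
  by (subst C_infinity_iff) (auto simp: real_differentiable_def)

text \<open>Coinduction for smoothness: what matters is that differentiation does not leave the
  family. It is applied to the four signed trigonometric functions and to the range of
  \<open>flat_exp\<close>.\<close>

lemma C_infinity_coinduct:
  fixes F :: "(real \<Rightarrow> real) set"
  assumes "h \<in> F" and "\<And>h. h \<in> F \<Longrightarrow> \<exists>h'\<in>F. \<forall>x. (h has_real_derivative h' x) (at x)"
  shows "C_infinity h"
proof -
  have "C_k k h" if "h \<in> F" for h k
    using that
  proof (induction k arbitrary: h)
    case 0
    then show ?case
      using assms(2)[OF 0] DERIV_isCont by (auto simp: continuous_on_eq_continuous_at)
  next
    case (Suc k)
    obtain h' where h': "h' \<in> F" "\<And>x. (h has_real_derivative h' x) (at x)"
      using assms(2)[OF Suc.prems] by blast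
    then show ?case
      using Suc.IH[OF h'(1)] frechet_derivative_real[OF h'(2)]
      by (auto simp: real_differentiable_def)
  qed
  then show ?thesis
    using assms(1) by (simp add: C_infinity_def)
qed

lemma C_infinity_DERIV:
  fixes h :: "real \<Rightarrow> real"
  assumes "C_infinity h"
  obtains h' where "C_infinity h'" "\<And>x. (h has_real_derivative h' x) (at x)"
proof -
  have "\<exists>h'. \<forall>x. (h has_real_derivative h' x) (at x)"
    using assms[unfolded C_infinity_iff[of h]] by (metis real_differentiable_def)
  then show ?thesis
    using that assms C_infinity_real_iff by blast
qed

text \<open>By the chain rule a directional derivative is again of this form, with \<open>h'\<close>
  in place of \<open>h\<close>, times the constant \<open>L v\<close>. The induction therefore runs
  over all \<open>h\<close> at once.\<close>

lemma C_infinity_compose_linear: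
  fixes h :: "real \<Rightarrow> real" and L :: "'a::euclidean_space \<Rightarrow> real"
  assumes "bounded_linear L" and "C_infinity h"
  shows "C_infinity (\<lambda>x. h (L x + c))"
proof -
  have "C_k k (\<lambda>x. h (L x + c))" if "C_infinity h" for k h
    using that
  proof (induction k arbitrary: h)
    case 0
    then have "continuous_on UNIV h"
      unfolding C_infinity_def by (metis C_k.simps(1))
    moreover have "continuous_on UNIV (\<lambda>x. L x + c)"
      using linear_continuous_on[OF assms(1)] by (intro continuous_intros)
    ultimately show ?case
      by (auto intro: continuous_on_compose2)
  next
    case (Suc k)
    obtain h' where h': "C_infinity h'" "\<And>x. (h has_real_derivative h' x) (at x)"
      using C_infinity_DERIV[OF Suc.prems] by blast
    have "((\<lambda>x. L x + c) has_derivative L) (at x)" for x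
      using has_derivative_add_const[OF bounded_linear_imp_has_derivative[OF assms(1)]] .
    then have d: "((\<lambda>x. h (L x + c)) has_derivative (\<lambda>v. h' (L x + c) * L v)) (at x)" for x
      using has_derivative_compose h'(2)[unfolded has_field_derivative_def] by blast
    have "frechet_derivative (\<lambda>x. h (L x + c)) (at x) v = h' (L x + c) * L v" for x v
      using frechet_derivative_at[OF d] by metis
    moreover have "C_k k (\<lambda>x. r)" for r
      using C_infinity_const by (auto simp: C_infinity_def)
    moreover have "(\<lambda>x. h (L x + c)) differentiable (at x)" for x
      using d differentiable_def by blast
    ultimately show ?case
      using Suc.IH[OF h'(1)] by (auto intro!: C_k_mult)
  qed
  then show ?thesis
    using assms(2) by (simp add: C_infinity_def)
qed

lemma C_infinity_sin: "C_infinity (sin :: real \<Rightarrow> real)"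
  and C_infinity_cos: "C_infinity (cos :: real \<Rightarrow> real)"
proof -
  let ?F = "{sin, cos, \<lambda>x. - sin x, \<lambda>x. - cos x :: real}"
  have "\<exists>h'\<in>?F. \<forall>x. (h has_real_derivative h' x) (at x)" if "h \<in> ?F" for h
    using that by (auto intro!: derivative_eq_intros)
  then show "C_infinity (sin :: real \<Rightarrow> real)" "C_infinity (cos :: real \<Rightarrow> real)"
    by (auto intro: C_infinity_coinduct[of _ ?F])
qed

section \<open>Smooth cutoffs built from the function exp(-1/x)\<close>

definition flat_exp :: "real poly \<Rightarrow> real \<Rightarrow> real" where
  "flat_exp p x = (if x \<le> 0 then 0 else poly p (1 / x) * exp (- (1 / x)))"

lemma poly_mult_exp_minus_tendsto_0:
  fixes p :: "real poly"
  shows "((\<lambda>x. poly p x * exp (- x)) \<longlongrightarrow> 0) at_top"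
proof -
  have "((\<lambda>x. \<Sum>i\<le>degree p. coeff p i * (x ^ i / exp x)) \<longlongrightarrow> (\<Sum>i\<le>degree p. coeff p i * 0)) at_top"
    by (intro tendsto_sum tendsto_mult_left tendsto_power_div_exp_0)
  then show ?thesis
    by (simp add: poly_altdef sum_distrib_right exp_minus divide_inverse mult.assoc)
qed

text \<open>In the variable y = 1/x differentiation in x is multiplication of the y-derivative by
  the negative square of y, which explains the factor \<open>[:0, 0, 1:]\<close> and the difference
  \<open>p - pderiv p\<close>. The polynomial parameter exists so that the family is closed under
  this operation, also across zero.\<close>

lemma flat_exp_DERIV:
  "(flat_exp p has_real_derivative flat_exp ([:0, 0, 1:] * (p - pderiv p)) x) (at x)"
proof -
  consider "x < 0" | "x = 0" | "x > 0" by linarith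
  then show ?thesis
  proof cases
    case 1
    have "(flat_exp p has_real_derivative 0) (at x)"
      by (rule has_field_derivative_transform_within_open[of "\<lambda>x. 0" _ _ "{..<0}"])
        (use 1 in \<open>auto simp: flat_exp_def\<close>)
    then show ?thesis
      using 1 by (simp add: flat_exp_def)
  next
    case 2
    have "((\<lambda>y. flat_exp p y / y) \<longlongrightarrow> 0) (at_right 0)"
      \<comment> \<open>Dividing by \<open>y\<close> in the difference quotient is multiplication by
        the reciprocal variable, hence the extra factor \<open>[:0, 1:]\<close>.\<close>
      using poly_mult_exp_minus_tendsto_0[of "[:0, 1:] * p"]
      unfolding filterlim_at_right_to_top
      by (rule Lim_transform_eventually)
        (auto simp: flat_exp_def field_simps intro!: eventually_mono[OF eventually_gt_at_top[of 0]])
    moreover have "((\<lambda>y. flat_exp p y / y) \<longlongrightarrow> 0) (at_left 0)"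
      by (rule tendsto_eventually)
        (auto simp: flat_exp_def eventually_at_filter)
    ultimately have "((\<lambda>y. flat_exp p y / y) \<longlongrightarrow> 0) (at 0)"
      by (simp add: filterlim_split_at)
    then show ?thesis
      using 2 by (simp add: has_field_derivative_iff flat_exp_def)
  next
    case 3
    have "((\<lambda>x. poly p (1 / x) * exp (- (1 / x))) has_real_derivative
        poly ([:0, 0, 1:] * (p - pderiv p)) (1 / x) * exp (- (1 / x))) (at x)"
      using 3 by (auto intro!: derivative_eq_intros poly_DERIV[THEN DERIV_chain2]
          simp: field_simps power2_eq_square)
    then have "(flat_exp p has_real_derivative
        poly ([:0, 0, 1:] * (p - pderiv p)) (1 / x) * exp (- (1 / x))) (at x)"
      by (rule has_field_derivative_transform_within_open[of _ _ _ "{0<..}"])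
        (use 3 in \<open>auto simp: flat_exp_def\<close>)
    then show ?thesis
      using 3 by (simp add: flat_exp_def)
  qed
qed

lemma C_infinity_flat_exp: "C_infinity (flat_exp p)"
  using flat_exp_DERIV by (intro C_infinity_coinduct[of _ "range flat_exp"]) blast+

text \<open>The arguments are shifted by one so that the support lies compactly inside the interval.\<close>

definition plateau :: "real \<Rightarrow> real \<Rightarrow> nat \<Rightarrow> real \<Rightarrow> real" where
  "plateau p q n x = flat_exp 1 (real (Suc n) * (x - p) - 1) * flat_exp 1 (real (Suc n) * (q - x) - 1)"

lemma C_infinity_plateau: "C_infinity (plateau p q n)"
proof -
  have "C_infinity (\<lambda>x. flat_exp 1 (real (Suc n) * x + (- real (Suc n) * p - 1)))"
    "C_infinity (\<lambda>x. flat_exp 1 ((- real (Suc n)) * x + (real (Suc n) * q - 1)))"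
    by (intro C_infinity_compose_linear C_infinity_flat_exp bounded_linear_mult_right)+
  from C_infinity_mult[OF this] show ?thesis
    by (rule back_subst[of C_infinity]) (auto simp: plateau_def algebra_simps)
qed

lemma flat_exp_1_bounds: "0 \<le> flat_exp 1 y" "flat_exp 1 y \<le> 1"
  by (simp_all add: flat_exp_def)

lemma plateau_bounds: "0 \<le> plateau p q n x" "plateau p q n x \<le> 1"
  by (simp_all add: plateau_def flat_exp_1_bounds mult_le_one)

lemma plateau_eq_0:
  assumes "x \<notin> {p + 1 / real (Suc n)<..<q - 1 / real (Suc n)}"
  shows "plateau p q n x = 0"
proof -
  have "real (Suc n) * (x - p) - 1 \<le> 0 \<or> real (Suc n) * (q - x) - 1 \<le> 0"
    using assms by (auto simp: field_simps)
  then show ?thesis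
    by (auto simp: plateau_def flat_exp_def)
qed

lemma plateau_pos:
  assumes "x \<in> {p + 1 / real (Suc n)<..<q - 1 / real (Suc n)}"
  shows "plateau p q n x > 0"
proof -
  have "real (Suc n) * (x - p) - 1 > 0" "real (Suc n) * (q - x) - 1 > 0"
    using assms by (auto simp: field_simps)
  then show ?thesis
    by (auto simp: plateau_def flat_exp_def)
qed

text \<open>Inside the interval both arguments grow linearly in \<open>n\<close>, and exp(-1/z)
  tends to 1 at infinity; outside, every member of the sequence vanishes. This is how indicators of
  intervals become limits of test functions.\<close>

lemma plateau_tendsto: "(\<lambda>n. plateau p q n x) \<longlonglongrightarrow> indicator {p<..<q} x"
proof (cases "x \<in> {p<..<q}")
  case True
  have "(\<lambda>n. flat_exp 1 (real (Suc n) * y - 1)) \<longlonglongrightarrow> 1" if "y > 0" for y :: real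
  proof -
    have "filterlim (\<lambda>n. real (Suc n)) at_top sequentially"
      by (rule filterlim_compose[OF filterlim_real_sequentially filterlim_Suc])
    from filterlim_tendsto_add_at_top[OF tendsto_const[of "- 1"]
        filterlim_at_top_mult_tendsto_pos[OF tendsto_const[of y] that this]]
    have lim: "filterlim (\<lambda>n. real (Suc n) * y - 1) at_top sequentially"
      by (simp add: add.commute)
    have "((\<lambda>z::real. exp (- (1 / z))) \<longlongrightarrow> 1) at_top"
      using tendsto_exp[OF tendsto_minus[OF tendsto_divide_0[OF tendsto_const[of 1] filterlim_at_top_imp_at_infinity[OF filterlim_ident]]]] by simp
    then have "(flat_exp 1 \<longlongrightarrow> 1) at_top"
      by (rule Lim_transform_eventually)
        (auto simp: flat_exp_def intro!: eventually_mono[OF eventually_gt_at_top[of 0]])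
    then show ?thesis
      using lim by (rule filterlim_compose)
  qed
  from tendsto_mult[OF this[of "x - p"] this[of "q - x"]] True show ?thesis
    by (auto simp: plateau_def)
next
  case False
  have "x \<notin> {p + 1 / real (Suc n)<..<q - 1 / real (Suc n)}" for n
  proof
    assume "x \<in> {p + 1 / real (Suc n)<..<q - 1 / real (Suc n)}"
    moreover have "1 / real (Suc n) > 0" by simp
    ultimately have "p < x" "x < q"
      unfolding greaterThanLessThan_iff by linarith+
    then show False using False by simp
  qed
  then show ?thesis
    using False by (simp add: plateau_eq_0)
qed

definition interval_test_function :: "real \<Rightarrow> (real \<Rightarrow> real) \<Rightarrow> bool" where
  "interval_test_function T \<eta> \<longleftrightarrow> C_infinity \<eta> \<and>
     (\<exists>r s. 0 < r \<and> r \<le> s \<and> s < T \<and> (\<forall>t. t \<notin> {r..s} \<longrightarrow> \<eta> t = 0))"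

lemma interval_test_function_plateau:
  assumes "0 \<le> p" "p < q" "q \<le> T"
  shows "interval_test_function T (plateau p q n)"
proof -
  define d where "d = 1 / real (Suc n)"
  have "d > 0" by (simp add: d_def)
  have 0: "plateau p q n t = 0" if "t \<notin> {p + d<..<q - d}" for t
    using plateau_eq_0[of t p n q] that by (simp add: d_def)
  show ?thesis
  proof (cases "p + d \<le> q - d")
    case True
    then show ?thesis
      unfolding interval_test_function_def using 0 \<open>d > 0\<close> assms C_infinity_plateau
      by (intro conjI exI[of _ "p + d"] exI[of _ "q - d"]) auto
  next
    case False
    then have "plateau p q n t = 0" for t
      using 0 by auto
    then show ?thesis
      unfolding interval_test_function_def using assms C_infinity_plateau
      \<comment> \<open>The two margins meet and the function is identically zero; the support only
        has to be some nonempty compact interval, here the single point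
        \<open>T / 2\<close>.\<close>
      by (intro conjI exI[of _ "T / 2"]) auto
  qed
qed

section \<open>The fundamental lemma of the calculus of variations\<close>

lemma C_infinity_imp_continuous: "C_infinity f \<Longrightarrow> continuous_on UNIV f"
  unfolding C_infinity_def by (metis C_k.simps(1))

lemma integrable_lborel_compact_support:
  fixes f :: "real \<Rightarrow> real"
  assumes "continuous_on UNIV f" and "\<And>t. t \<notin> {r..s} \<Longrightarrow> f t = 0"
  shows "integrable lborel f"
proof -
  have "set_integrable lborel {r..s} f"
    by (rule borel_integrable_atLeastAtMost') (rule continuous_on_subset[OF assms(1)], simp)
  moreover have "(\<lambda>x. indicat_real {r..s} x *\<^sub>R f x) = f"
    using assms(2) by (fastforce simp: fun_eq_iff indicator_def)
  ultimately show ?thesis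
    by (simp add: set_integrable_def)
qed

lemma bounded_compact_support:
  fixes f :: "real \<Rightarrow> real"
  assumes "continuous_on UNIV f" and "\<And>t. t \<notin> {r..s} \<Longrightarrow> f t = 0"
  obtains B where "\<And>t. \<bar>f t\<bar> \<le> B"
proof -
  have "bounded (f ` {r..s})"
    using assms(1) by (intro compact_imp_bounded compact_continuous_image)
      (auto intro: continuous_on_subset)
  then obtain B where B: "\<forall>t\<in>{r..s}. \<bar>f t\<bar> \<le> B"
    by (auto simp: bounded_iff)
  have "\<bar>f t\<bar> \<le> max B 0" for t
    using B assms(2)[of t] by (cases "t \<in> {r..s}") (auto simp: le_max_iff_disj)
  then show ?thesis using that by blast
qed

lemma interval_test_functionE:
  assumes "interval_test_function T \<eta>"
  obtains r s where "C_infinity \<eta>" "0 < r" "r \<le> s" "s < T" "\<And>t. t \<notin> {r..s} \<Longrightarrow> \<eta> t = 0"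
  using assms that unfolding interval_test_function_def by blast

lemma interval_test_function_DERIV:
  assumes "interval_test_function T \<eta>"
  obtains \<eta>' where "interval_test_function T \<eta>'" "\<And>t. (\<eta> has_real_derivative \<eta>' t) (at t)"
proof -
  obtain r s where rs: "C_infinity \<eta>" "0 < r" "r \<le> s" "s < T" "\<And>t. t \<notin> {r..s} \<Longrightarrow> \<eta> t = 0"
    using interval_test_functionE[OF assms] by blast
  obtain \<eta>' where \<eta>': "C_infinity \<eta>'" "\<And>x. (\<eta> has_real_derivative \<eta>' x) (at x)"
    using C_infinity_DERIV[OF rs(1)] by blast
  have "\<eta>' t = 0" if "t \<notin> {r..s}" for t
  proof -
    have "(\<eta> has_real_derivative 0) (at t)"
      by (rule has_field_derivative_transform_within_open[of "\<lambda>x. 0" _ _ "- {r..s}"])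
        (use that rs(5) in auto)
    then show ?thesis
      using \<eta>'(2) DERIV_unique by blast
  qed
  then show ?thesis
    using that \<eta>' rs unfolding interval_test_function_def by blast
qed

lemma continuous_antiderivative:
  fixes v :: "real \<Rightarrow> real"
  assumes "continuous_on UNIV v"
  obtains V where "\<And>x. (V has_real_derivative v x) (at x)"
proof -
  have "\<exists>V. \<forall>x::real. - \<infinity> < ereal x \<longrightarrow> ereal x < \<infinity> \<longrightarrow> (V has_vector_derivative v x) (at x)"
    by (rule einterval_antiderivative)
      (use assms in \<open>auto simp: continuous_on_eq_continuous_at\<close>)
  then show ?thesis
    using that by (auto simp: has_real_derivative_iff_has_vector_derivative)
qed

text \<open>A primitive is constant on either side of the support. The vanishing integral says that
  the two constants agree, and subtracting their common value restores compact support.\<close>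

lemma interval_test_function_antiderivative:
  assumes "interval_test_function T \<zeta>" and "integral\<^sup>L lborel \<zeta> = 0"
  obtains \<eta> where "interval_test_function T \<eta>" "\<And>t. (\<eta> has_real_derivative \<zeta> t) (at t)"
proof -
  obtain r s where rs: "C_infinity \<zeta>" "0 < r" "r \<le> s" "s < T" "\<And>t. t \<notin> {r..s} \<Longrightarrow> \<zeta> t = 0"
    using interval_test_functionE[OF assms(1)] by blast
  have cont: "continuous_on UNIV \<zeta>"
    using rs(1) by (rule C_infinity_imp_continuous)
  obtain F where F: "\<And>x. (F has_real_derivative \<zeta> x) (at x)"
    using continuous_antiderivative[OF cont] by blast
  have const: "\<exists>c. \<forall>t\<in>S. F t = c" if "convex S" "S \<inter> {r..s} = {}" for S
    using that rs(5) F
    by (intro has_field_derivative_zero_constant) (metis disjoint_iff has_field_derivative_at_within)+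
  obtain c where c: "\<forall>t\<in>{..<r}. F t = c"
    using const[of "{..<r}"] by (metis convex_real_interval(4) disjoint_iff atLeastAtMost_iff lessThan_iff not_less)
  obtain d where d: "\<forall>t\<in>{s<..}. F t = d"
    using const[of "{s<..}"] by (metis convex_real_interval(3) disjoint_iff atLeastAtMost_iff greaterThan_iff not_less)
  have "(\<lambda>x. indicator {0..T} x *\<^sub>R \<zeta> x) = \<zeta>"
  proof (rule ext)
    show "indicator {0..T} x *\<^sub>R \<zeta> x = \<zeta> x" for x
      using rs(2-5) by (cases "x \<in> {0..T}") (auto simp del: atLeastAtMost_iff, force)
  qed
  moreover have "(\<integral>x. indicator {0..T} x *\<^sub>R \<zeta> x \<partial>lborel) = F T - F 0"
  proof (rule integral_FTC_atLeastAtMost)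
    show "(F has_vector_derivative \<zeta> x) (at x within {0..T})" for x
      using has_field_derivative_at_within[OF F]
      by (simp add: has_real_derivative_iff_has_vector_derivative)
    show "continuous_on {0..T} \<zeta>"
      using cont continuous_on_subset by blast
  qed (use rs in simp)
  ultimately have "c = d"
    using assms(2) c d rs by simp
  define \<eta> where "\<eta> t = F t - c" for t
  have der: "(\<eta> has_real_derivative \<zeta> t) (at t)" for t
    unfolding \<eta>_def using F[of t] by (auto intro!: derivative_eq_intros)
  moreover have "C_infinity \<eta>"
    using C_infinity_real_iff[OF der] rs(1) by blast
  moreover have "\<eta> t = 0" if "t \<notin> {r..s}" for t
    using that c d \<open>c = d\<close> by (cases "t < r") (auto simp: \<eta>_def)
  ultimately show ?thesis
    using that rs unfolding interval_test_function_def by blast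
qed

lemma interval_test_function_lincomb:
  assumes "interval_test_function T f" "interval_test_function T g"
  shows "interval_test_function T (\<lambda>t. f t + c * g t)"
proof -
  obtain r s where 1: "C_infinity f" "0 < r" "r \<le> s" "s < T" "\<And>t. t \<notin> {r..s} \<Longrightarrow> f t = 0"
    using interval_test_functionE[OF assms(1)] by blast
  obtain r' s' where 2: "C_infinity g" "0 < r'" "r' \<le> s'" "s' < T" "\<And>t. t \<notin> {r'..s'} \<Longrightarrow> g t = 0"
    using interval_test_functionE[OF assms(2)] by blast
  have "f t + c * g t = 0" if "t \<notin> {min r r'..max s s'}" for t
    using that 1(5)[of t] 2(5)[of t] by (auto simp: min_le_iff_disj le_max_iff_disj)
  then show ?thesis
    unfolding interval_test_function_def
    using 1 2 by (intro conjI exI[of _ "min r r'"] exI[of _ "max s s'"]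
        C_infinity_add C_infinity_mult C_infinity_const) auto
qed

lemma interval_test_function_integrable:
  assumes "interval_test_function T \<eta>"
  shows "integrable lborel \<eta>"
  by (rule interval_test_functionE[OF assms])
    (rule integrable_lborel_compact_support, rule C_infinity_imp_continuous)

lemma interval_test_function_integrable_mult:
  assumes "interval_test_function T \<eta>" and "integrable lborel f"
  shows "integrable lborel (\<lambda>t. f t * \<eta> t)"
proof -
  obtain r s where rs: "C_infinity \<eta>" "\<And>t. t \<notin> {r..s} \<Longrightarrow> \<eta> t = 0"
    using interval_test_functionE[OF assms(1)] by blast
  have cont: "continuous_on UNIV \<eta>"
    using rs(1) by (rule C_infinity_imp_continuous)
  then have [measurable]: "\<eta> \<in> borel_measurable borel"
    by (rule borel_measurable_continuous_onI)
  have [measurable]: "f \<in> borel_measurable borel"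
    using assms(2) by auto
  obtain B where B: "\<And>t. \<bar>\<eta> t\<bar> \<le> B"
    using bounded_compact_support[OF cont rs(2)] by blast
  show ?thesis
    by (rule Bochner_Integration.integrable_bound[OF integrable_mult_left[OF integrable_norm[OF assms(2)], of B]])
      (auto simp: abs_mult intro!: mult_left_mono order.trans[OF B])
qed

text \<open>Half-lines form an intersection-stable generator of the Borel sets, so the identity
  extends to all Borel sets by the induction over disjoint unions and complements. Complements need
  the total integral to vanish, which is obtained as a limit over growing half-lines.\<close>

lemma AE_eq_0_if_integral_greaterThan_eq_0:
  fixes g :: "real \<Rightarrow> real"
  assumes int: "integrable lborel g" and 0: "\<And>x. (\<integral>t. indicator {x<..} t * g t \<partial>lborel) = 0"
  shows "AE t in lborel. g t = 0"
proof -
  have int_ind: "integrable lborel (\<lambda>t. indicator A t * g t)" if "A \<in> sets borel" for A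
    using integrable_mult_indicator[OF _ int, of A] that by simp
  have "(\<lambda>n. \<integral>t. indicator {- real n<..} t * g t \<partial>lborel) \<longlonglongrightarrow> integral\<^sup>L lborel g"
  proof (rule integral_dominated_convergence)
    show "integrable lborel (\<lambda>t. \<bar>g t\<bar>)"
      using int by simp
    show "AE t in lborel. (\<lambda>n. indicator {- real n<..} t * g t) \<longlonglongrightarrow> g t"
    proof (rule AE_I2)
      fix t :: real
      obtain N where "- t < real N"
        using reals_Archimedean2 by blast
      then have "\<forall>\<^sub>F n in sequentially. indicator {- real n<..} t * g t = g t"
        by (intro eventually_sequentiallyI[of N]) (auto simp: indicator_def)
      then show "(\<lambda>n. indicator {- real n<..} t * g t) \<longlonglongrightarrow> g t"
        by (rule tendsto_eventually)
    qed
  qed (use int int_ind in \<open>auto simp: indicator_def\<close>)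
  then have total: "integral\<^sup>L lborel g = 0"
    by (simp add: 0 LIMSEQ_const_iff)
  let ?E = "range (\<lambda>x::real. {x<..})"
  have sets_E: "sets (borel :: real measure) = sigma_sets UNIV ?E"
    by (simp add: borel_Ioi)
  have stable: "Int_stable ?E"
  proof (rule Int_stableI)
    fix A B :: "real set"
    assume "A \<in> ?E" "B \<in> ?E"
    then obtain x y where "A = {x<..}" "B = {y<..}" by blast
    then have "A \<inter> B = {max x y<..}" by auto
    then show "A \<inter> B \<in> ?E" by blast
  qed
  have Pow_UNIV_E: "?E \<subseteq> Pow UNIV"
    by simp
  have "(\<integral>t. indicator A t * g t \<partial>lborel) = 0" if "A \<in> sigma_sets UNIV ?E" for A
    using stable Pow_UNIV_E that
  proof (induction rule: sigma_sets_induct_disjoint)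
    case (compl A)
    then have "(\<integral>t. g t - indicator A t * g t \<partial>lborel) = 0"
      using int_ind int total sets_E by (subst Bochner_Integration.integral_diff) auto
    moreover have "(\<lambda>t. indicator (UNIV - A) t * g t) = (\<lambda>t. g t - indicator A t * g t)"
      by (auto simp: indicator_def)
    ultimately show ?case by simp
  next
    case (union A)
    have "(\<Union>i. A i) \<in> sets borel"
      using union(2) sets_E by (intro sets.countable_UN) auto
    then have "(LINT t:(\<Union>i. A i)|lborel. g t) = (\<Sum>i. LINT t:A i|lborel. g t)"
      using union sets_E int_ind
      by (intro lebesgue_integral_countable_add)
        (auto simp: disjoint_family_on_def set_integrable_def)
    then show ?case
      using union by (simp add: set_lebesgue_integral_def)
  qed (use 0 in auto)
  then show ?thesis
    using int by (intro sigma_finite_measure.density_zero[OF lborel.sigma_finite_measure_axioms]) (auto simp: set_lebesgue_integral_def sets_E)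
qed

text \<open>Subtracting a multiple of one fixed bump \<open>\<omega>\<close> from a test function
  makes its mean zero, hence makes it the derivative of a test function, which \<open>f\<close>
  annihilates. So \<open>f\<close> minus a constant annihilates every test function, and plateaus
  then approximate indicators.\<close>

lemma du_Bois_Reymond:
  assumes T: "0 < T" and f: "integrable lborel f" "\<And>t. t \<notin> {0<..<T} \<Longrightarrow> f t = 0"
    and 0: "\<And>\<eta> \<eta>'. interval_test_function T \<eta> \<Longrightarrow> (\<And>t. (\<eta> has_real_derivative \<eta>' t) (at t)) \<Longrightarrow>
      (\<integral>t. f t * \<eta>' t \<partial>lborel) = 0"
  obtains c where "AE t in lborel. f t = c * indicator {0<..<T} t"
proof -
  \<comment> \<open>This makes the margin \<open>1 / real (Suc n)\<close> smaller than
    \<open>T / 2\<close>, so the midpoint lies where the bump is positive.\<close>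
  obtain n where n: "2 / T < real n"
    using reals_Archimedean2 by blast
  define \<omega> where "\<omega> = plateau 0 T n"
  have \<omega>: "interval_test_function T \<omega>"
    using T by (auto simp: \<omega>_def intro: interval_test_function_plateau)
  note \<omega>_int = interval_test_function_integrable[OF \<omega>]
  have "\<omega> (T / 2) > 0"
    unfolding \<omega>_def using n T by (intro plateau_pos) (auto simp: field_simps)
  have "integral\<^sup>L lborel \<omega> \<noteq> 0"
  proof
    assume "integral\<^sup>L lborel \<omega> = 0"
    then have "AE t in lborel. \<omega> t = 0"
      using \<omega>_int by (subst (asm) integral_nonneg_eq_0_iff_AE) (auto simp: \<omega>_def plateau_bounds)
    moreover have op: "open {t. \<omega> t \<noteq> 0}"
      using C_infinity_imp_continuous[of \<omega>] C_infinity_plateau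
      by (intro open_Collect_neq) (auto simp: \<omega>_def)
    ultimately have "{t. \<omega> t \<noteq> 0} \<in> null_sets lborel"
      by (subst AE_iff_null_sets) auto
    then have "{t. \<omega> t \<noteq> 0} \<in> null_sets lebesgue"
      by (rule null_sets_completionI)
    with op have "{t. \<omega> t \<noteq> 0} = {}"
      using open_not_negligible negligible_iff_null_sets by blast
    then show False
      using \<open>\<omega> (T / 2) > 0\<close> by auto
  qed
  \<comment> \<open>Forced by the requirement that \<open>g\<close> annihilate
    \<open>\<omega>\<close>.\<close>
  define c where "c = (\<integral>t. f t * \<omega> t \<partial>lborel) / integral\<^sup>L lborel \<omega>"
  define g where "g t = f t - c * indicator {0<..<T} t" for t
  have g_int: "integrable lborel g"
    unfolding g_def using f(1) T by (intro Bochner_Integration.integrable_diff integrable_mult_right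
      integrable_real_indicator) auto
  have g_test: "(\<integral>t. g t * \<theta> t \<partial>lborel) = 0" if \<theta>: "interval_test_function T \<theta>" for \<theta>
  proof -
    \<comment> \<open>The multiple of \<open>\<omega>\<close> whose removal gives
      \<open>\<theta>\<close> mean zero.\<close>
    define \<alpha> where "\<alpha> = integral\<^sup>L lborel \<theta> / integral\<^sup>L lborel \<omega>"
    have \<zeta>: "interval_test_function T (\<lambda>t. \<theta> t + (- \<alpha>) * \<omega> t)"
      using \<theta> \<omega> by (rule interval_test_function_lincomb)
    have \<theta>_int: "integrable lborel \<theta>"
      using \<theta> by (rule interval_test_function_integrable)
    have "(\<integral>t. \<theta> t + (- \<alpha>) * \<omega> t \<partial>lborel) = 0"
      using \<theta>_int \<omega>_int \<open>integral\<^sup>L lborel \<omega> \<noteq> 0\<close> by (simp add: \<alpha>_def)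
    then have "(\<integral>t. f t * (\<theta> t + (- \<alpha>) * \<omega> t) \<partial>lborel) = 0"
      by (rule interval_test_function_antiderivative[OF \<zeta>]) (rule 0)
    then have "(\<integral>t. f t * \<theta> t - \<alpha> * (f t * \<omega> t) \<partial>lborel) = 0"
      by (simp add: algebra_simps)
    then have 1: "(\<integral>t. f t * \<theta> t \<partial>lborel) = \<alpha> * (\<integral>t. f t * \<omega> t \<partial>lborel)"
      using interval_test_function_integrable_mult f(1) \<theta> \<omega> by simp
    obtain r s where "0 < r" "s < T" "\<And>t. t \<notin> {r..s} \<Longrightarrow> \<theta> t = 0"
      using interval_test_functionE[OF \<theta>] by metis
    then have "g t * \<theta> t = f t * \<theta> t - c * \<theta> t" for t
      by (cases "t \<in> {r..s}") (auto simp: g_def algebra_simps)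
    then have "(\<integral>t. g t * \<theta> t \<partial>lborel) = (\<integral>t. f t * \<theta> t \<partial>lborel) - c * integral\<^sup>L lborel \<theta>"
      using \<theta>_int interval_test_function_integrable_mult[OF \<theta> f(1)] by simp
    then show ?thesis
      using 1 by (simp add: c_def \<alpha>_def)
  qed
  have "(\<integral>t. indicator {x<..} t * g t \<partial>lborel) = 0" for x
  proof -
    \<comment> \<open>Since \<open>g\<close> vanishes outside the time interval, the half-line may
      be cut to an interval inside it, for which plateaus are admissible.\<close>
    define p where "p = max x 0"
    have ind: "(\<lambda>t. indicator {x<..} t * g t) = (\<lambda>t. indicator {p<..<T} t * g t)"
      using f(2) by (auto simp: fun_eq_iff g_def p_def indicator_def)
    show ?thesis
    proof (cases "p < T")
      case True
      have "(\<lambda>n. \<integral>t. g t * plateau p T n t \<partial>lborel) \<longlonglongrightarrow> (\<integral>t. g t * indicator {p<..<T} t \<partial>lborel)"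
      proof (rule integral_dominated_convergence)
        show "integrable lborel (\<lambda>t. \<bar>g t\<bar>)"
          using g_int by simp
        show "AE t in lborel. (\<lambda>n. g t * plateau p T n t) \<longlonglongrightarrow> g t * indicator {p<..<T} t"
          by (intro AE_I2 tendsto_mult_left plateau_tendsto)
        show "AE t in lborel. norm (g t * plateau p T n t) \<le> \<bar>g t\<bar>" for n
          by (intro AE_I2) (simp add: abs_mult mult_left_le plateau_bounds)
        have [measurable]: "g \<in> borel_measurable borel"
          using g_int by auto
        have [measurable]: "plateau p T n \<in> borel_measurable borel" for n
          by (intro borel_measurable_continuous_onI C_infinity_imp_continuous C_infinity_plateau)
        show "(\<lambda>t. g t * indicator {p<..<T} t) \<in> borel_measurable lborel"
          "(\<lambda>t. g t * plateau p T n t) \<in> borel_measurable lborel" for n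
          by measurable
      qed
      moreover have "(\<integral>t. g t * plateau p T n t \<partial>lborel) = 0" for n
        using True by (intro g_test interval_test_function_plateau) (auto simp: p_def)
      ultimately show ?thesis
        unfolding ind by (simp add: LIMSEQ_const_iff mult.commute)
    next
      case False
      then show ?thesis unfolding ind by simp
    qed
  qed
  then have "AE t in lborel. g t = 0"
    using g_int by (intro AE_eq_0_if_integral_greaterThan_eq_0)
  then show ?thesis
    using that[of c] by (simp add: g_def)
qed

section \<open>Primitives and integration by parts\<close>

text \<open>The integral starts at minus infinity, and the cutoff is part of the integrand over the
  whole line; measurability in \<open>t\<close> is then that of an integral with a
  parameter.\<close>

definition primitive :: "(real \<Rightarrow> 'a::euclidean_space) \<Rightarrow> real \<Rightarrow> 'a" where
  "primitive g t = (\<integral>s. (if s \<le> t then g s else 0) \<partial>lborel)"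

lemma integrable_if_le:
  fixes g :: "real \<Rightarrow> 'a::euclidean_space"
  assumes "integrable lborel g"
  shows "integrable lborel (\<lambda>s. if s \<le> t then g s else 0)"
proof -
  have "integrable lborel (\<lambda>s. indicator {..t} s *\<^sub>R g s)"
    using assms by (intro integrable_mult_indicator) auto
  then show ?thesis
    by (rule back_subst[of "integrable lborel"]) (auto simp: indicator_def)
qed

lemma primitive_measurable [measurable]:
  fixes g :: "real \<Rightarrow> 'a::euclidean_space"
  assumes [measurable]: "g \<in> borel_measurable borel"
  shows "primitive g \<in> borel_measurable borel"
  unfolding primitive_def by measurable

lemma norm_primitive_le:
  fixes g :: "real \<Rightarrow> 'a::euclidean_space"
  assumes "integrable lborel g"
  shows "norm (primitive g t) \<le> (\<integral>s. norm (g s) \<partial>lborel)"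
  unfolding primitive_def
  using assms integrable_if_le[OF assms]
  by (intro order.trans[OF integral_norm_bound] integral_mono) auto

lemma primitive_add:
  fixes f g :: "real \<Rightarrow> 'a::euclidean_space"
  assumes "integrable lborel f" "integrable lborel g"
  shows "primitive (\<lambda>s. f s + g s) t = primitive f t + primitive g t"
  unfolding primitive_def
  by (subst Bochner_Integration.integral_add[symmetric])
    (auto intro!: integrable_if_le assms Bochner_Integration.integral_cong)

lemma primitive_bounded_linear:
  fixes g :: "real \<Rightarrow> 'a::euclidean_space" and L :: "'a \<Rightarrow> 'b::euclidean_space"
  assumes "bounded_linear L" and "integrable lborel g"
  shows "primitive (\<lambda>s. L (g s)) t = L (primitive g t)"
proof -
  have "(\<integral>s. L (if s \<le> t then g s else 0) \<partial>lborel) = L (primitive g t)"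
    unfolding primitive_def
    by (rule integral_bounded_linear[OF assms(1) integrable_if_le[OF assms(2)]])
  moreover have "(\<lambda>s. L (if s \<le> t then g s else 0)) = (\<lambda>s. if s \<le> t then L (g s) else 0)"
    using linear_0[OF bounded_linear.linear[OF assms(1)]] by auto
  ultimately show ?thesis
    by (simp add: primitive_def)
qed

lemma primitive_cong_AE:
  fixes f g :: "real \<Rightarrow> 'a::euclidean_space"
  assumes [measurable]: "f \<in> borel_measurable borel" "g \<in> borel_measurable borel"
    and "AE s in lborel. f s = g s"
  shows "primitive f t = primitive g t"
  unfolding primitive_def using assms(3) by (intro integral_cong_AE) auto

lemma integrable_dominated:
  fixes g :: "'s \<Rightarrow> 'a::euclidean_space" and h :: "'s \<Rightarrow> real"
  assumes "integrable M h" "g \<in> borel_measurable M" "\<And>x. norm (g x) \<le> h x"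
  shows "integrable M g"
proof (rule Bochner_Integration.integrable_bound[OF assms(1,2)])
  show "AE x in M. norm (g x) \<le> norm (h x)"
    using assms(3) by (intro AE_I2) (metis abs_ge_self order.trans real_norm_def)
qed

text \<open>One statement covers the products used below: real multiplication, scaling by a bounded
  factor, inner products, and the form \<open>cross3 \<kappa> u \<bullet> v\<close>.\<close>

lemma integrable_bilinear_bounded:
  fixes f :: "'s \<Rightarrow> 'a::euclidean_space" and g :: "'s \<Rightarrow> 'b::euclidean_space"
    and prod :: "'a \<Rightarrow> 'b \<Rightarrow> 'c::euclidean_space"
  assumes "bounded_bilinear prod" and f: "integrable M f" and g: "g \<in> borel_measurable M"
    and B: "\<And>s. norm (g s) \<le> B"
  shows "integrable M (\<lambda>s. prod (f s) (g s))"
proof -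
  interpret bounded_bilinear prod by fact
  obtain K where K: "\<And>a b. norm (prod a b) \<le> norm a * norm b * K" "K \<ge> 0"
    using nonneg_bounded by blast
  note [measurable] = borel_measurable_integrable[OF f] g
  have [measurable]: "(\<lambda>s. prod (f s) (g s)) \<in> borel_measurable M"
    using borel_measurable_continuous_Pair[of f M g prod] continuous_on
    by (simp add: bounded_bilinear.continuous_on[OF assms(1)] continuous_on_fst continuous_on_snd)
  have bound: "norm (prod (f s) (g s)) \<le> norm (f s) * (B * K)" for s
  proof -
    have "norm (f s) * (norm (g s) * K) \<le> norm (f s) * (B * K)"
      using B K by (intro mult_left_mono mult_right_mono) auto
    then show ?thesis
      using K(1)[of "f s" "g s"] by (simp add: mult.assoc)
  qed
  have "integrable M (\<lambda>s. norm (f s) * (B * K))"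
    by (rule integrable_mult_left[OF integrable_norm[OF f]])
  then show ?thesis
    by (rule integrable_dominated[OF _ _ bound]) simp
qed

text \<open>Fubini on the half-plane \<open>r \<le> s\<close> for the product of \<open>f s\<close>
  and \<open>g r\<close>. Integrating first in \<open>s\<close> leaves the tail of \<open>f\<close>,
  which is its total integral minus its primitive. No primitive has to be differentiated, so
  integrability suffices.\<close>

lemma integration_by_parts_primitive:
  fixes f :: "real \<Rightarrow> 'a::euclidean_space" and g :: "real \<Rightarrow> 'b::euclidean_space"
    and prod :: "'a \<Rightarrow> 'b \<Rightarrow> 'c::euclidean_space"
  assumes "bounded_bilinear prod" and f: "integrable lborel f" and g: "integrable lborel g"
  shows "(\<integral>s. prod (f s) (primitive g s) \<partial>lborel) + (\<integral>s. prod (primitive f s) (g s) \<partial>lborel) =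
    prod (integral\<^sup>L lborel f) (integral\<^sup>L lborel g)"
proof -
  interpret bounded_bilinear prod by fact
  note [measurable] = borel_measurable_integrable[OF f] borel_measurable_integrable[OF g]
  have fg_meas [measurable]: "(\<lambda>z. prod (f (fst z)) (g (snd z))) \<in> borel_measurable (lborel \<Otimes>\<^sub>M lborel)"
    using borel_measurable_continuous_Pair[of "\<lambda>z. f (fst z)" "lborel \<Otimes>\<^sub>M lborel" "\<lambda>z. g (snd z)" prod]
    by (simp add: bounded_bilinear.continuous_on[OF assms(1)] continuous_on_fst continuous_on_snd)
  have int_r: "integrable lborel (\<lambda>r. prod x (g r))" for x
    by (rule integrable_bounded_linear[OF bounded_linear_right g])
  have norm_int: "integrable lborel (\<lambda>s. \<integral>r. norm (prod (f s) (g r)) \<partial>lborel)"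
  proof -
    obtain K where K: "\<And>a b. norm (prod a b) \<le> norm a * norm b * K" "K \<ge> 0"
      using nonneg_bounded by blast
    have "(\<integral>r. norm (prod (f s) (g r)) \<partial>lborel) \<le> (\<integral>r. norm (f s) * (norm (g r) * K) \<partial>lborel)" for s
      using g K(1) int_r by (intro integral_mono) (auto simp: mult.assoc)
    then have "(\<integral>r. norm (prod (f s) (g r)) \<partial>lborel) \<le> norm (f s) * ((\<integral>r. norm (g r) \<partial>lborel) * K)" for s
      by simp
    then have bound: "norm (\<integral>r. norm (prod (f s) (g r)) \<partial>lborel) \<le>
        norm (f s) * ((\<integral>r. norm (g r) \<partial>lborel) * K)" for s
      unfolding real_norm_def by (subst abs_of_nonneg) simp_all
    have "(\<lambda>(s, r). norm (prod (f s) (g r))) \<in> borel_measurable (lborel \<Otimes>\<^sub>M lborel)"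
      using fg_meas by (simp add: split_beta)
    then have meas: "(\<lambda>s. \<integral>r. norm (prod (f s) (g r)) \<partial>lborel) \<in> borel_measurable lborel"
      by (rule lborel.borel_measurable_lebesgue_integral)
    have "integrable lborel (\<lambda>s. norm (f s) * ((\<integral>r. norm (g r) \<partial>lborel) * K))"
      by (rule integrable_mult_left[OF integrable_norm[OF f]])
    then show ?thesis
      using meas bound by (rule integrable_dominated)
  qed
  have int: "integrable (lborel \<Otimes>\<^sub>M lborel) (\<lambda>z. prod (f (fst z)) (g (snd z)))"
    using norm_int int_r by (intro lborel_pair.Fubini_integrable) auto
  have int': "integrable (lborel \<Otimes>\<^sub>M lborel)
      (\<lambda>(s, r). if r \<le> s then prod (f s) (g r) else 0)"
    by (rule Bochner_Integration.integrable_bound[OF int]) (auto simp: split_beta)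
  have f_int: "integrable lborel (\<lambda>s. if r \<le> s then f s else 0)" for r
    using integrable_mult_indicator[OF _ f, of "{r..}"]
    by (rule back_subst[of "integrable lborel"]) (auto simp: indicator_def)
  have tail: "(\<integral>s. (if r \<le> s then f s else 0) \<partial>lborel) = integral\<^sup>L lborel f - primitive f r" for r
  proof -
    have "(\<integral>s. (if r \<le> s then f s else 0) \<partial>lborel) + primitive f r =
        (\<integral>s. (if r \<le> s then f s else 0) + (if s \<le> r then f s else 0) \<partial>lborel)"
      unfolding primitive_def using f_int integrable_if_le[OF f] by simp
    also have "\<dots> = integral\<^sup>L lborel f"
    proof (rule integral_cong_AE)
      \<comment> \<open>The two half-lines overlap exactly at \<open>s = r\<close>, a null
        set.\<close>
      show "AE s in lborel. (if r \<le> s then f s else 0) + (if s \<le> r then f s else 0) = f s"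
        using AE_lborel_singleton[of r] by eventually_elim auto
    qed auto
    finally show ?thesis by (simp add: algebra_simps)
  qed
  have int_pg: "integrable lborel (\<lambda>s. prod (primitive f s) (g s))"
    by (rule integrable_bilinear_bounded[OF flip g _ norm_primitive_le[OF f]]) simp
  have "(\<integral>s. prod (f s) (primitive g s) \<partial>lborel) =
      (\<integral>s. (\<integral>r. (if r \<le> s then prod (f s) (g r) else 0) \<partial>lborel) \<partial>lborel)"
  proof (intro Bochner_Integration.integral_cong refl)
    fix s
    have "(\<integral>r. prod (f s) (if r \<le> s then g r else 0) \<partial>lborel) = prod (f s) (primitive g s)"
      unfolding primitive_def by (rule integral_bounded_linear[OF bounded_linear_right integrable_if_le[OF g]])
    then show "prod (f s) (primitive g s) = (\<integral>r. (if r \<le> s then prod (f s) (g r) else 0) \<partial>lborel)"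
      by (simp add: if_distrib zero_right cong: if_cong)
  qed
  also have "\<dots> = (\<integral>r. (\<integral>s. (if r \<le> s then prod (f s) (g r) else 0) \<partial>lborel) \<partial>lborel)"
    by (rule lborel_pair.Fubini_integral[symmetric, OF int'])
  also have "\<dots> = (\<integral>r. prod (integral\<^sup>L lborel f) (g r) - prod (primitive f r) (g r) \<partial>lborel)"
  proof (intro Bochner_Integration.integral_cong refl)
    fix r
    have "(\<integral>s. prod (if r \<le> s then f s else 0) (g r) \<partial>lborel) =
        prod (integral\<^sup>L lborel f - primitive f r) (g r)"
      using integral_bounded_linear[OF bounded_linear_left f_int] tail by simp
    then show "(\<integral>s. (if r \<le> s then prod (f s) (g r) else 0) \<partial>lborel) =
        prod (integral\<^sup>L lborel f) (g r) - prod (primitive f r) (g r)"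
      by (simp add: if_distrib[of "\<lambda>x. prod x _"] zero_left diff_left cong: if_cong)
  qed
  also have "\<dots> = prod (integral\<^sup>L lborel f) (integral\<^sup>L lborel g) - (\<integral>s. prod (primitive f s) (g s) \<partial>lborel)"
    using int_pg int_r integral_bounded_linear[OF bounded_linear_right g] by simp
  finally show ?thesis by simp
qed

text \<open>The product rule in integrated form: integration by parts for both functions truncated
  at \<open>t\<close>, whose total integrals are the primitives at \<open>t\<close>. The constants
  contribute linear terms.\<close>

lemma primitive_product:
  fixes f :: "real \<Rightarrow> 'a::euclidean_space" and g :: "real \<Rightarrow> 'b::euclidean_space"
    and prod :: "'a \<Rightarrow> 'b \<Rightarrow> 'c::euclidean_space"
  assumes "bounded_bilinear prod" and f: "integrable lborel f" and g: "integrable lborel g"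
  shows "prod (c + primitive f t) (d + primitive g t) =
    prod c d + primitive (\<lambda>s. prod (f s) (d + primitive g s) + prod (c + primitive f s) (g s)) t"
proof -
  interpret bounded_bilinear prod by fact
  note [measurable] = borel_measurable_integrable[OF f] borel_measurable_integrable[OF g]
  have i1: "integrable lborel (\<lambda>s. prod (f s) (primitive g s))"
    by (rule integrable_bilinear_bounded[OF assms(1) f _ norm_primitive_le[OF g]]) simp
  have i2: "integrable lborel (\<lambda>s. prod (primitive f s) (g s))"
    by (rule integrable_bilinear_bounded[OF flip g _ norm_primitive_le[OF f]]) simp
  have i3: "integrable lborel (\<lambda>s. prod (f s) d)" "integrable lborel (\<lambda>s. prod c (g s))"
    using f g bounded_linear_left bounded_linear_right by (auto intro: integrable_bounded_linear)
  let ?f = "\<lambda>s. if s \<le> t then f s else 0" and ?g = "\<lambda>s. if s \<le> t then g s else 0"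
  have [simp]: "primitive ?g s = primitive g s" "primitive ?f s = primitive f s" if "s \<le> t" for s
    unfolding primitive_def using that by (auto intro!: Bochner_Integration.integral_cong)
  have "prod (primitive f t) (primitive g t) =
      (\<integral>s. prod (?f s) (primitive ?g s) \<partial>lborel) + (\<integral>s. prod (primitive ?f s) (?g s) \<partial>lborel)"
    using integration_by_parts_primitive[OF assms(1) integrable_if_le[OF f] integrable_if_le[OF g], of t t]
    by (simp add: primitive_def)
  also have "\<dots> = primitive (\<lambda>s. prod (f s) (primitive g s)) t + primitive (\<lambda>s. prod (primitive f s) (g s)) t"
  proof (intro arg_cong2[where f = "(+)"])
    show "(\<integral>s. prod (?f s) (primitive ?g s) \<partial>lborel) = primitive (\<lambda>s. prod (f s) (primitive g s)) t"
      unfolding primitive_def[of "\<lambda>s. prod (f s) (primitive g s)"]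
      by (intro Bochner_Integration.integral_cong refl) (simp add: zero_left)
    show "(\<integral>s. prod (primitive ?f s) (?g s) \<partial>lborel) = primitive (\<lambda>s. prod (primitive f s) (g s)) t"
      unfolding primitive_def[of "\<lambda>s. prod (primitive f s) (g s)"]
      by (intro Bochner_Integration.integral_cong refl) (simp add: zero_right)
  qed
  finally have "prod (primitive f t) (primitive g t) = \<dots>" .
  moreover have "primitive (\<lambda>s. prod (f s) d) t = prod (primitive f t) d"
    "primitive (\<lambda>s. prod c (g s)) t = prod c (primitive g t)"
    by (rule primitive_bounded_linear[OF bounded_linear_left f] primitive_bounded_linear[OF bounded_linear_right g])+
  ultimately show ?thesis
    using i1 i2 i3 by (simp add: add_left add_right primitive_add algebra_simps)
qed

lemma primitive_of_test_function:
  assumes \<eta>: "interval_test_function T \<eta>" and der: "\<And>t. (\<eta> has_real_derivative \<eta>' t) (at t)"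
    and int: "integrable lborel \<eta>'" and cont: "continuous_on UNIV \<eta>'" and 0: "\<And>t. t \<le> 0 \<Longrightarrow> \<eta>' t = 0"
  shows "primitive \<eta>' t = \<eta> t"
proof -
  obtain r s where rs: "0 < r" "\<And>t. t \<notin> {r..s} \<Longrightarrow> \<eta> t = 0"
    using interval_test_functionE[OF \<eta>] by metis
  \<comment> \<open>A lower limit at which the test function vanishes, chosen so that the interval
    is nonempty also for negative \<open>t\<close>.\<close>
  define m where "m = min t 0"
  have "(\<lambda>s. if s \<le> t then \<eta>' s else 0) = (\<lambda>s. indicator {m..t} s *\<^sub>R \<eta>' s)"
    using 0 by (auto simp: m_def fun_eq_iff indicator_def)
  then have "primitive \<eta>' t = (\<integral>s. indicator {m..t} s *\<^sub>R \<eta>' s \<partial>lborel)"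
    by (simp add: primitive_def)
  also have "\<dots> = \<eta> t - \<eta> m"
  proof (rule integral_FTC_atLeastAtMost)
    show "(\<eta> has_vector_derivative \<eta>' x) (at x within {m..t})" for x
      using has_field_derivative_at_within[OF der]
      by (simp add: has_real_derivative_iff_has_vector_derivative)
    show "continuous_on {m..t} \<eta>'"
      using cont continuous_on_subset by blast
  qed (simp add: m_def)
  also have "\<eta> m = 0"
    using rs by (simp add: m_def)
  finally show ?thesis by simp
qed

section \<open>From weak derivatives in time to primitives\<close>

text \<open>Subtracting the primitive of \<open>g\<close> leaves a function with zero weak
  derivative, to which \<open>du_Bois_Reymond\<close> applies. The indicator is inserted because the
  primitive does not vanish after time \<open>T\<close>.\<close>

lemma weak_derivative_imp_primitive_real:
  fixes f g :: "real \<Rightarrow> real"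
  assumes T: "0 < T" and f: "integrable lborel f" "\<And>t. t \<notin> {0<..<T} \<Longrightarrow> f t = 0"
    and g: "integrable lborel g"
    and weak: "\<And>\<eta> \<eta>'. interval_test_function T \<eta> \<Longrightarrow> (\<And>t. (\<eta> has_real_derivative \<eta>' t) (at t)) \<Longrightarrow>
      (\<integral>t. f t * \<eta>' t \<partial>lborel) = - (\<integral>t. g t * \<eta> t \<partial>lborel)"
  obtains c where "AE t in lborel. f t = indicator {0<..<T} t * (c + primitive g t)"
proof -
  note [measurable] = borel_measurable_integrable[OF g]
  have pint: "integrable lborel (\<lambda>t. indicator {0<..<T} t * primitive g t)"
    by (rule integrable_bilinear_bounded[OF bounded_bilinear_mult _ _ norm_primitive_le[OF g]])
      (use T in \<open>auto intro: integrable_real_indicator\<close>)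
  obtain c where c: "AE t in lborel. f t - indicator {0<..<T} t * primitive g t = c * indicator {0<..<T} t"
  proof (rule du_Bois_Reymond[OF T])
    show "integrable lborel (\<lambda>t. f t - indicator {0<..<T} t * primitive g t)"
      using f(1) pint by simp
    fix \<eta> \<eta>' assume \<eta>: "interval_test_function T \<eta>" and der: "\<And>t. (\<eta> has_real_derivative \<eta>' t) (at t)"
    have \<eta>': "interval_test_function T \<eta>'"
      using interval_test_function_DERIV[OF \<eta>] der DERIV_unique by (metis ext)
    obtain r s where rs: "C_infinity \<eta>'" "0 < r" "s < T" "\<And>t. t \<notin> {r..s} \<Longrightarrow> \<eta>' t = 0"
      using interval_test_functionE[OF \<eta>'] by metis
    note int' = interval_test_function_integrable[OF \<eta>']
    have prim: "primitive \<eta>' t = \<eta> t" for t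
      using rs by (intro primitive_of_test_function[OF \<eta> der int']) (auto intro: C_infinity_imp_continuous)
    obtain r' s' where rs': "s' < T" "\<And>t. t \<notin> {r'..s'} \<Longrightarrow> \<eta> t = 0"
      using interval_test_functionE[OF \<eta>] by metis
    \<comment> \<open>The boundary term of the integration by parts: it is the value of the test
      function at \<open>T\<close>, which is zero.\<close>
    have "integral\<^sup>L lborel \<eta>' = primitive \<eta>' T"
      unfolding primitive_def using rs by (intro Bochner_Integration.integral_cong) auto
    then have "integral\<^sup>L lborel \<eta>' = 0"
      using rs' by (simp add: prim)
    then have parts: "(\<integral>t. \<eta>' t * primitive g t \<partial>lborel) + (\<integral>t. \<eta> t * g t \<partial>lborel) = 0"
      using integration_by_parts_primitive[OF bounded_bilinear_mult int' g] by (simp add: prim)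
    have eq: "indicator {0<..<T} t * primitive g t * \<eta>' t = \<eta>' t * primitive g t" for t
      using rs by (cases "t \<in> {r..s}") (auto simp: indicator_def)
    have "(\<integral>t. (f t - indicator {0<..<T} t * primitive g t) * \<eta>' t \<partial>lborel) =
        (\<integral>t. f t * \<eta>' t - \<eta>' t * primitive g t \<partial>lborel)"
      by (simp add: left_diff_distrib eq)
    also have "\<dots> = (\<integral>t. f t * \<eta>' t \<partial>lborel) - (\<integral>t. \<eta>' t * primitive g t \<partial>lborel)"
      using interval_test_function_integrable_mult[OF \<eta>' f(1)]
        interval_test_function_integrable_mult[OF \<eta>' pint] by (simp add: eq)
    also have "\<dots> = 0"
      using parts weak[OF \<eta> der] by (simp add: mult.commute)
    finally show "(\<integral>t. (f t - indicator {0<..<T} t * primitive g t) * \<eta>' t \<partial>lborel) = 0" .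
  qed (use f(2) in auto)
  show ?thesis
    by (rule that[of c], use c in eventually_elim) (simp add: algebra_simps)
qed

lemma weak_derivative_imp_primitive:
  fixes f g :: "real \<Rightarrow> 'a::euclidean_space"
  assumes T: "0 < T" and f: "integrable lborel f" "\<And>t. t \<notin> {0<..<T} \<Longrightarrow> f t = 0"
    and g: "integrable lborel g"
    and weak: "\<And>\<eta> \<eta>'. interval_test_function T \<eta> \<Longrightarrow> (\<And>t. (\<eta> has_real_derivative \<eta>' t) (at t)) \<Longrightarrow>
      (\<integral>t. \<eta>' t *\<^sub>R f t \<partial>lborel) = - (\<integral>t. \<eta> t *\<^sub>R g t \<partial>lborel)"
  obtains c where "AE t in lborel. f t = indicator {0<..<T} t *\<^sub>R (c + primitive g t)"
proof -
  have "\<exists>c. AE t in lborel. f t \<bullet> i = indicator {0<..<T} t * (c + primitive g t \<bullet> i)"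
    if i: "i \<in> Basis" for i
  proof -
    have "\<And>\<eta> \<eta>'. interval_test_function T \<eta> \<Longrightarrow> (\<And>t. (\<eta> has_real_derivative \<eta>' t) (at t)) \<Longrightarrow>
      (\<integral>t. (f t \<bullet> i) * \<eta>' t \<partial>lborel) = - (\<integral>t. (g t \<bullet> i) * \<eta> t \<partial>lborel)"
    proof -
      fix \<eta> \<eta>' assume \<eta>: "interval_test_function T \<eta>" and der: "\<And>t. (\<eta> has_real_derivative \<eta>' t) (at t)"
      have \<eta>': "interval_test_function T \<eta>'"
        using interval_test_function_DERIV[OF \<eta>] der DERIV_unique by (metis ext)
      have int: "integrable lborel (\<lambda>t. \<theta> t *\<^sub>R h t)" if \<theta>: "interval_test_function T \<theta>" and h: "integrable lborel h"
        for \<theta> and h :: "real \<Rightarrow> 'a"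
      proof -
        obtain r s where rs: "C_infinity \<theta>" "\<And>t. t \<notin> {r..s} \<Longrightarrow> \<theta> t = 0"
          using interval_test_functionE[OF \<theta>] by metis
        have cont: "continuous_on UNIV \<theta>"
          using rs(1) by (rule C_infinity_imp_continuous)
        then obtain B where B: "\<And>t. \<bar>\<theta> t\<bar> \<le> B"
          using bounded_compact_support[OF cont rs(2)] by blast
        show ?thesis
          by (rule integrable_bilinear_bounded[OF bounded_bilinear.flip[OF bounded_bilinear_scaleR] h])
            (use B cont in \<open>auto intro: borel_measurable_continuous_onI\<close>)
      qed
      have "(\<integral>t. (\<eta>' t *\<^sub>R f t) \<bullet> i \<partial>lborel) = - (\<integral>t. (\<eta> t *\<^sub>R g t) \<bullet> i \<partial>lborel)"
        using weak[OF \<eta> der]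
        unfolding integral_bounded_linear[OF bounded_linear_inner_left int[OF \<eta>' f(1)]]
          integral_bounded_linear[OF bounded_linear_inner_left int[OF \<eta> g]] by simp
      then show "(\<integral>t. (f t \<bullet> i) * \<eta>' t \<partial>lborel) = - (\<integral>t. (g t \<bullet> i) * \<eta> t \<partial>lborel)"
        by (simp add: mult.commute)
    qed
    then obtain c where "AE t in lborel. f t \<bullet> i = indicator {0<..<T} t * (c + primitive (\<lambda>t. g t \<bullet> i) t)"
      using weak_derivative_imp_primitive_real[OF T, of "\<lambda>t. f t \<bullet> i" "\<lambda>t. g t \<bullet> i"] f g by auto
    then show ?thesis
      using primitive_bounded_linear[OF bounded_linear_inner_left g] by auto
  qed
  then obtain c where c: "\<And>i. i \<in> Basis \<Longrightarrow> AE t in lborel. f t \<bullet> i = indicator {0<..<T} t * (c i + primitive g t \<bullet> i)"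
    by metis
  then have "AE t in lborel. \<forall>i\<in>Basis. f t \<bullet> i = indicator {0<..<T} t * (c i + primitive g t \<bullet> i)"
    by (simp add: AE_ball_countable countable_finite)
  then have "AE t in lborel. f t = indicator {0<..<T} t *\<^sub>R ((\<Sum>i\<in>Basis. c i *\<^sub>R i) + primitive g t)"
  proof eventually_elim
    case (elim t)
    show ?case
    proof (rule euclidean_eqI)
      fix j :: 'a
      assume j: "j \<in> Basis"
      show "f t \<bullet> j = (indicator {0<..<T} t *\<^sub>R ((\<Sum>i\<in>Basis. c i *\<^sub>R i) + primitive g t)) \<bullet> j"
        unfolding inner_scaleR_left inner_add_left inner_sum_left_Basis[OF j] using elim j by blast
    qed
  qed
  then show ?thesis
    by (rule that)
qed

section \<open>A positive trigonometric approximate identity on the torus\<close>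

inductive trig_poly :: "(real^3 \<Rightarrow> real) \<Rightarrow> bool" where
  cos: "(\<And>i. \<exists>m::int. \<kappa> $ i = 2 * pi * m) \<Longrightarrow> trig_poly (\<lambda>z. cos (\<kappa> \<bullet> z))"
| add: "trig_poly f \<Longrightarrow> trig_poly g \<Longrightarrow> trig_poly (\<lambda>z. f z + g z)"
| scale: "trig_poly f \<Longrightarrow> trig_poly (\<lambda>z. c * f z)"

lemma trig_poly_const: "trig_poly (\<lambda>z. c)"
proof -
  have "trig_poly (\<lambda>z. cos (0 \<bullet> z))"
    by (rule trig_poly.cos) (auto intro: exI[of _ 0])
  from trig_poly.scale[OF this, of c] show ?thesis by simp
qed

text \<open>Induction on both factors reduces this to two cosines, where the product-to-sum formula
  stays within the frequency lattice and produces no sines.\<close>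

lemma trig_poly_mult:
  assumes "trig_poly f" and "trig_poly g"
  shows "trig_poly (\<lambda>z. f z * g z)"
  using assms
proof (induction f)
  case (cos \<kappa>)
  from \<open>trig_poly g\<close> show ?case
  proof (induction g)
    case (cos \<kappa>')
    have m: "\<exists>m::int. (\<kappa> - \<kappa>') $ i = 2 * pi * m" "\<exists>m::int. (\<kappa> + \<kappa>') $ i = 2 * pi * m" for i
    proof -
      obtain m m' :: int where "\<kappa> $ i = 2 * pi * m" "\<kappa>' $ i = 2 * pi * m'"
        using cos \<open>\<And>i. \<exists>m::int. \<kappa> $ i = 2 * pi * m\<close> by blast
      then show "\<exists>m::int. (\<kappa> - \<kappa>') $ i = 2 * pi * m" "\<exists>m::int. (\<kappa> + \<kappa>') $ i = 2 * pi * m"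
        by (auto intro: exI[of _ "m - m'"] exI[of _ "m + m'"] simp: algebra_simps)
    qed
    have "trig_poly (\<lambda>z. (1/2) * cos ((\<kappa> - \<kappa>') \<bullet> z) + (1/2) * cos ((\<kappa> + \<kappa>') \<bullet> z))"
      by (intro trig_poly.intros m)
    then show ?case
      by (simp add: cos_times_cos inner_diff_left inner_add_left add_divide_distrib)
  next
    case (add g h)
    then show ?case by (simp add: distrib_left trig_poly.add)
  next
    case (scale g c)
    then show ?case
      using trig_poly.scale[of "\<lambda>z. cos (\<kappa> \<bullet> z) * g z" c] by (simp add: mult.left_commute)
  qed
next
  case (add f h)
  then show ?case by (simp add: distrib_right trig_poly.add)
next
  case (scale f c)
  then show ?case
    using trig_poly.scale[of "\<lambda>z. f z * g z" c] by (simp add: mult.assoc)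
qed

lemma trig_poly_power: "trig_poly f \<Longrightarrow> trig_poly (\<lambda>z. f z ^ n)"
  by (induction n) (simp_all add: trig_poly_const trig_poly_mult)

lemma trig_poly_prod:
  "(\<And>i. i \<in> I \<Longrightarrow> trig_poly (f i)) \<Longrightarrow> trig_poly (\<lambda>z. \<Prod>i\<in>I. f i z)"
  by (induction I rule: infinite_finite_induct) (simp_all add: trig_poly_const trig_poly_mult)

lemma trig_poly_even: "trig_poly f \<Longrightarrow> f (- z) = f z"
  by (induction rule: trig_poly.induct) simp_all

lemma trig_poly_continuous: "trig_poly f \<Longrightarrow> continuous_on A f"
  by (induction rule: trig_poly.induct) (auto intro!: continuous_intros)

section \<open>Powers of a cosine product as approximate identity\<close>

text \<open>Each factor is the square of the cosine of pi times one coordinate, so the product lies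
  between 0 and 1 and equals 1 only at integer vectors. Its powers therefore concentrate
  there.\<close>

definition cos_kernel :: "real^3 \<Rightarrow> real" where
  "cos_kernel z = (\<Prod>b\<in>Basis. (1 + cos (2 * pi * (z \<bullet> b))) / 2)"

lemma trig_poly_cos_kernel: "trig_poly cos_kernel"
  unfolding cos_kernel_def
proof (rule trig_poly_prod)
  fix b :: "real^3"
  assume "b \<in> Basis"
  then obtain j where j: "b = axis j 1"
    by (auto simp: Basis_vec_def)
  have "trig_poly (\<lambda>z. cos ((2 * pi) *\<^sub>R b \<bullet> z))"
  proof (rule trig_poly.cos)
    fix i
    have "((2 * pi) *\<^sub>R b) $ i = 2 * pi * of_int (if i = j then 1 else 0)"
      by (simp add: j axis_def)
    then show "\<exists>m::int. ((2 * pi) *\<^sub>R b) $ i = 2 * pi * m"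
      by blast
  qed
  then have "trig_poly (\<lambda>z. (1/2) * (1 + cos ((2 * pi) *\<^sub>R b \<bullet> z)))"
    by (intro trig_poly.add trig_poly.scale trig_poly_const)
  then show "trig_poly (\<lambda>z. (1 + cos (2 * pi * (z \<bullet> b))) / 2)"
    by (simp add: inner_commute)
qed

lemma cos_factor_bounds:
  fixes t :: real
  shows "0 \<le> (1 + cos t) / 2" "(1 + cos t) / 2 \<le> 1"
proof -
  show "0 \<le> (1 + cos t) / 2"
    using add_left_mono[OF cos_ge_minus_one[of t], of 1] by simp
  show "(1 + cos t) / 2 \<le> 1"
    using cos_le_one[of t] by simp
qed

lemma cos_kernel_nonneg: "0 \<le> cos_kernel z"
  unfolding cos_kernel_def by (intro prod_nonneg cos_factor_bounds)

lemma cos_kernel_0: "cos_kernel 0 = 1"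
  by (simp add: cos_kernel_def)

text \<open>With \<open>x\<close> in the open cube all coordinate differences are smaller than 1 in
  absolute value, so none is a nonzero integer. For \<open>x\<close> on a face the opposite face
  would give the value 1.\<close>

lemma cos_kernel_less_1:
  assumes "x \<in> box 0 One" "y \<in> torus3" "y \<noteq> x"
  shows "cos_kernel (x - y) < 1"
proof -
  obtain b :: "real^3" where b: "b \<in> Basis" "x \<bullet> b \<noteq> y \<bullet> b"
    using assms(3) euclidean_eqI by metis
  have d: "\<bar>x \<bullet> b - y \<bullet> b\<bar> < 1" "x \<bullet> b - y \<bullet> b \<noteq> 0"
    using assms b by (force simp: mem_box)+
  have "cos (2 * pi * (x \<bullet> b - y \<bullet> b)) \<noteq> 1"
  proof
    assume "cos (2 * pi * (x \<bullet> b - y \<bullet> b)) = 1"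
    then obtain n :: int where "2 * pi * (x \<bullet> b - y \<bullet> b) = real_of_int n * 2 * pi"
      unfolding cos_one_2pi_int by blast
    then have "x \<bullet> b - y \<bullet> b = real_of_int n" by simp
    with d show False by simp
  qed
  then have "cos (2 * pi * ((x - y) \<bullet> b)) < 1"
    using cos_le_one by (simp add: inner_diff_left less_le)
  then have "(1 + cos (2 * pi * ((x - y) \<bullet> b))) / 2 < 1"
    by simp
  moreover have "cos_kernel (x - y) = (1 + cos (2 * pi * ((x - y) \<bullet> b))) / 2 *
      (\<Prod>b\<in>Basis - {b}. (1 + cos (2 * pi * ((x - y) \<bullet> b))) / 2)"
    unfolding cos_kernel_def using b by (subst prod.remove[of _ b]) auto
  moreover have "(\<Prod>b\<in>Basis - {b}. (1 + cos (2 * pi * ((x - y) \<bullet> b))) / 2) \<le> 1"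
    by (intro prod_le_1 conjI cos_factor_bounds)
  ultimately show ?thesis
    using mult_left_le[OF _ cos_factor_bounds(1)] order_le_less_trans by (metis (no_types, lifting))
qed

text \<open>In terms of an antiderivative \<open>V\<close> the integral is
  \<open>V x - V (x - 1)\<close>, whose derivative vanishes by periodicity.\<close>

lemma periodic_integral_shift:
  fixes v :: "real \<Rightarrow> real"
  assumes cont: "continuous_on UNIV v" and per: "\<And>s. v (s - 1) = v s"
  shows "(\<integral>s. indicator {0..1} s * v (x - s) \<partial>lborel) = (\<integral>s. indicator {0..1} s * v (0 - s) \<partial>lborel)"
proof -
  obtain V where V: "\<And>x. (V has_real_derivative v x) (at x)"
    using continuous_antiderivative[OF cont] by blast
  have FTC: "(\<integral>s. indicator {0..1} s * v (x - s) \<partial>lborel) = V x - V (x - 1)" for x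
  proof -
    have "(\<integral>s. indicator {0..1} s *\<^sub>R v (x - s) \<partial>lborel) = (- V (x - 1)) - (- V (x - 0))"
    proof (rule integral_FTC_atLeastAtMost)
      fix s :: real
      have "((\<lambda>s. - V (x - s)) has_real_derivative v (x - s)) (at s)"
        by (auto intro!: derivative_eq_intros DERIV_chain2[OF V])
      then show "((\<lambda>s. - V (x - s)) has_vector_derivative v (x - s)) (at s within {0..1})"
        using has_field_derivative_at_within
        by (auto simp: has_real_derivative_iff_has_vector_derivative[symmetric])
      show "continuous_on {0..1} (\<lambda>s. v (x - s))"
        by (rule continuous_on_compose2[OF cont]) (auto intro!: continuous_intros)
    qed simp
    then show ?thesis by simp
  qed
  have "((\<lambda>x. V x - V (x - 1)) has_real_derivative 0) (at x)" for x
    using per[of x] by (auto intro!: derivative_eq_intros V DERIV_chain2[OF V])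
  then have "\<exists>c. \<forall>x\<in>UNIV. V x - V (x - 1) = c"
    by (intro has_field_derivative_zero_constant) auto
  then show ?thesis
    unfolding FTC by (metis UNIV_I)
qed

text \<open>Kernel power and indicator of the cube both factor over the coordinates, so the integral
  is a product of one-dimensional integrals of a periodic function. Nonnegativity allows the
  factorisation to be done with extended nonnegative integrals.\<close>

lemma cos_kernel_integral_shift:
  "(\<integral>y. indicator torus3 y * cos_kernel (x - y) ^ n \<partial>lborel) =
    (\<integral>y. indicator torus3 y * cos_kernel (0 - y) ^ n \<partial>lborel)"
proof -
  define v where "v s = ((1 + cos (2 * pi * s)) / 2) ^ n" for s :: real
  have v_cont: "continuous_on A v" for A
    unfolding v_def by (intro continuous_intros) auto
  have v_nonneg: "0 \<le> v s" for s
    unfolding v_def by (intro zero_le_power cos_factor_bounds)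
  have v_per: "v (s - 1) = v s" for s
  proof -
    have "cos (2 * pi * (s - 1)) = cos (2 * pi * s)"
      by (simp add: right_diff_distrib cos_diff)
    then show ?thesis by (simp add: v_def)
  qed
  have [measurable]: "v \<in> borel_measurable borel"
    using v_cont by (rule borel_measurable_continuous_onI)
  have "(\<integral>\<^sup>+y. ennreal (indicator torus3 y * cos_kernel (x - y) ^ n) \<partial>lborel) =
      (\<Prod>b\<in>(Basis :: (real^3) set). \<integral>\<^sup>+s. ennreal (indicator {0..1} s * v (0 - s)) \<partial>lborel)" for x
  proof -
    have "indicator torus3 y * cos_kernel (x - y) ^ n = (\<Prod>b\<in>Basis. indicator {0..1} (y \<bullet> b) * v (x \<bullet> b - y \<bullet> b))"
      for y :: "real^3"
    proof -
      have "indicator torus3 y = (\<Prod>b\<in>Basis. indicator {0..1} (y \<bullet> b) :: real)"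
        by (auto simp: indicator_def mem_box prod_zero_iff simp flip: prod.inter_filter)
      then show ?thesis
        by (simp add: prod.distrib cos_kernel_def v_def inner_diff_left prod_power_distrib)
    qed
    then have "(\<integral>\<^sup>+y. ennreal (indicator torus3 y * cos_kernel (x - y) ^ n) \<partial>lborel) =
        (\<integral>\<^sup>+y. (\<Prod>b\<in>Basis. ennreal (indicator {0..1} (y \<bullet> b) * v (x \<bullet> b - y \<bullet> b))) \<partial>lborel)"
      using v_nonneg by (simp add: prod_ennreal)
    also have "\<dots> = (\<Prod>b\<in>Basis. \<integral>\<^sup>+s. ennreal (indicator {0..1} s * v (x \<bullet> b - s)) \<partial>lborel)"
      by (rule nn_integral_lborel_prod) auto
    also have "\<dots> = (\<Prod>b\<in>(Basis :: (real^3) set). \<integral>\<^sup>+s. ennreal (indicator {0..1} s * v (0 - s)) \<partial>lborel)"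
    proof (rule prod.cong[OF refl])
      fix b :: "real^3"
      have int: "integrable lborel (\<lambda>s. indicator {0..1} s * v (t - s))" for t
      proof -
        have "integrable lborel (\<lambda>s. indicator {0..1} s *\<^sub>R v (t - s))"
          by (rule borel_integrable_compact)
            (auto intro!: continuous_on_compose2[OF v_cont[of UNIV]] continuous_intros)
        then show ?thesis by simp
      qed
      have eq: "(\<integral>\<^sup>+s. ennreal (indicator {0..1} s * v (t - s)) \<partial>lborel) =
          ennreal (\<integral>s. indicator {0..1} s * v (t - s) \<partial>lborel)" for t
        using int v_nonneg by (intro nn_integral_eq_integral) auto
      show "(\<integral>\<^sup>+s. ennreal (indicator {0..1} s * v (x \<bullet> b - s)) \<partial>lborel) =
          (\<integral>\<^sup>+s. ennreal (indicator {0..1} s * v (0 - s)) \<partial>lborel)"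
        unfolding eq by (subst periodic_integral_shift[OF v_cont v_per]) simp
    qed
    finally show ?thesis .
  qed
  moreover have "(\<integral>y. indicator torus3 y * cos_kernel (x - y) ^ n \<partial>lborel) =
      enn2real (\<integral>\<^sup>+y. ennreal (indicator torus3 y * cos_kernel (x - y) ^ n) \<partial>lborel)" for x
  proof (rule integral_eq_nn_integral)
    have "continuous_on UNIV (\<lambda>y. cos_kernel (x - y) ^ n)"
      by (intro continuous_intros continuous_on_compose2[OF trig_poly_continuous[OF trig_poly_cos_kernel]]) auto
    then have [measurable]: "(\<lambda>y. cos_kernel (x - y) ^ n) \<in> borel_measurable borel"
      by (rule borel_measurable_continuous_onI)
    show "(\<lambda>y. indicator torus3 y * cos_kernel (x - y) ^ n) \<in> borel_measurable lborel"
      by measurable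
  qed (simp add: cos_kernel_nonneg)
  ultimately show ?thesis
    by presburger
qed

definition torus_kernel :: "nat \<Rightarrow> real^3 \<Rightarrow> real" where
  "torus_kernel n z = cos_kernel z ^ n / (\<integral>y. indicator torus3 y * cos_kernel (0 - y) ^ n \<partial>lborel)"

lemma trig_poly_torus_kernel: "trig_poly (torus_kernel n)"
  using trig_poly.scale[OF trig_poly_power[OF trig_poly_cos_kernel, of n],
      of "1 / (\<integral>y. indicator torus3 y * cos_kernel (0 - y) ^ n \<partial>lborel)"]
  by (rule back_subst[of trig_poly]) (simp add: torus_kernel_def fun_eq_iff)

lemma torus_kernel_nonneg: "0 \<le> torus_kernel n z"
  unfolding torus_kernel_def
  by (intro divide_nonneg_nonneg Bochner_Integration.integral_nonneg mult_nonneg_nonneg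
      zero_le_power cos_kernel_nonneg) auto

lemma continuous_compose_torus:
  fixes f :: "real^3 \<Rightarrow> real"
  assumes "continuous_on UNIV f"
  shows "continuous_on A (\<lambda>y. f (x - y))"
  by (rule continuous_on_compose2[OF assms]) (auto intro!: continuous_intros)

lemma integrable_indicator_torus:
  fixes f :: "real^3 \<Rightarrow> real"
  assumes "continuous_on UNIV f"
  shows "integrable lborel (\<lambda>y. indicator torus3 y * f y)"
  using borel_integrable_compact[OF compact_cbox[of 0 One] continuous_on_subset[OF assms subset_UNIV]]
  unfolding real_scaleR_def .

lemma cos_kernel_power_continuous: "continuous_on UNIV (\<lambda>y. cos_kernel (x - y) ^ n)"
  by (intro continuous_on_power continuous_compose_torus trig_poly_continuous trig_poly_cos_kernel)

text \<open>By continuity the kernel exceeds \<open>\<theta>\<close> on a ball around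
  \<open>x\<close>, and \<open>\<mu>\<close> is the volume of that ball, independent of
  \<open>n\<close>. Shift invariance moves the bound to the normalising integral. It will beat any
  geometric decay with a smaller ratio.\<close>

lemma cos_kernel_integral_lower_bound:
  fixes x :: "real^3"
  assumes x: "x \<in> box 0 One" and \<theta>: "\<theta> < 1" "0 \<le> \<theta>"
  obtains \<mu> where "\<mu> > 0"
    "\<And>n. \<mu> * \<theta> ^ n \<le> (\<integral>y. indicator torus3 y * cos_kernel (0 - y) ^ n \<partial>lborel)"
proof -
  have "continuous_on UNIV (\<lambda>y. cos_kernel (x - y))"
    by (intro continuous_compose_torus trig_poly_continuous trig_poly_cos_kernel)
  then have "open (box 0 One \<inter> {y. \<theta> < cos_kernel (x - y)})"
    by (intro open_Int open_box open_Collect_less continuous_on_const)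
  moreover have "x \<in> box 0 One \<inter> {y. \<theta> < cos_kernel (x - y)}"
    using x \<theta> by (simp add: cos_kernel_0)
  ultimately obtain \<rho> where \<rho>: "\<rho> > 0" "ball x \<rho> \<subseteq> box 0 One \<inter> {y. \<theta> < cos_kernel (x - y)}"
    by (meson open_contains_ball)
  have \<mu>: "measure lborel (ball x \<rho>) > 0"
    using content_ball_pos[OF \<rho>(1)] by simp
  have "measure lborel (ball x \<rho>) * \<theta> ^ n \<le> (\<integral>y. indicator torus3 y * cos_kernel (0 - y) ^ n \<partial>lborel)" for n
  proof -
    have "measure lborel (ball x \<rho>) * \<theta> ^ n = (\<integral>y. indicator (ball x \<rho>) y * \<theta> ^ n \<partial>lborel)"
      by simp
    also have "\<dots> \<le> (\<integral>y. indicator torus3 y * cos_kernel (x - y) ^ n \<partial>lborel)"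
    proof (rule integral_mono)
      show "integrable lborel (\<lambda>y. indicator (ball x \<rho>) y * \<theta> ^ n)"
        using emeasure_lborel_ball_finite[of x \<rho>] by (intro integrable_mult_left integrable_real_indicator) auto
      show "integrable lborel (\<lambda>y. indicator torus3 y * cos_kernel (x - y) ^ n)"
        by (intro integrable_indicator_torus cos_kernel_power_continuous)
      show "indicator (ball x \<rho>) y * \<theta> ^ n \<le> indicator torus3 y * cos_kernel (x - y) ^ n" for y
      proof (cases "y \<in> ball x \<rho>")
        case True
        then have "y \<in> torus3" "\<theta> \<le> cos_kernel (x - y)"
          using \<rho>(2) box_subset_cbox[of 0 "One :: real^3"] by auto
        then show ?thesis
          using True \<theta> by (auto intro: power_mono)
      next
        case False
        then show ?thesis
          by (simp add: cos_kernel_nonneg)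
      qed
    qed
    also have "\<dots> = (\<integral>y. indicator torus3 y * cos_kernel (0 - y) ^ n \<partial>lborel)"
      by (rule cos_kernel_integral_shift)
    finally show ?thesis .
  qed
  with \<mu> show ?thesis by (rule that)
qed

lemma One_half_in_box: "(1/2) *\<^sub>R One \<in> box 0 (One :: real^3)"
  by (simp add: mem_box)

lemma torus_kernel_integral:
  "(\<integral>y. indicator torus3 y * torus_kernel n (x - y) \<partial>lborel) = 1"
proof -
  \<comment> \<open>The centre of the cube and the ratio 1/2 are arbitrary choices; only positivity
    of the normalising integral is extracted.\<close>
  obtain \<mu> where "\<mu> > 0"
    "\<mu> * (1/2) ^ n \<le> (\<integral>y. indicator torus3 y * cos_kernel (0 - y) ^ n \<partial>lborel)"
    using cos_kernel_integral_lower_bound[OF One_half_in_box, of "1/2"] by auto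
  then have "(\<integral>y. indicator torus3 y * cos_kernel (0 - y) ^ n \<partial>lborel) > 0"
    by (meson less_le_trans mult_pos_pos zero_less_power half_gt_zero zero_less_one)
  then show ?thesis
    using cos_kernel_integral_shift[of x n] by (simp add: torus_kernel_def)
qed

text \<open>Near \<open>x\<close> the function is small and the kernel has unit mass. Away from
  \<open>x\<close> compactness bounds the unnormalised kernel by some \<open>m < 1\<close>, while
  the normalising integral decays no faster than the powers of a larger ratio
  \<open>\<theta>\<close>, so the kernel is of order \<open>(m / \<theta>) ^ n\<close>.\<close>

lemma torus_kernel_concentrates:
  fixes \<phi> :: "real^3 \<Rightarrow> real"
  assumes x: "x \<in> box 0 One" and \<phi>: "continuous_on UNIV \<phi>" "\<And>y. 0 \<le> \<phi> y" "\<And>y. \<phi> y \<le> B" "\<phi> x = 0"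
  shows "(\<lambda>n. \<integral>y. indicator torus3 y * (torus_kernel n (x - y) * \<phi> y) \<partial>lborel) \<longlonglongrightarrow> 0"
proof (rule LIMSEQ_I)
  fix \<epsilon> :: real
  assume "\<epsilon> > 0"
  define e where "e = \<epsilon> / 2"
  have "e > 0" using \<open>\<epsilon> > 0\<close> by (simp add: e_def)
  have B: "0 \<le> B" using \<phi>(2,3) order.trans by blast
  have "open {y. \<phi> y < e}"
    using \<phi>(1) by (intro open_Collect_less continuous_on_const)
  then obtain \<delta> where \<delta>: "\<delta> > 0" "ball x \<delta> \<subseteq> {y. \<phi> y < e}"
    using \<phi>(4) \<open>e > 0\<close> by (metis mem_Collect_eq open_contains_ball)
  have cont: "continuous_on A (\<lambda>y. cos_kernel (x - y))" for A
    by (intro continuous_compose_torus trig_poly_continuous trig_poly_cos_kernel)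
  obtain m where m: "0 \<le> m" "m < 1" "\<And>y. y \<in> torus3 - ball x \<delta> \<Longrightarrow> cos_kernel (x - y) \<le> m"
  proof (cases "torus3 - ball x \<delta> = {}")
    case True
    show ?thesis
      by (rule that[of 0]) (use True in \<open>force+\<close>)
  next
    case False
    have "compact (torus3 - ball x \<delta>)"
      by (intro compact_diff) auto
    then obtain y where y: "y \<in> torus3 - ball x \<delta>" "\<forall>z\<in>torus3 - ball x \<delta>. cos_kernel (x - z) \<le> cos_kernel (x - y)"
      using continuous_attains_sup[OF _ False cont] by blast
    then have "cos_kernel (x - y) < 1"
      using x \<delta>(1) by (intro cos_kernel_less_1) auto
    then show ?thesis
      using that[of "cos_kernel (x - y)"] y(2) cos_kernel_nonneg by blast
  qed
  \<comment> \<open>Any ratio strictly between \<open>m\<close> and 1 serves.\<close>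
  define \<theta> where "\<theta> = (1 + m) / 2"
  have \<theta>: "m < \<theta>" "\<theta> < 1" "0 < \<theta>"
    using m by (auto simp: \<theta>_def)
  obtain \<mu> where \<mu>: "\<mu> > 0"
    "\<And>n. \<mu> * \<theta> ^ n \<le> (\<integral>y. indicator torus3 y * cos_kernel (0 - y) ^ n \<partial>lborel)"
    using cos_kernel_integral_lower_bound[OF x \<theta>(2)] \<theta>(3) by auto
  have bound: "torus_kernel n (x - y) * \<phi> y \<le> e * torus_kernel n (x - y) + B / \<mu> * (m / \<theta>) ^ n"
    if y: "y \<in> torus3" for n y
  proof (cases "y \<in> ball x \<delta>")
    case True
    then have "torus_kernel n (x - y) * \<phi> y \<le> torus_kernel n (x - y) * e"
      using \<delta>(2) by (intro mult_left_mono torus_kernel_nonneg) auto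
    moreover have "0 \<le> B / \<mu> * (m / \<theta>) ^ n"
      using B \<mu>(1) m \<theta> by simp
    ultimately show ?thesis by (simp add: mult.commute)
  next
    case False
    have "torus_kernel n (x - y) \<le> m ^ n / (\<mu> * \<theta> ^ n)"
      unfolding torus_kernel_def
      using False y m \<mu> \<theta> by (intro frac_le power_mono) (auto intro: cos_kernel_nonneg)
    then have "torus_kernel n (x - y) * \<phi> y \<le> m ^ n / (\<mu> * \<theta> ^ n) * B"
      using \<phi>(2,3) torus_kernel_nonneg m \<theta> \<mu>(1) by (intro mult_mono) auto
    moreover have "0 \<le> e * torus_kernel n (x - y)"
      using \<open>e > 0\<close> torus_kernel_nonneg by simp
    ultimately show ?thesis
      by (simp add: power_divide mult.commute)
  qed
  have K_cont: "continuous_on UNIV (\<lambda>y. torus_kernel n (x - y))" for n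
    by (intro continuous_compose_torus trig_poly_continuous trig_poly_torus_kernel)
  have int_le: "(\<integral>y. indicator torus3 y * (torus_kernel n (x - y) * \<phi> y) \<partial>lborel) \<le> e + B / \<mu> * (m / \<theta>) ^ n" for n
  proof -
    have int: "integrable lborel (\<lambda>y. indicator torus3 y * (e * torus_kernel n (x - y)))"
      "integrable lborel (\<lambda>y::real^3. indicator torus3 y * (B / \<mu> * (m / \<theta>) ^ n))"
      by (intro integrable_indicator_torus continuous_on_mult_left K_cont continuous_on_const)+
    have "(\<integral>y. indicator torus3 y * (torus_kernel n (x - y) * \<phi> y) \<partial>lborel) \<le>
        (\<integral>y. indicator torus3 y * (e * torus_kernel n (x - y)) + indicator torus3 y * (B / \<mu> * (m / \<theta>) ^ n) \<partial>lborel)"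
    proof (rule integral_mono)
      show "integrable lborel (\<lambda>y. indicator torus3 y * (torus_kernel n (x - y) * \<phi> y))"
        by (intro integrable_indicator_torus continuous_on_mult K_cont \<phi>(1))
      show "indicator torus3 y * (torus_kernel n (x - y) * \<phi> y) \<le>
        indicator torus3 y * (e * torus_kernel n (x - y)) + indicator torus3 y * (B / \<mu> * (m / \<theta>) ^ n)" for y
        using bound[of y n] by (auto simp: indicator_def simp del: mem_box)
    qed (use int in simp)
    also have "\<dots> = e * (\<integral>y. indicator torus3 y * torus_kernel n (x - y) \<partial>lborel) +
        measure lborel torus3 * (B / \<mu> * (m / \<theta>) ^ n)"
      using int by (simp add: mult.left_commute[of _ e])
    also have "measure lborel torus3 = 1"
      by (simp add: measure_lborel_cbox_eq)
    finally show ?thesis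
      by (simp add: torus_kernel_integral)
  qed
  have "(\<lambda>n. e + B / \<mu> * (m / \<theta>) ^ n) \<longlonglongrightarrow> e + B / \<mu> * 0"
    using m \<theta> by (intro tendsto_intros LIMSEQ_power_zero) simp
  then have "\<forall>\<^sub>F n in sequentially. e + B / \<mu> * (m / \<theta>) ^ n < \<epsilon>"
    by (rule order_tendstoD) (use \<open>\<epsilon> > 0\<close> in \<open>simp add: e_def\<close>)
  then obtain N where N: "\<And>n. n \<ge> N \<Longrightarrow> e + B / \<mu> * (m / \<theta>) ^ n < \<epsilon>"
    by (auto simp: eventually_sequentially)
  have "0 \<le> (\<integral>y. indicator torus3 y * (torus_kernel n (x - y) * \<phi> y) \<partial>lborel)" for n
    by (intro Bochner_Integration.integral_nonneg mult_nonneg_nonneg torus_kernel_nonneg \<phi>(2)) auto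
  then show "\<exists>no. \<forall>n\<ge>no. norm ((\<integral>y. indicator torus3 y * (torus_kernel n (x - y) * \<phi> y) \<partial>lborel) - 0) < \<epsilon>"
    using N int_le by (intro exI[of _ N]) (auto intro: order.strict_trans1)
qed

section \<open>Convergence of translation defects\<close>

lemma cube_add_le:
  fixes a b :: real
  assumes "0 \<le> a" "0 \<le> b"
  shows "(a + b) ^ 3 \<le> 8 * (a ^ 3 + b ^ 3)"
proof -
  have "(a + b) ^ 3 \<le> (2 * max a b) ^ 3"
    using assms by (intro power_mono) auto
  also have "\<dots> = 8 * max (a ^ 3) (b ^ 3)"
    using assms by (auto simp: power_mult_distrib max_def power_mono_iff)
  also have "\<dots> \<le> 8 * (a ^ 3 + b ^ 3)"
    using assms by (auto simp: max_def)
  finally show ?thesis .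
qed

text \<open>Cutting off large values, with dominated convergence under the cube of the norm of
  \<open>g\<close>.\<close>

lemma bounded_approximation_L3:
  fixes g :: "'a::euclidean_space \<Rightarrow> 'b::euclidean_space"
  assumes [measurable]: "g \<in> borel_measurable borel"
    and fin: "(\<integral>\<^sup>+z. ennreal (norm (g z) ^ 3) \<partial>lborel) < \<infinity>" and "\<epsilon> > 0"
  obtains M g' where "g' \<in> borel_measurable borel" "M \<ge> 0" "\<And>z. norm (g' z) \<le> M"
    "(\<integral>\<^sup>+z. ennreal (norm (g z - g' z) ^ 3) \<partial>lborel) < \<epsilon>"
proof -
  define g' where "g' m z = (if norm (g z) \<le> real m then g z else 0)" for m z
  have [measurable]: "g' m \<in> borel_measurable borel" for m
    unfolding g'_def by measurable
  have "(\<lambda>m. \<integral>\<^sup>+z. ennreal (norm (g z - g' m z) ^ 3) \<partial>lborel) \<longlonglongrightarrow> (\<integral>\<^sup>+z. 0 \<partial>(lborel :: 'a measure))"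
  proof (rule nn_integral_dominated_convergence[where w = "\<lambda>z. ennreal (norm (g z) ^ 3)"])
    show "AE z in lborel. (\<lambda>m. ennreal (norm (g z - g' m z) ^ 3)) \<longlonglongrightarrow> 0"
    proof (rule AE_I2)
      fix z
      obtain N where N: "norm (g z) \<le> real N"
        using real_arch_simple by blast
      show "(\<lambda>m. ennreal (norm (g z - g' m z) ^ 3)) \<longlonglongrightarrow> 0"
        by (rule tendsto_eventually, rule eventually_sequentiallyI[of N])
          (use N in \<open>auto simp: g'_def\<close>)
    qed
    show "AE z in lborel. ennreal (norm (g z - g' m z) ^ 3) \<le> ennreal (norm (g z) ^ 3)" for m
      by (rule AE_I2) (simp add: g'_def)
  qed (use fin in auto)
  then have "(\<lambda>m. \<integral>\<^sup>+z. ennreal (norm (g z - g' m z) ^ 3) \<partial>lborel) \<longlonglongrightarrow> 0"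
    by simp
  then have "\<forall>\<^sub>F m in sequentially. (\<integral>\<^sup>+z. ennreal (norm (g z - g' m z) ^ 3) \<partial>lborel) < \<epsilon>"
    by (rule order_tendstoD) (use \<open>\<epsilon> > 0\<close> in simp)
  then obtain m where "(\<integral>\<^sup>+z. ennreal (norm (g z - g' m z) ^ 3) \<partial>lborel) < \<epsilon>"
    by (auto simp: eventually_sequentially)
  then show ?thesis
    by (intro that[of "g' m" "real m"]) (auto simp: g'_def)
qed

text \<open>A measurable function is an almost everywhere limit of continuous ones. Projecting these
  to the ball of radius \<open>M\<close> keeps continuity and the limit and makes them uniformly
  bounded, so dominated convergence applies on a set of finite measure.\<close>

lemma continuous_approximation_bounded:
  fixes g :: "'a::euclidean_space \<Rightarrow> 'b::euclidean_space"
  assumes [measurable]: "g \<in> borel_measurable borel" and M: "M \<ge> 0" "\<And>z. norm (g z) \<le> M"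
    and A [measurable]: "A \<in> sets borel" and fin: "emeasure lborel A < \<infinity>" and "\<epsilon> > 0"
  obtains h where "continuous_on UNIV h" "\<And>z. norm (h z) \<le> M"
    "(\<integral>\<^sup>+z. indicator A z * ennreal (norm (g z - h z) ^ 3) \<partial>lborel) < \<epsilon>"
proof -
  have "g measurable_on UNIV"
    using measurable_completion[of g lborel borel]
    by (subst measurable_on_iff_borel_measurable) auto
  then obtain N k where N: "negligible N" and k: "\<And>n. continuous_on UNIV (k n)"
    "\<And>x. x \<notin> N \<Longrightarrow> (\<lambda>n. k n x) \<longlonglongrightarrow> g x"
    unfolding measurable_on_def by auto
  define P :: "'b \<Rightarrow> 'b" where "P = closest_point (cball 0 M)"
  have P_cont: "continuous_on S P" for S
    unfolding P_def using M by (intro continuous_on_closest_point) auto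
  have P_self: "P x = x" if "norm x \<le> M" for x
    unfolding P_def using that by (intro closest_point_self) auto
  have P_bound: "norm (P x) \<le> M" for x
  proof -
    have "P x \<in> cball 0 M"
      unfolding P_def using M by (intro closest_point_in_set) auto
    then show ?thesis by simp
  qed
  have h_cont: "continuous_on UNIV (\<lambda>z. P (k n z))" for n
    by (rule continuous_on_compose2[OF P_cont[of UNIV] k(1)]) auto
  have [measurable]: "(\<lambda>z. P (k n z)) \<in> borel_measurable borel" for n
    using h_cont by (rule borel_measurable_continuous_onI)
  have AE: "AE z in lborel. z \<notin> N"
    using N AE_not_in[of N lebesgue] by (simp add: negligible_iff_null_sets AE_completion_iff)
  have "(\<lambda>n. \<integral>\<^sup>+z. indicator A z * ennreal (norm (g z - P (k n z)) ^ 3) \<partial>lborel) \<longlonglongrightarrow> (\<integral>\<^sup>+z. 0 \<partial>(lborel :: 'a measure))"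
  proof (rule nn_integral_dominated_convergence[where w = "\<lambda>z. indicator A z * ennreal ((2 * M) ^ 3)"])
    show "AE z in lborel. (\<lambda>n. indicator A z * ennreal (norm (g z - P (k n z)) ^ 3)) \<longlonglongrightarrow> 0"
      using AE
    proof eventually_elim
      case (elim z)
      have "(\<lambda>n. P (k n z)) \<longlonglongrightarrow> P (g z)"
        using P_cont[of UNIV] k(2)[OF elim] by (intro continuous_on_tendsto_compose[of UNIV P]) auto
      then have "(\<lambda>n. norm (g z - P (k n z)) ^ 3) \<longlonglongrightarrow> norm (g z - g z) ^ 3"
        using P_self M(2) by (intro tendsto_intros) simp
      then have "(\<lambda>n. ennreal (norm (g z - P (k n z)) ^ 3)) \<longlonglongrightarrow> ennreal 0"
        by (intro tendsto_ennrealI) simp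
      then have "(\<lambda>n. indicator A z * ennreal (norm (g z - P (k n z)) ^ 3)) \<longlonglongrightarrow> indicator A z * 0"
        by (intro ennreal_tendsto_cmult) (auto simp: indicator_def)
      then show ?case by simp
    qed
    show "AE z in lborel. indicator A z * ennreal (norm (g z - P (k n z)) ^ 3) \<le> indicator A z * ennreal ((2 * M) ^ 3)" for n
    proof (rule AE_I2)
      fix z
      have "norm (g z - P (k n z)) \<le> 2 * M"
        using norm_triangle_ineq4[of "g z" "P (k n z)"] M(2)[of z] P_bound[of "k n z"] by linarith
      then show "indicator A z * ennreal (norm (g z - P (k n z)) ^ 3) \<le> indicator A z * ennreal ((2 * M) ^ 3)"
        by (intro mult_left_mono ennreal_leI power_mono) auto
    qed
    show "(\<integral>\<^sup>+z. indicator A z * ennreal ((2 * M) ^ 3) \<partial>lborel) < \<infinity>"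
      using fin by (simp add: nn_integral_multc ennreal_mult_less_top)
  qed auto
  then have "(\<lambda>n. \<integral>\<^sup>+z. indicator A z * ennreal (norm (g z - P (k n z)) ^ 3) \<partial>lborel) \<longlonglongrightarrow> 0"
    by simp
  then have "\<forall>\<^sub>F n in sequentially. (\<integral>\<^sup>+z. indicator A z * ennreal (norm (g z - P (k n z)) ^ 3) \<partial>lborel) < \<epsilon>"
    by (rule order_tendstoD) (use \<open>\<epsilon> > 0\<close> in simp)
  then obtain n where "(\<integral>\<^sup>+z. indicator A z * ennreal (norm (g z - P (k n z)) ^ 3) \<partial>lborel) < \<epsilon>"
    by (auto simp: eventually_sequentially)
  then show ?thesis
    using that[OF h_cont P_bound] by blast
qed

lemma continuous_approximation_L3:
  fixes g :: "'a::euclidean_space \<Rightarrow> 'b::euclidean_space"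
  assumes [measurable]: "g \<in> borel_measurable borel"
    and fin: "(\<integral>\<^sup>+z. ennreal (norm (g z) ^ 3) \<partial>lborel) < \<infinity>"
    and A [measurable]: "A \<in> sets borel" and finA: "emeasure lborel A < \<infinity>" and "\<epsilon> > (0::real)"
  obtains h M where "continuous_on UNIV h" "\<And>z. norm (h z) \<le> M"
    "(\<integral>\<^sup>+z. indicator A z * ennreal (norm (g z - h z) ^ 3) \<partial>lborel) \<le> ennreal \<epsilon>"
proof -
  \<comment> \<open>Two errors of this size, multiplied by the 8 of \<open>cube_add_le\<close>, add
    up to \<open>\<epsilon>\<close>.\<close>
  define e where "e = ennreal (\<epsilon> / 16)"
  have "e > 0" using \<open>\<epsilon> > 0\<close> by (simp add: e_def)
  obtain M g' where g': "g' \<in> borel_measurable borel" "M \<ge> 0" "\<And>z. norm (g' z) \<le> M"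
    "(\<integral>\<^sup>+z. ennreal (norm (g z - g' z) ^ 3) \<partial>lborel) < e"
    by (rule bounded_approximation_L3[OF assms(1) fin \<open>e > 0\<close>], rule that)
  note [measurable] = g'(1)
  obtain h where h: "continuous_on UNIV h" "\<And>z. norm (h z) \<le> M"
    "(\<integral>\<^sup>+z. indicator A z * ennreal (norm (g' z - h z) ^ 3) \<partial>lborel) < e"
    by (rule continuous_approximation_bounded[OF g'(1-3) A finA \<open>e > 0\<close>], rule that)
  have [measurable]: "h \<in> borel_measurable borel"
    using h(1) by (rule borel_measurable_continuous_onI)
  have le: "ennreal (norm (g z - h z) ^ 3) \<le>
      8 * (ennreal (norm (g z - g' z) ^ 3) + ennreal (norm (g' z - h z) ^ 3))" for z
  proof -
    have "norm (g z - h z) \<le> norm (g z - g' z) + norm (g' z - h z)"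
      using norm_triangle_ineq[of "g z - g' z" "g' z - h z"] by simp
    then have "norm (g z - h z) ^ 3 \<le> (norm (g z - g' z) + norm (g' z - h z)) ^ 3"
      by (intro power_mono) auto
    also have "\<dots> \<le> 8 * (norm (g z - g' z) ^ 3 + norm (g' z - h z) ^ 3)"
      by (intro cube_add_le) auto
    finally have "ennreal (norm (g z - h z) ^ 3) \<le> ennreal (8 * (norm (g z - g' z) ^ 3 + norm (g' z - h z) ^ 3))"
      by (rule ennreal_leI)
    then show ?thesis
      by (simp add: ennreal_mult ennreal_plus)
  qed
  have "(\<integral>\<^sup>+z. indicator A z * ennreal (norm (g z - h z) ^ 3) \<partial>lborel) \<le>
      (\<integral>\<^sup>+z. 8 * (ennreal (norm (g z - g' z) ^ 3) + indicator A z * ennreal (norm (g' z - h z) ^ 3)) \<partial>lborel)"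
  proof (rule nn_integral_mono)
    fix z
    show "indicator A z * ennreal (norm (g z - h z) ^ 3) \<le>
        8 * (ennreal (norm (g z - g' z) ^ 3) + indicator A z * ennreal (norm (g' z - h z) ^ 3))"
      using le[of z] by (cases "z \<in> A") auto
  qed
  also have "\<dots> = 8 * ((\<integral>\<^sup>+z. ennreal (norm (g z - g' z) ^ 3) \<partial>lborel) +
      (\<integral>\<^sup>+z. indicator A z * ennreal (norm (g' z - h z) ^ 3) \<partial>lborel))"
    by (simp add: nn_integral_cmult nn_integral_add)
  also have "\<dots> \<le> 8 * (e + e)"
    using g'(4) h(3) by (intro mult_left_mono add_mono) auto
  also have "\<dots> = ennreal \<epsilon>"
  proof -
    have "e + e = ennreal (\<epsilon> / 16 + \<epsilon> / 16)"
      unfolding e_def using \<open>\<epsilon> > 0\<close> by (intro ennreal_plus[symmetric]) auto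
    then have "8 * (e + e) = ennreal 8 * ennreal (\<epsilon> / 16 + \<epsilon> / 16)"
      by simp
    also have "\<dots> = ennreal (8 * (\<epsilon> / 16 + \<epsilon> / 16))"
      using \<open>\<epsilon> > 0\<close> by (intro ennreal_mult[symmetric]) auto
    finally show ?thesis by simp
  qed
  finally show ?thesis
    using that h(1,2) by blast
qed

section \<open>The kernel on the cube and its translation defect\<close>

text \<open>The kernel is periodic already; restricting both variables to the cube represents
  convolution on the torus. The result is symmetric with unit marginals, and its values in
  \<open>ennreal\<close> permit interchanging integrals without integrability conditions.\<close>

definition periodization :: "nat \<Rightarrow> real^3 \<Rightarrow> real^3 \<Rightarrow> ennreal" where
  "periodization n x y = ennreal (indicator torus3 x * indicator torus3 y * torus_kernel n (x - y))"

lemma torus_kernel_measurable [measurable]: "torus_kernel n \<in> borel_measurable borel"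
  by (intro borel_measurable_continuous_onI trig_poly_continuous trig_poly_torus_kernel)

lemma periodization_measurable [measurable]:
  "(\<lambda>(x, y). periodization n x y) \<in> borel_measurable (borel \<Otimes>\<^sub>M borel)"
proof -
  have [measurable]: "(\<lambda>z::(real^3) \<times> (real^3). torus_kernel n (fst z - snd z)) \<in> borel_measurable (borel \<Otimes>\<^sub>M borel)"
    by (rule measurable_compose[OF _ torus_kernel_measurable]) measurable
  show ?thesis
    unfolding periodization_def split_beta by measurable
qed

lemma periodization_sym: "periodization n x y = periodization n y x"
  using trig_poly_even[OF trig_poly_torus_kernel, of n "x - y"]
  by (simp add: periodization_def mult_ac)

lemma periodization_nn_integral: "(\<integral>\<^sup>+y. periodization n x y \<partial>lborel) = indicator torus3 x"
proof -
  have cont: "continuous_on UNIV (\<lambda>y. torus_kernel n (x - y))"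
    by (intro continuous_compose_torus trig_poly_continuous trig_poly_torus_kernel)
  have "(\<integral>\<^sup>+y. ennreal (indicator torus3 y * torus_kernel n (x - y)) \<partial>lborel) =
      ennreal (\<integral>y. indicator torus3 y * torus_kernel n (x - y) \<partial>lborel)"
    by (intro nn_integral_eq_integral integrable_indicator_torus cont) (simp add: torus_kernel_nonneg)
  then have "(\<integral>\<^sup>+y. ennreal (indicator torus3 y * torus_kernel n (x - y)) \<partial>lborel) = 1"
    by (simp only: torus_kernel_integral ennreal_1)
  then show ?thesis
    by (cases "x \<in> torus3") (simp_all add: periodization_def)
qed

text \<open>The form of Young's inequality is chosen to avoid fractional powers of \<open>\<delta>\<close>.\<close>

lemma young_3_2_3:
  fixes \<alpha> \<beta> \<delta> :: real
  assumes "0 \<le> \<alpha>" "0 \<le> \<beta>" "0 < \<delta>"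
  shows "\<alpha> * \<beta> \<le> \<delta> * \<alpha> powr (3/2) + \<beta> ^ 3 / \<delta>\<^sup>2"
\<comment> \<open>At equality the left side and both terms on the right coincide; on either side of
  this threshold one term alone dominates the product.\<close>
proof (cases "\<beta> \<le> \<delta> * sqrt \<alpha>")
  case True
  have "\<alpha> powr (3/2) = \<alpha> * sqrt \<alpha>"
  proof (cases "\<alpha> = 0")
    case False
    have "\<alpha> powr (1 + 1/2) = \<alpha> powr 1 * \<alpha> powr (1/2)"
      by (rule powr_add)
    then show ?thesis
      using assms False by (simp add: powr_half_sqrt)
  qed simp
  moreover have "\<alpha> * \<beta> \<le> \<alpha> * (\<delta> * sqrt \<alpha>)"
    using True assms by (intro mult_left_mono)
  moreover have "0 \<le> \<beta> ^ 3 / \<delta>\<^sup>2"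
    using assms by simp
  ultimately show ?thesis
    by (simp add: mult_ac)
next
  case False
  then have "(\<delta> * sqrt \<alpha>)\<^sup>2 \<le> \<beta>\<^sup>2"
    using assms by (intro power_mono) auto
  then have "\<alpha> \<le> \<beta>\<^sup>2 / \<delta>\<^sup>2"
    using assms by (simp add: power_mult_distrib field_simps)
  then have "\<alpha> * \<beta> \<le> \<beta>\<^sup>2 / \<delta>\<^sup>2 * \<beta>"
    using assms by (intro mult_right_mono)
  moreover have "0 \<le> \<delta> * \<alpha> powr (3/2)"
    using assms by simp
  ultimately show ?thesis
    by (simp add: power2_eq_square power3_eq_cube)
qed

text \<open>With \<open>f\<close> the norm of a field paired with \<open>g\<close>, this bounds,
  integrated in time, the error made when \<open>g\<close> is replaced by its convolution with the
  kernel.\<close>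

definition translation_defect ::
    "nat \<Rightarrow> ((real^3) \<times> real \<Rightarrow> real) \<Rightarrow> ((real^3) \<times> real \<Rightarrow> 'b::euclidean_space) \<Rightarrow> ennreal" where
  "translation_defect n f g =
     (\<integral>\<^sup>+z. ennreal (f z) * (\<integral>\<^sup>+y. ennreal (norm (g (y, snd z) - g z)) * periodization n (fst z) y \<partial>lborel) \<partial>lborel)"

lemma periodization_measurable' [measurable (raw)]:
  assumes "f \<in> borel_measurable M" "g \<in> borel_measurable M"
  shows "(\<lambda>w. periodization n (f w) (g w)) \<in> borel_measurable M"
  using measurable_compose[OF measurable_Pair[OF assms] periodization_measurable] by simp

lemma time_slice_measurable [measurable (raw)]:
  fixes g :: "(real^3) \<times> real \<Rightarrow> 'b::topological_space"
  assumes "g \<in> borel_measurable borel" "f \<in> borel_measurable M" "t \<in> borel_measurable M"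
  shows "(\<lambda>w. g (f w, t w)) \<in> borel_measurable M"
proof -
  have "(\<lambda>w. (f w, t w)) \<in> borel_measurable M"
    using measurable_Pair[OF assms(2,3)] by (simp add: borel_prod)
  then show ?thesis
    using assms(1) by (rule measurable_compose)
qed

lemma borel_measurable_fst_snd [measurable]:
  "(fst :: (real^3) \<times> real \<Rightarrow> real^3) \<in> borel_measurable borel"
  "(snd :: (real^3) \<times> real \<Rightarrow> real) \<in> borel_measurable borel"
  by (intro borel_measurable_continuous_onI continuous_intros)+

lemma nn_integral_cylinder_snd:
  fixes F :: "(real^3) \<times> real \<Rightarrow> ennreal"
  assumes "F \<in> borel_measurable borel"
  shows "(\<integral>\<^sup>+z. F z \<partial>lborel) = (\<integral>\<^sup>+t. \<integral>\<^sup>+x. F (x, t) \<partial>lborel \<partial>lborel)"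
proof -
  have "F \<in> borel_measurable (lborel \<Otimes>\<^sub>M lborel)"
    using assms by (simp add: lborel_prod)
  from lborel_pair.nn_integral_snd[OF this] show ?thesis
    by (simp add: lborel_prod)
qed

text \<open>Tonelli moves the averaging onto the first variable, and symmetry of the kernel then
  gives the unit marginal: averaging preserves the integral.\<close>

lemma nn_integral_periodization_y:
  fixes G :: "(real^3) \<times> real \<Rightarrow> ennreal"
  assumes [measurable]: "G \<in> borel_measurable borel"
  shows "(\<integral>\<^sup>+z. (\<integral>\<^sup>+y. G (y, snd z) * periodization n (fst z) y \<partial>lborel) \<partial>lborel) =
    (\<integral>\<^sup>+z. indicator torus3 (fst z) * G z \<partial>lborel)"
proof -
  have "(\<integral>\<^sup>+z. (\<integral>\<^sup>+y. G (y, snd z) * periodization n (fst z) y \<partial>lborel) \<partial>lborel) =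
      (\<integral>\<^sup>+t. \<integral>\<^sup>+x. \<integral>\<^sup>+y. G (y, t) * periodization n x y \<partial>lborel \<partial>lborel \<partial>lborel)"
    by (subst nn_integral_cylinder_snd) auto
  also have "\<dots> = (\<integral>\<^sup>+t. \<integral>\<^sup>+y. \<integral>\<^sup>+x. G (y, t) * periodization n x y \<partial>lborel \<partial>lborel \<partial>lborel)"
    by (intro nn_integral_cong lborel_pair.Fubini') measurable
  also have "\<dots> = (\<integral>\<^sup>+t. \<integral>\<^sup>+y. indicator torus3 y * G (y, t) \<partial>lborel \<partial>lborel)"
  proof (intro nn_integral_cong)
    fix t :: real and y :: "real^3"
    have "(\<integral>\<^sup>+x. G (y, t) * periodization n x y \<partial>lborel) = G (y, t) * (\<integral>\<^sup>+x. periodization n y x \<partial>lborel)"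
      by (subst nn_integral_cmult[symmetric]) (auto simp: periodization_sym[of n _ y])
    then show "(\<integral>\<^sup>+x. G (y, t) * periodization n x y \<partial>lborel) = indicator torus3 y * G (y, t)"
      by (simp add: periodization_nn_integral mult.commute)
  qed
  also have "\<dots> = (\<integral>\<^sup>+z. indicator torus3 (fst z) * G z \<partial>lborel)"
    by (subst nn_integral_cylinder_snd) auto
  finally show ?thesis .
qed

text \<open>Two versions are needed because the triangle inequality yields an approximation error at
  the averaged point and one at the base point. The kernel has unit marginals in both variables, so
  Young's inequality under the integral gives the same bound for both.\<close>

lemma nn_integral_periodization_young:
  fixes f G :: "(real^3) \<times> real \<Rightarrow> real"
  assumes [measurable]: "f \<in> borel_measurable borel" "G \<in> borel_measurable borel"
    and f: "\<And>z. 0 \<le> f z" "\<And>z. z \<notin> cylinder T \<Longrightarrow> f z = 0" and G: "\<And>z. 0 \<le> G z" and "\<delta> > 0"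
  shows "(\<integral>\<^sup>+z. ennreal (f z) * (\<integral>\<^sup>+y. ennreal (G (y, snd z)) * periodization n (fst z) y \<partial>lborel) \<partial>lborel) \<le>
      ennreal \<delta> * (\<integral>\<^sup>+z. ennreal (f z powr (3/2)) \<partial>lborel) +
      ennreal (1 / \<delta>\<^sup>2) * (\<integral>\<^sup>+z. indicator (cylinder T) z * ennreal (G z ^ 3) \<partial>lborel)"
    (is "?l1 \<le> ?r")
  and "(\<integral>\<^sup>+z. ennreal (f z) * (\<integral>\<^sup>+y. ennreal (G z) * periodization n (fst z) y \<partial>lborel) \<partial>lborel) \<le>
      ennreal \<delta> * (\<integral>\<^sup>+z. ennreal (f z powr (3/2)) \<partial>lborel) +
      ennreal (1 / \<delta>\<^sup>2) * (\<integral>\<^sup>+z. indicator (cylinder T) z * ennreal (G z ^ 3) \<partial>lborel)"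
    (is "?l2 \<le> ?r")
proof -
  let ?H = "\<lambda>z. indicator {0<..<T} (snd z) * ennreal (G z ^ 3)"
  have ind: "indicator (cylinder T) z = indicator torus3 (fst z) * (indicator {0<..<T} (snd z) :: ennreal)" for z :: "(real^3) \<times> real"
    by (cases z) (auto simp: indicator_def)
  have young: "ennreal (f z) * ennreal (G w) \<le> ennreal \<delta> * ennreal (f z powr (3/2)) + ennreal (1 / \<delta>\<^sup>2) * ?H w"
    if "snd w = snd z" for z w
  proof (cases "z \<in> cylinder T")
    case True
    have "f z * G w \<le> \<delta> * f z powr (3/2) + 1 / \<delta>\<^sup>2 * G w ^ 3"
      using young_3_2_3[OF f(1) G \<open>\<delta> > 0\<close>, of z w] by simp
    then have "ennreal (f z * G w) \<le> ennreal (\<delta> * f z powr (3/2) + 1 / \<delta>\<^sup>2 * G w ^ 3)"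
      by (rule ennreal_leI)
    also have "\<dots> = ennreal (\<delta> * f z powr (3/2)) + ennreal (1 / \<delta>\<^sup>2 * G w ^ 3)"
      using \<open>\<delta> > 0\<close> G[of w] by (intro ennreal_plus) auto
    also have "ennreal (\<delta> * f z powr (3/2)) = ennreal \<delta> * ennreal (f z powr (3/2))"
      using \<open>\<delta> > 0\<close> by (intro ennreal_mult) auto
    also have "ennreal (1 / \<delta>\<^sup>2 * G w ^ 3) = ennreal (1 / \<delta>\<^sup>2) * ennreal (G w ^ 3)"
      using G[of w] by (intro ennreal_mult) auto
    also have "ennreal (f z * G w) = ennreal (f z) * ennreal (G w)"
      using f(1) G by (intro ennreal_mult) auto
    also have "ennreal (G w ^ 3) = ?H w"
      using True that by (cases z) (simp add: indicator_def)
    finally show ?thesis .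
  next
    case False
    then show ?thesis by (simp add: f(2))
  qed
  \<comment> \<open>The parameter \<open>w\<close> selects the point at which the second factor is
    evaluated, so both estimates share this computation.\<close>
  have split: "(\<integral>\<^sup>+z. (\<integral>\<^sup>+y. (ennreal \<delta> * ennreal (f z powr (3/2)) + ennreal (1 / \<delta>\<^sup>2) * ?H (w z y)) * periodization n (fst z) y \<partial>lborel) \<partial>lborel) \<le> ?r"
    if [measurable]: "(\<lambda>p. w (fst p) (snd p)) \<in> borel \<Otimes>\<^sub>M borel \<rightarrow>\<^sub>M borel"
      and w: "(\<integral>\<^sup>+z. (\<integral>\<^sup>+y. ?H (w z y) * periodization n (fst z) y \<partial>lborel) \<partial>lborel) = (\<integral>\<^sup>+z. indicator torus3 (fst z) * ?H z \<partial>lborel)"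
    for w :: "(real^3) \<times> real \<Rightarrow> real^3 \<Rightarrow> (real^3) \<times> real"
  proof -
    have [measurable]: "(\<lambda>y. w z y) \<in> borel \<rightarrow>\<^sub>M borel" for z
      using measurable_compose[OF measurable_Pair1'[of z borel borel] that(1)] by simp
    have "(\<integral>\<^sup>+y. (ennreal \<delta> * ennreal (f z powr (3/2)) + ennreal (1 / \<delta>\<^sup>2) * ?H (w z y)) * periodization n (fst z) y \<partial>lborel) =
        ennreal \<delta> * ennreal (f z powr (3/2)) * indicator torus3 (fst z) +
        ennreal (1 / \<delta>\<^sup>2) * (\<integral>\<^sup>+y. ?H (w z y) * periodization n (fst z) y \<partial>lborel)" for z
      by (simp add: distrib_right nn_integral_add nn_integral_cmult mult.assoc periodization_nn_integral)
    then have "(\<integral>\<^sup>+z. (\<integral>\<^sup>+y. (ennreal \<delta> * ennreal (f z powr (3/2)) + ennreal (1 / \<delta>\<^sup>2) * ?H (w z y)) * periodization n (fst z) y \<partial>lborel) \<partial>lborel) =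
        (\<integral>\<^sup>+z. ennreal \<delta> * ennreal (f z powr (3/2)) * indicator torus3 (fst z) \<partial>lborel) +
        (\<integral>\<^sup>+z. ennreal (1 / \<delta>\<^sup>2) * (\<integral>\<^sup>+y. ?H (w z y) * periodization n (fst z) y \<partial>lborel) \<partial>lborel)"
      by (simp add: nn_integral_add)
    also have "\<dots> = (\<integral>\<^sup>+z. ennreal \<delta> * ennreal (f z powr (3/2)) * indicator torus3 (fst z) \<partial>lborel) +
        ennreal (1 / \<delta>\<^sup>2) * (\<integral>\<^sup>+z. indicator torus3 (fst z) * ?H z \<partial>lborel)"
      unfolding w[symmetric] by (simp add: nn_integral_cmult)
    also have "\<dots> \<le> (\<integral>\<^sup>+z. ennreal \<delta> * ennreal (f z powr (3/2)) \<partial>lborel) +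
        ennreal (1 / \<delta>\<^sup>2) * (\<integral>\<^sup>+z. indicator torus3 (fst z) * ?H z \<partial>lborel)"
      by (intro add_mono nn_integral_mono) (auto simp: indicator_def)
    finally show ?thesis
      by (simp add: nn_integral_cmult ind mult.assoc)
  qed
  have "?l1 = (\<integral>\<^sup>+z. (\<integral>\<^sup>+y. ennreal (f z) * ennreal (G (y, snd z)) * periodization n (fst z) y \<partial>lborel) \<partial>lborel)"
    by (intro nn_integral_cong, subst nn_integral_cmult[symmetric]) (auto simp: mult.assoc)
  also have "\<dots> \<le> (\<integral>\<^sup>+z. (\<integral>\<^sup>+y. (ennreal \<delta> * ennreal (f z powr (3/2)) + ennreal (1 / \<delta>\<^sup>2) * ?H (y, snd z)) * periodization n (fst z) y \<partial>lborel) \<partial>lborel)"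
    by (intro nn_integral_mono mult_right_mono young) auto
  also have "\<dots> \<le> ?r"
    by (rule split[of "\<lambda>z y. (y, snd z)"]) (use nn_integral_periodization_y[of ?H n] in auto)
  finally show "?l1 \<le> ?r" .
  have "?l2 = (\<integral>\<^sup>+z. (\<integral>\<^sup>+y. ennreal (f z) * ennreal (G z) * periodization n (fst z) y \<partial>lborel) \<partial>lborel)"
    by (intro nn_integral_cong, subst nn_integral_cmult[symmetric]) (auto simp: mult.assoc)
  also have "\<dots> \<le> (\<integral>\<^sup>+z. (\<integral>\<^sup>+y. (ennreal \<delta> * ennreal (f z powr (3/2)) + ennreal (1 / \<delta>\<^sup>2) * ?H z) * periodization n (fst z) y \<partial>lborel) \<partial>lborel)"
    by (intro nn_integral_mono mult_right_mono young) auto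
  also have "\<dots> \<le> ?r"
  proof (rule split[of "\<lambda>z y. z"])
    have "(\<integral>\<^sup>+y. ?H z * periodization n (fst z) y \<partial>lborel) = indicator torus3 (fst z) * ?H z" for z
      by (subst nn_integral_cmult) (auto simp: periodization_nn_integral mult.commute)
    then show "(\<integral>\<^sup>+z. (\<integral>\<^sup>+y. ?H z * periodization n (fst z) y \<partial>lborel) \<partial>lborel) = (\<integral>\<^sup>+z. indicator torus3 (fst z) * ?H z \<partial>lborel)"
      by (intro nn_integral_cong)
  qed simp
  finally show "?l2 \<le> ?r" .
qed

text \<open>For fixed \<open>z\<close> over the open cube the inner average tends to zero by
  \<open>torus_kernel_concentrates\<close>, and it is at most \<open>2 * M\<close>; dominated
  convergence does the rest. The faces of the cube, where concentration fails, form a null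
  set.\<close>

lemma translation_defect_continuous:
  fixes f :: "(real^3) \<times> real \<Rightarrow> real" and h :: "(real^3) \<times> real \<Rightarrow> 'b::euclidean_space"
  assumes [measurable]: "f \<in> borel_measurable borel"
    and f: "\<And>z. 0 \<le> f z" "\<And>z. z \<notin> cylinder T \<Longrightarrow> f z = 0" and fin: "(\<integral>\<^sup>+z. ennreal (f z) \<partial>lborel) < \<infinity>"
    and h: "continuous_on UNIV h" "\<And>z. norm (h z) \<le> M"
  shows "(\<lambda>n. translation_defect n f h) \<longlonglongrightarrow> 0"
proof -
  have [measurable]: "h \<in> borel_measurable borel"
    using h(1) by (rule borel_measurable_continuous_onI)
  let ?I = "\<lambda>n z. \<integral>\<^sup>+y. ennreal (norm (h (y, snd z) - h z)) * periodization n (fst z) y \<partial>lborel"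
  have M: "0 \<le> M" using h(2) norm_ge_zero order.trans by blast
  have le: "norm (h w - h z) \<le> 2 * M" for w z
    using norm_triangle_ineq4[of "h w" "h z"] h(2)[of w] h(2)[of z] by linarith
  have I_le: "?I n z \<le> ennreal (2 * M)" for n z
  proof -
    have "?I n z \<le> (\<integral>\<^sup>+y. ennreal (2 * M) * periodization n (fst z) y \<partial>lborel)"
      by (intro nn_integral_mono mult_right_mono ennreal_leI le) auto
    also have "\<dots> = ennreal (2 * M) * indicator torus3 (fst z)"
      by (simp add: nn_integral_cmult periodization_nn_integral)
    also have "\<dots> \<le> ennreal (2 * M)"
      by (auto simp: indicator_def)
    finally show ?thesis .
  qed
  have I_lim: "(\<lambda>n. ?I n z) \<longlonglongrightarrow> 0" if z: "fst z \<in> box 0 One" for z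
  proof -
    let ?\<phi> = "\<lambda>y. norm (h (y, snd z) - h z)"
    have \<phi>: "continuous_on UNIV ?\<phi>"
      by (intro continuous_on_norm continuous_on_diff continuous_on_const
          continuous_on_compose2[OF h(1)]) (auto intro!: continuous_intros)
    have zt: "fst z \<in> torus3"
      using z box_subset_cbox by blast
    have "?I n z = ennreal (\<integral>y. indicator torus3 y * (torus_kernel n (fst z - y) * ?\<phi> y) \<partial>lborel)" for n
    proof -
      have "?I n z = (\<integral>\<^sup>+y. ennreal (indicator torus3 y * (torus_kernel n (fst z - y) * ?\<phi> y)) \<partial>lborel)"
        using zt by (intro nn_integral_cong) (auto simp: periodization_def indicator_def
            ennreal_mult' torus_kernel_nonneg mult.commute)
      also have "\<dots> = ennreal (\<integral>y. indicator torus3 y * (torus_kernel n (fst z - y) * ?\<phi> y) \<partial>lborel)"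
        by (intro nn_integral_eq_integral integrable_indicator_torus continuous_on_mult \<phi>
            continuous_compose_torus trig_poly_continuous trig_poly_torus_kernel)
          (simp add: torus_kernel_nonneg)
      finally show ?thesis .
    qed
    moreover have "(\<lambda>n. \<integral>y. indicator torus3 y * (torus_kernel n (fst z - y) * ?\<phi> y) \<partial>lborel) \<longlonglongrightarrow> 0"
      by (rule torus_kernel_concentrates[OF z \<phi>, of "2 * M"]) (use le in auto)
    ultimately show ?thesis
      using tendsto_ennrealI by fastforce
  qed
  have [measurable]: "{z. f z = 0 \<or> fst z \<in> box 0 (One :: real^3)} \<in> sets borel"
    by measurable
  have AE: "AE z in lborel. f z = 0 \<or> fst z \<in> box 0 (One :: real^3)"
  proof -
    have "negligible (torus3 - box 0 (One :: real^3))"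
      using negligible_frontier_interval[of 0 "One :: real^3"] by simp
    then have "AE x in lborel. x \<notin> torus3 - box 0 (One :: real^3)"
      using AE_not_in[of "torus3 - box 0 (One :: real^3)" lebesgue] by (simp add: negligible_iff_null_sets AE_completion_iff)
    then have "AE x in lborel. AE t in lborel. f (x, t) = 0 \<or> x \<in> box 0 One"
      by eventually_elim (auto intro!: AE_I2 f(2) simp del: mem_box)
    then have "AE z in lborel \<Otimes>\<^sub>M lborel. f z = 0 \<or> fst z \<in> box 0 (One :: real^3)"
    proof (intro lborel_pair.AE_pair_measure)
      show "{z \<in> space (lborel \<Otimes>\<^sub>M lborel). f z = 0 \<or> fst z \<in> box 0 (One :: real^3)} \<in> sets (lborel \<Otimes>\<^sub>M lborel)"
        unfolding lborel_prod by (simp del: mem_box)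
    qed simp
    then show ?thesis
      unfolding lborel_prod .
  qed
  have "(\<lambda>n. \<integral>\<^sup>+z. ennreal (f z) * ?I n z \<partial>lborel) \<longlonglongrightarrow> (\<integral>\<^sup>+z. 0 \<partial>(lborel :: ((real^3) \<times> real) measure))"
  proof (rule nn_integral_dominated_convergence[where w = "\<lambda>z. ennreal (f z) * ennreal (2 * M)"])
    show "AE z in lborel. ennreal (f z) * ?I n z \<le> ennreal (f z) * ennreal (2 * M)" for n
      by (intro AE_I2 mult_left_mono I_le) simp
    show "AE z in lborel. (\<lambda>n. ennreal (f z) * ?I n z) \<longlonglongrightarrow> 0"
      using AE
    proof eventually_elim
      case (elim z)
      then consider "f z = 0" | "fst z \<in> box 0 One" by blast
      then show ?case
      proof cases
        case 2
        then have "(\<lambda>n. ennreal (f z) * ?I n z) \<longlonglongrightarrow> ennreal (f z) * 0"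
          by (intro ennreal_tendsto_cmult I_lim) auto
        then show ?thesis by simp
      qed simp
    qed
    show "(\<integral>\<^sup>+z. ennreal (f z) * ennreal (2 * M) \<partial>lborel) < \<infinity>"
      using fin by (simp add: nn_integral_multc ennreal_mult_less_top)
  qed auto
  then show ?thesis
    by (simp add: translation_defect_def)
qed

lemma cylinder_sets [measurable]: "cylinder T \<in> sets borel"
  by (intro borel_Times) auto

lemma emeasure_cylinder: "emeasure lborel (cylinder T) < \<infinity>"
  by (intro emeasure_bounded_finite bounded_Times) auto

text \<open>A smaller power is bounded by the larger power plus 1, and the cylinder has finite
  measure.\<close>

lemma nn_integral_powr_finite_mono:
  fixes w :: "(real^3) \<times> real \<Rightarrow> 'b::euclidean_space"
  assumes [measurable]: "w \<in> borel_measurable borel" and zero: "\<And>z. z \<notin> cylinder T \<Longrightarrow> w z = 0"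
    and fin: "(\<integral>\<^sup>+z. ennreal (norm (w z) powr q) \<partial>lborel) < \<infinity>" and pq: "0 \<le> p" "p \<le> q"
  shows "(\<integral>\<^sup>+z. ennreal (norm (w z) powr p) \<partial>lborel) < \<infinity>"
proof -
  have "ennreal (norm (w z) powr p) \<le> ennreal (norm (w z) powr q) + indicator (cylinder T) z" for z
  proof (cases "z \<in> cylinder T")
    case True
    have "norm (w z) powr p \<le> norm (w z) powr q + 1"
    proof (cases "norm (w z) \<le> 1")
      case True
      then have "norm (w z) powr p \<le> 1 powr p"
        using pq by (intro powr_mono2) auto
      then show ?thesis by (simp add: add_increasing)
    next
      case False
      then have "norm (w z) powr p \<le> norm (w z) powr q"
        using pq by (intro powr_mono) auto
      then show ?thesis by simp
    qed
    then have "ennreal (norm (w z) powr p) \<le> ennreal (norm (w z) powr q + 1)"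
      by (rule ennreal_leI)
    then show ?thesis
      using True by (simp add: ennreal_plus)
  qed (simp add: zero)
  then have "(\<integral>\<^sup>+z. ennreal (norm (w z) powr p) \<partial>lborel) \<le>
      (\<integral>\<^sup>+z. ennreal (norm (w z) powr q) + indicator (cylinder T) z \<partial>lborel)"
    by (intro nn_integral_mono)
  also have "\<dots> < \<infinity>"
    using fin emeasure_cylinder[of T] by (simp add: nn_integral_add less_top)
  finally show ?thesis .
qed

text \<open>A density argument: \<open>g\<close> is replaced by a bounded continuous
  \<open>h\<close>, and the Young bounds control the two replacement errors uniformly in
  \<open>n\<close>.\<close>

lemma translation_defect_tendsto_0:
  fixes f :: "(real^3) \<times> real \<Rightarrow> real" and g :: "(real^3) \<times> real \<Rightarrow> 'b::euclidean_space"
  assumes [measurable]: "f \<in> borel_measurable borel" "g \<in> borel_measurable borel"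
    and f: "\<And>z. 0 \<le> f z" "\<And>z. z \<notin> cylinder T \<Longrightarrow> f z = 0"
      "(\<integral>\<^sup>+z. ennreal (f z powr (3/2)) \<partial>lborel) < \<infinity>"
    and g: "(\<integral>\<^sup>+z. ennreal (norm (g z) ^ 3) \<partial>lborel) < \<infinity>"
  shows "(\<lambda>n. translation_defect n f g) \<longlonglongrightarrow> 0"
proof (rule tendsto_zero_ennreal)
  fix e :: real
  assume "0 < e"
  obtain A where A: "A \<ge> 0" "(\<integral>\<^sup>+z. ennreal (f z powr (3/2)) \<partial>lborel) = ennreal A"
    using f(3) by (cases "\<integral>\<^sup>+z. ennreal (f z powr (3/2)) \<partial>lborel") auto
  \<comment> \<open>Makes the first Young term at most \<open>e / 8\<close>; the summand 1 covers
    the case \<open>A = 0\<close>.\<close>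
  define \<delta> where "\<delta> = e / (8 * (A + 1))"
  have \<delta>: "\<delta> > 0" "\<delta> * A \<le> e / 8"
    using \<open>e > 0\<close> A by (auto simp: \<delta>_def field_simps)
  \<comment> \<open>Chosen after \<open>\<delta>\<close>, to compensate the inverse square of
    \<open>\<delta>\<close> in the second Young term.\<close>
  define \<epsilon> where "\<epsilon> = e * \<delta>\<^sup>2 / 8"
  have \<epsilon>: "\<epsilon> > 0" "1 / \<delta>\<^sup>2 * \<epsilon> = e / 8"
    using \<open>e > 0\<close> \<delta> by (auto simp: \<epsilon>_def)
  obtain h M where h: "continuous_on UNIV h" "\<And>z. norm (h z) \<le> M"
    "(\<integral>\<^sup>+z. indicator (cylinder T) z * ennreal (norm (g z - h z) ^ 3) \<partial>lborel) \<le> ennreal \<epsilon>"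
    by (rule continuous_approximation_L3[OF assms(2) g cylinder_sets emeasure_cylinder \<epsilon>(1)], rule that)
  have [measurable]: "h \<in> borel_measurable borel"
    using h(1) by (rule borel_measurable_continuous_onI)
  let ?G = "\<lambda>z. norm (g z - h z)"
  have [measurable]: "?G \<in> borel_measurable borel"
    by measurable
  have f_int: "(\<integral>\<^sup>+z. ennreal (f z) \<partial>lborel) < \<infinity>"
    using nn_integral_powr_finite_mono[OF assms(1) f(2), of T "3/2" 1] f(1,3) by simp
  have young: "ennreal \<delta> * ennreal A +
      ennreal (1 / \<delta>\<^sup>2) * (\<integral>\<^sup>+z. indicator (cylinder T) z * ennreal (?G z ^ 3) \<partial>lborel) \<le> ennreal (e / 4)"
  proof -
    have "ennreal \<delta> * ennreal A = ennreal (\<delta> * A)"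
      using \<delta> A by (intro ennreal_mult[symmetric]) auto
    also have "\<dots> \<le> ennreal (e / 8)"
      using \<delta> by (intro ennreal_leI)
    finally have 1: "ennreal \<delta> * ennreal A \<le> ennreal (e / 8)" .
    have "ennreal (1 / \<delta>\<^sup>2) * (\<integral>\<^sup>+z. indicator (cylinder T) z * ennreal (?G z ^ 3) \<partial>lborel) \<le>
        ennreal (1 / \<delta>\<^sup>2) * ennreal \<epsilon>"
      using h(3) by (intro mult_left_mono) auto
    also have "\<dots> = ennreal (1 / \<delta>\<^sup>2 * \<epsilon>)"
      using \<epsilon> by (intro ennreal_mult[symmetric]) auto
    finally have "ennreal (1 / \<delta>\<^sup>2) * (\<integral>\<^sup>+z. indicator (cylinder T) z * ennreal (?G z ^ 3) \<partial>lborel) \<le> ennreal (e / 8)"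
      unfolding \<epsilon>(2) .
    with 1 have "ennreal \<delta> * ennreal A +
      ennreal (1 / \<delta>\<^sup>2) * (\<integral>\<^sup>+z. indicator (cylinder T) z * ennreal (?G z ^ 3) \<partial>lborel) \<le> ennreal (e / 8) + ennreal (e / 8)"
      by (rule add_mono)
    also have "\<dots> = ennreal (e / 8 + e / 8)"
      using \<open>e > 0\<close> by (intro ennreal_plus[symmetric]) auto
    finally show ?thesis by simp
  qed
  have le: "translation_defect n f g \<le> translation_defect n f h + ennreal (e / 2)" for n
  proof -
    let ?a = "\<lambda>z y. ennreal (norm (h (y, snd z) - h z)) * periodization n (fst z) y"
    let ?b = "\<lambda>z y. ennreal (?G (y, snd z)) * periodization n (fst z) y"
    let ?c = "\<lambda>z y. ennreal (?G z) * periodization n (fst z) y"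
    have "translation_defect n f g \<le>
        (\<integral>\<^sup>+z. ennreal (f z) * (\<integral>\<^sup>+y. ?a z y + ?b z y + ?c z y \<partial>lborel) \<partial>lborel)"
      unfolding translation_defect_def
    proof (intro nn_integral_mono mult_left_mono)
      fix z :: "(real^3) \<times> real" and y :: "real^3"
      have "norm (g (y, snd z) - g z) \<le> norm (h (y, snd z) - h z) + ?G (y, snd z) + ?G z"
        using norm_triangle_ineq[of "h (y, snd z) - h z" "(g (y, snd z) - h (y, snd z)) - (g z - h z)"]
          norm_triangle_ineq4[of "g (y, snd z) - h (y, snd z)" "g z - h z"]
        by (simp add: algebra_simps)
      then have "ennreal (norm (g (y, snd z) - g z)) \<le> ennreal (norm (h (y, snd z) - h z) + ?G (y, snd z) + ?G z)"
        by (rule ennreal_leI)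
      then have "ennreal (norm (g (y, snd z) - g z)) * periodization n (fst z) y \<le>
          ennreal (norm (h (y, snd z) - h z) + ?G (y, snd z) + ?G z) * periodization n (fst z) y"
        by (rule mult_right_mono) simp
      then show "ennreal (norm (g (y, snd z) - g z)) * periodization n (fst z) y \<le> ?a z y + ?b z y + ?c z y"
        by (simp add: ennreal_plus distrib_right)
    qed simp
    also have "\<dots> = (\<integral>\<^sup>+z. ennreal (f z) * (\<integral>\<^sup>+y. ?a z y \<partial>lborel) + ennreal (f z) * (\<integral>\<^sup>+y. ?b z y \<partial>lborel) +
        ennreal (f z) * (\<integral>\<^sup>+y. ?c z y \<partial>lborel) \<partial>lborel)"
      by (intro nn_integral_cong) (simp add: nn_integral_add distrib_left)
    also have "\<dots> = translation_defect n f h + (\<integral>\<^sup>+z. ennreal (f z) * (\<integral>\<^sup>+y. ?b z y \<partial>lborel) \<partial>lborel) +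
        (\<integral>\<^sup>+z. ennreal (f z) * (\<integral>\<^sup>+y. ?c z y \<partial>lborel) \<partial>lborel)"
      by (simp add: nn_integral_add translation_defect_def)
    also have "\<dots> \<le> translation_defect n f h + ennreal (e / 4) + ennreal (e / 4)"
    proof (intro add_mono order_refl)
      show "(\<integral>\<^sup>+z. ennreal (f z) * (\<integral>\<^sup>+y. ?b z y \<partial>lborel) \<partial>lborel) \<le> ennreal (e / 4)"
        by (rule order.trans[OF nn_integral_periodization_young(1)[OF _ _ f(1,2) _ \<delta>(1)]])
          (use young in \<open>auto simp: A(2)\<close>)
      show "(\<integral>\<^sup>+z. ennreal (f z) * (\<integral>\<^sup>+y. ?c z y \<partial>lborel) \<partial>lborel) \<le> ennreal (e / 4)"
        by (rule order.trans[OF nn_integral_periodization_young(2)[OF _ _ f(1,2) _ \<delta>(1)]])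
          (use young in \<open>auto simp: A(2)\<close>)
    qed
    also have "\<dots> = translation_defect n f h + ennreal (e / 2)"
    proof -
      have "ennreal (e / 4) + ennreal (e / 4) = ennreal (e / 4 + e / 4)"
        using \<open>e > 0\<close> by (intro ennreal_plus[symmetric]) auto
      then show ?thesis by (simp add: add.assoc)
    qed
    finally show ?thesis .
  qed
  have "(\<lambda>n. translation_defect n f h) \<longlonglongrightarrow> 0"
    by (rule translation_defect_continuous[OF assms(1) f(1,2) f_int h(1,2)])
  then have "\<forall>\<^sub>F n in sequentially. translation_defect n f h < ennreal (e / 2)"
    by (rule order_tendstoD) (use \<open>e > 0\<close> in simp)
  then show "\<forall>\<^sub>F n in sequentially. translation_defect n f g < ennreal e"
  proof eventually_elim
    case (elim n)
    have "translation_defect n f g < ennreal (e / 2) + ennreal (e / 2)"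
    proof (rule order.strict_trans1[OF le])
      show "translation_defect n f h + ennreal (e / 2) < ennreal (e / 2) + ennreal (e / 2)"
        using elim by (subst add.commute) (simp add: ennreal_add_left_cancel_less del: ennreal_plus)
    qed
    also have "\<dots> = ennreal (e / 2 + e / 2)"
      using \<open>e > 0\<close> by (intro ennreal_plus[symmetric]) auto
    finally show ?case by simp
  qed
qed

section \<open>Pairings with trigonometric kernels\<close>

lemma trig_poly_bounded: "trig_poly f \<Longrightarrow> \<exists>B. \<forall>z. \<bar>f z\<bar> \<le> B"
proof (induction rule: trig_poly.induct)
  case (cos \<kappa>)
  then show ?case by (intro exI[of _ 1]) simp
next
  case (add f g)
  then obtain B B' where "\<forall>z. \<bar>f z\<bar> \<le> B" "\<forall>z. \<bar>g z\<bar> \<le> B'" by blast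
  then have "\<bar>f z + g z\<bar> \<le> B + B'" for z
    using abs_triangle_ineq[of "f z" "g z"] by (meson add_mono order.trans)
  then show ?case by blast
next
  case (scale f c)
  then obtain B where "\<forall>z. \<bar>f z\<bar> \<le> B" by blast
  then have "\<bar>c * f z\<bar> \<le> \<bar>c\<bar> * B" for z
    by (simp add: abs_mult mult_left_mono)
  then show ?case by blast
qed

lemma trig_poly_measurable: "trig_poly f \<Longrightarrow> f \<in> borel_measurable borel"
  by (intro borel_measurable_continuous_onI trig_poly_continuous)

text \<open>Integration over the whole space is meant for fields extended by zero outside the cube;
  with a periodic \<open>f\<close> this is convolution on the torus.\<close>

definition convolution :: "(real^3 \<Rightarrow> real) \<Rightarrow> (real^3 \<Rightarrow> real^3) \<Rightarrow> real^3 \<Rightarrow> real^3" where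
  "convolution f v x = (\<integral>y. f (x - y) *\<^sub>R v y \<partial>lborel)"

definition pairing :: "(real^3 \<Rightarrow> real) \<Rightarrow> (real^3 \<Rightarrow> real^3) \<Rightarrow> (real^3 \<Rightarrow> real^3) \<Rightarrow> real" where
  "pairing f w v = (\<integral>x. w x \<bullet> convolution f v x \<partial>lborel)"

lemma integrable_convolution:
  fixes v :: "real^3 \<Rightarrow> real^3"
  assumes f: "trig_poly f" and v: "integrable lborel v"
  shows "integrable lborel (\<lambda>y. f (x - y) *\<^sub>R v y)"
proof -
  obtain B where B: "\<And>z. \<bar>f z\<bar> \<le> B"
    using trig_poly_bounded[OF f] by blast
  have [measurable]: "f \<in> borel_measurable borel"
    using f by (rule trig_poly_measurable)
  show ?thesis
    by (rule integrable_bilinear_bounded[OF bounded_bilinear.flip[OF bounded_bilinear_scaleR] v, of _ B])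
      (use B in auto)
qed

lemma convolution_measurable:
  assumes f: "trig_poly f" and v: "integrable lborel v"
  shows "convolution f v \<in> borel_measurable borel"
proof -
  note [measurable] = trig_poly_measurable[OF f] borel_measurable_integrable[OF v]
  have "(\<lambda>p::(real^3) \<times> (real^3). f (fst p - snd p)) \<in> borel_measurable (borel \<Otimes>\<^sub>M borel)"
    by (rule measurable_compose[OF _ trig_poly_measurable[OF f]]) measurable
  then have [measurable]: "(\<lambda>(x, y). f (x - y) *\<^sub>R v y) \<in> borel_measurable (borel \<Otimes>\<^sub>M lborel)"
    by (simp add: split_beta)
  show ?thesis
    unfolding convolution_def by measurable
qed

lemma convolution_bounded:
  assumes f: "trig_poly f" and v: "integrable lborel v"
  obtains B where "\<And>x. norm (convolution f v x) \<le> B"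
proof -
  obtain B where B: "\<And>z. \<bar>f z\<bar> \<le> B"
    using trig_poly_bounded[OF f] by blast
  have "norm (convolution f v x) \<le> (\<integral>y. B * norm (v y) \<partial>lborel)" for x
    unfolding convolution_def
  proof (rule order.trans[OF integral_norm_bound integral_mono])
    show "norm (f (x - y) *\<^sub>R v y) \<le> B * norm (v y)" for y
      using B by (simp add: mult_right_mono)
    show "integrable lborel (\<lambda>y. norm (f (x - y) *\<^sub>R v y))"
      by (rule integrable_norm[OF integrable_convolution[OF f v]])
    show "integrable lborel (\<lambda>y. B * norm (v y))"
      using v by simp
  qed
  then show ?thesis by (rule that)
qed

lemma integrable_pairing:
  assumes f: "trig_poly f" and v: "integrable lborel v" and w: "integrable lborel w"
  shows "integrable lborel (\<lambda>x. w x \<bullet> convolution f v x)"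
proof -
  obtain B where B: "\<And>x. norm (convolution f v x) \<le> B"
    using convolution_bounded[OF f v] by blast
  show ?thesis
    by (rule integrable_bilinear_bounded[OF bounded_bilinear_inner w _ B])
      (use convolution_measurable[OF f v] in simp)
qed

lemma pairing_add:
  assumes "trig_poly f" "trig_poly g" "integrable lborel v" "integrable lborel w"
  shows "pairing (\<lambda>z. f z + g z) w v = pairing f w v + pairing g w v"
proof -
  have "convolution (\<lambda>z. f z + g z) v x = convolution f v x + convolution g v x" for x
    unfolding convolution_def using assms(1-3) by (simp add: scaleR_left_distrib integrable_convolution)
  then show ?thesis
    unfolding pairing_def using assms by (simp add: inner_add_right integrable_pairing)
qed

lemma pairing_scale: "pairing (\<lambda>z. c * f z) w v = c * pairing f w v"
proof -
  have "convolution (\<lambda>z. c * f z) v x = c *\<^sub>R convolution f v x" for x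
    unfolding convolution_def by (simp flip: scaleR_scaleR)
  then show ?thesis
    unfolding pairing_def by simp
qed

definition fourier_cos :: "real^3 \<Rightarrow> (real^3 \<Rightarrow> real^3) \<Rightarrow> real^3" where
  "fourier_cos \<kappa> v = (\<integral>x. cos (\<kappa> \<bullet> x) *\<^sub>R v x \<partial>lborel)"

definition fourier_sin :: "real^3 \<Rightarrow> (real^3 \<Rightarrow> real^3) \<Rightarrow> real^3" where
  "fourier_sin \<kappa> v = (\<integral>x. sin (\<kappa> \<bullet> x) *\<^sub>R v x \<partial>lborel)"

lemma integrable_coeff:
  fixes v :: "real^3 \<Rightarrow> real^3"
  assumes v: "integrable lborel v"
  shows "integrable lborel (\<lambda>x. cos (\<kappa> \<bullet> x) *\<^sub>R v x)" "integrable lborel (\<lambda>x. sin (\<kappa> \<bullet> x) *\<^sub>R v x)"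
  by (rule integrable_bilinear_bounded[OF bounded_bilinear.flip[OF bounded_bilinear_scaleR] v, of _ 1];
      simp)+

text \<open>The addition theorem splits the kernel into two products of a function of
  \<open>x\<close> and a function of \<open>y\<close>, so only the coefficients at one frequency
  enter.\<close>

lemma pairing_cos:
  assumes v: "integrable lborel v" and w: "integrable lborel w"
  shows "pairing (\<lambda>z. cos (\<kappa> \<bullet> z)) w v =
    fourier_cos \<kappa> w \<bullet> fourier_cos \<kappa> v + fourier_sin \<kappa> w \<bullet> fourier_sin \<kappa> v"
proof -
  have conv: "convolution (\<lambda>z. cos (\<kappa> \<bullet> z)) v x = cos (\<kappa> \<bullet> x) *\<^sub>R fourier_cos \<kappa> v + sin (\<kappa> \<bullet> x) *\<^sub>R fourier_sin \<kappa> v" for x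
  proof -
    have "convolution (\<lambda>z. cos (\<kappa> \<bullet> z)) v x =
        (\<integral>y. cos (\<kappa> \<bullet> x) *\<^sub>R (cos (\<kappa> \<bullet> y) *\<^sub>R v y) + sin (\<kappa> \<bullet> x) *\<^sub>R (sin (\<kappa> \<bullet> y) *\<^sub>R v y) \<partial>lborel)"
      unfolding convolution_def by (simp add: inner_diff_right cos_diff scaleR_left_distrib)
    also have "\<dots> = cos (\<kappa> \<bullet> x) *\<^sub>R fourier_cos \<kappa> v + sin (\<kappa> \<bullet> x) *\<^sub>R fourier_sin \<kappa> v"
      unfolding fourier_cos_def fourier_sin_def using integrable_coeff[OF v]
      by (subst Bochner_Integration.integral_add) (simp_all del: scaleR_scaleR)
    finally show ?thesis .
  qed
  have "pairing (\<lambda>z. cos (\<kappa> \<bullet> z)) w v =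
      (\<integral>x. (cos (\<kappa> \<bullet> x) *\<^sub>R w x) \<bullet> fourier_cos \<kappa> v + (sin (\<kappa> \<bullet> x) *\<^sub>R w x) \<bullet> fourier_sin \<kappa> v \<partial>lborel)"
    unfolding pairing_def conv by (simp add: inner_add_right)
  also have "\<dots> = (\<integral>x. (cos (\<kappa> \<bullet> x) *\<^sub>R w x) \<bullet> fourier_cos \<kappa> v \<partial>lborel) + (\<integral>x. (sin (\<kappa> \<bullet> x) *\<^sub>R w x) \<bullet> fourier_sin \<kappa> v \<partial>lborel)"
    using integrable_coeff[OF w] by (intro Bochner_Integration.integral_add integrable_inner_left)
  also have "\<dots> = fourier_cos \<kappa> w \<bullet> fourier_cos \<kappa> v + fourier_sin \<kappa> w \<bullet> fourier_sin \<kappa> v"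
    unfolding fourier_cos_def[of \<kappa> w] fourier_sin_def[of \<kappa> w]
    using integral_bounded_linear[OF bounded_linear_inner_left integrable_coeff(1)[OF w]]
      integral_bounded_linear[OF bounded_linear_inner_left integrable_coeff(2)[OF w]] by simp
  finally show ?thesis .
qed

text \<open>For \<open>x\<close> in the cube the kernel has unit mass, so the error of the
  convolution is an average of differences \<open>v y - v x\<close>; for other \<open>x\<close> the
  weight \<open>w x\<close> vanishes.\<close>

lemma pairing_torus_kernel_defect:
  assumes v: "integrable lborel v" "\<And>x. x \<notin> torus3 \<Longrightarrow> v x = 0"
    and w: "integrable lborel w" "\<And>x. x \<notin> torus3 \<Longrightarrow> w x = 0"
    and wv: "integrable lborel (\<lambda>x. w x \<bullet> v x)"
  shows "ennreal \<bar>pairing (torus_kernel n) w v - (\<integral>x. w x \<bullet> v x \<partial>lborel)\<bar> \<le>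
    (\<integral>\<^sup>+x. ennreal (norm (w x)) * (\<integral>\<^sup>+y. ennreal (norm (v y - v x)) * periodization n x y \<partial>lborel) \<partial>lborel)"
proof -
  note f = trig_poly_torus_kernel[of n]
  note int = integrable_pairing[OF f v(1) w(1)]
  have "pairing (torus_kernel n) w v - (\<integral>x. w x \<bullet> v x \<partial>lborel) =
      (\<integral>x. w x \<bullet> convolution (torus_kernel n) v x - w x \<bullet> v x \<partial>lborel)"
    unfolding pairing_def using int wv by simp
  also have "ennreal \<bar>\<dots>\<bar> \<le> (\<integral>\<^sup>+x. ennreal (norm (w x \<bullet> convolution (torus_kernel n) v x - w x \<bullet> v x)) \<partial>lborel)"
    using integral_norm_bound_ennreal[OF Bochner_Integration.integrable_diff[OF int wv]] by simp
  also have "\<dots> \<le> (\<integral>\<^sup>+x. ennreal (norm (w x)) * (\<integral>\<^sup>+y. ennreal (norm (v y - v x)) * periodization n x y \<partial>lborel) \<partial>lborel)"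
  proof (rule nn_integral_mono)
    fix x :: "real^3"
    show "ennreal (norm (w x \<bullet> convolution (torus_kernel n) v x - w x \<bullet> v x)) \<le>
        ennreal (norm (w x)) * (\<integral>\<^sup>+y. ennreal (norm (v y - v x)) * periodization n x y \<partial>lborel)"
    proof (cases "x \<in> torus3")
      case True
      let ?K = "\<lambda>y. indicator torus3 y * torus_kernel n (x - y)"
      have K_int: "integrable lborel ?K"
        by (intro integrable_indicator_torus continuous_compose_torus trig_poly_continuous f)
      have Kv: "torus_kernel n (x - y) *\<^sub>R v y = ?K y *\<^sub>R v y" for y
        by (cases "y \<in> torus3") (simp_all add: v(2))
      have conv: "convolution (torus_kernel n) v x = (\<integral>y. ?K y *\<^sub>R v y \<partial>lborel)"
        unfolding convolution_def Kv ..
      have Kv_int: "integrable lborel (\<lambda>y. ?K y *\<^sub>R v y)"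
        using integrable_convolution[OF f v(1), of x] unfolding Kv .
      have vx: "v x = (\<integral>y. ?K y *\<^sub>R v x \<partial>lborel)"
        using K_int torus_kernel_integral[of n x] by simp
      have diff_int: "integrable lborel (\<lambda>y. ?K y *\<^sub>R (v y - v x))"
        using Bochner_Integration.integrable_diff[OF Kv_int integrable_scaleR_left[OF K_int, of "v x"]]
        by (simp only: scaleR_right_diff_distrib)
      have "convolution (torus_kernel n) v x - v x = (\<integral>y. ?K y *\<^sub>R v y \<partial>lborel) - (\<integral>y. ?K y *\<^sub>R v x \<partial>lborel)"
        using conv vx by simp
      also have "\<dots> = (\<integral>y. ?K y *\<^sub>R (v y - v x) \<partial>lborel)"
        using Kv_int integrable_scaleR_left[OF K_int, of "v x"]
        by (simp only: scaleR_right_diff_distrib Bochner_Integration.integral_diff)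
      finally have "ennreal (norm (convolution (torus_kernel n) v x - v x)) \<le> (\<integral>\<^sup>+y. ennreal (norm (?K y *\<^sub>R (v y - v x))) \<partial>lborel)"
        using integral_norm_bound_ennreal[OF diff_int] by simp
      also have "\<dots> = (\<integral>\<^sup>+y. ennreal (norm (v y - v x)) * periodization n x y \<partial>lborel)"
        using True by (intro nn_integral_cong)
          (auto simp: periodization_def indicator_def torus_kernel_nonneg ennreal_mult mult.commute)
      finally have conv_le: "ennreal (norm (convolution (torus_kernel n) v x - v x)) \<le> \<dots>" .
      have "norm (w x \<bullet> convolution (torus_kernel n) v x - w x \<bullet> v x) \<le> norm (w x) * norm (convolution (torus_kernel n) v x - v x)"
        using Cauchy_Schwarz_ineq2[of "w x" "convolution (torus_kernel n) v x - v x"] by (simp add: inner_diff_right)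
      then have "ennreal (norm (w x \<bullet> convolution (torus_kernel n) v x - w x \<bullet> v x)) \<le>
          ennreal (norm (w x) * norm (convolution (torus_kernel n) v x - v x))"
        by (rule ennreal_leI)
      also have "\<dots> = ennreal (norm (w x)) * ennreal (norm (convolution (torus_kernel n) v x - v x))"
        by (rule ennreal_mult) auto
      also have "\<dots> \<le> ennreal (norm (w x)) * (\<integral>\<^sup>+y. ennreal (norm (v y - v x)) * periodization n x y \<partial>lborel)"
        by (intro mult_left_mono conv_le) simp
      finally show ?thesis .
    qed (simp add: w(2))
  qed
  finally show ?thesis .
qed

text \<open>The numbers \<open>c n\<close> are not assumed to converge. They are eliminated by
  bounding the double integral of the distance between \<open>h t\<close> and \<open>h s\<close> by
  two of the given integrals; it is thus zero, and \<open>h\<close> agrees almost everywhere with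
  one of its own values.\<close>

lemma AE_const_if_L1_close:
  fixes h :: "real \<Rightarrow> real" and c :: "nat \<Rightarrow> real"
  assumes T: "0 < T" and [measurable]: "h \<in> borel_measurable borel"
    and lim: "(\<lambda>n. \<integral>\<^sup>+t. indicator {0<..<T} t * ennreal \<bar>h t - c n\<bar> \<partial>lborel) \<longlonglongrightarrow> 0"
  obtains C where "AE t in lborel. t \<in> {0<..<T} \<longrightarrow> h t = C"
proof -
  let ?i = "\<lambda>t. indicator {0<..<T} t :: ennreal"
  let ?D = "\<lambda>n. \<integral>\<^sup>+t. ?i t * ennreal \<bar>h t - c n\<bar> \<partial>lborel"
  have emeas: "(\<integral>\<^sup>+t. ?i t \<partial>lborel) = ennreal T"
    using T by simp
  have "(\<integral>\<^sup>+t. \<integral>\<^sup>+s. ?i t * (?i s * ennreal \<bar>h t - h s\<bar>) \<partial>lborel \<partial>lborel) \<le> ennreal T * ?D n + ennreal T * ?D n" for n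
  proof -
    have "(\<integral>\<^sup>+t. \<integral>\<^sup>+s. ?i t * (?i s * ennreal \<bar>h t - h s\<bar>) \<partial>lborel \<partial>lborel) \<le>
        (\<integral>\<^sup>+t. \<integral>\<^sup>+s. (?i t * ennreal \<bar>h t - c n\<bar>) * ?i s + ?i t * (?i s * ennreal \<bar>h s - c n\<bar>) \<partial>lborel \<partial>lborel)"
    proof (intro nn_integral_mono)
      fix t s
      have "ennreal \<bar>h t - h s\<bar> \<le> ennreal (\<bar>h t - c n\<bar> + \<bar>h s - c n\<bar>)"
        by (intro ennreal_leI) linarith
      then have "ennreal \<bar>h t - h s\<bar> \<le> ennreal \<bar>h t - c n\<bar> + ennreal \<bar>h s - c n\<bar>"
        by (simp add: ennreal_plus)
      then show "?i t * (?i s * ennreal \<bar>h t - h s\<bar>) \<le> (?i t * ennreal \<bar>h t - c n\<bar>) * ?i s + ?i t * (?i s * ennreal \<bar>h s - c n\<bar>)"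
        by (auto simp: indicator_def)
    qed
    also have "\<dots> = (\<integral>\<^sup>+t. (?i t * ennreal \<bar>h t - c n\<bar>) * ennreal T + ?i t * ?D n \<partial>lborel)"
      by (intro nn_integral_cong) (simp add: nn_integral_add nn_integral_cmult emeas del: nn_integral_indicator)
    also have "\<dots> = ennreal T * ?D n + ennreal T * ?D n"
      by (simp add: nn_integral_add nn_integral_multc emeas del: nn_integral_indicator) (simp add: mult.commute)
    finally show ?thesis .
  qed
  moreover have "(\<lambda>n. ennreal T * ?D n + ennreal T * ?D n) \<longlonglongrightarrow> ennreal T * 0 + ennreal T * 0"
    by (intro tendsto_add ennreal_tendsto_cmult lim) auto
  ultimately have "(\<integral>\<^sup>+t. \<integral>\<^sup>+s. ?i t * (?i s * ennreal \<bar>h t - h s\<bar>) \<partial>lborel \<partial>lborel) \<le> ennreal T * 0 + ennreal T * 0"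
    by (intro LIMSEQ_le_const) auto
  then have "(\<integral>\<^sup>+t. \<integral>\<^sup>+s. ?i t * (?i s * ennreal \<bar>h t - h s\<bar>) \<partial>lborel \<partial>lborel) = 0"
    by simp
  then have "AE t in lborel. (\<integral>\<^sup>+s. ?i t * (?i s * ennreal \<bar>h t - h s\<bar>) \<partial>lborel) = 0"
    by (subst (asm) nn_integral_0_iff_AE) auto
  then have AE: "AE t in lborel. t \<in> {0<..<T} \<longrightarrow> (AE s in lborel. s \<in> {0<..<T} \<longrightarrow> h s = h t)"
  proof eventually_elim
    case (elim t)
    then have "AE s in lborel. ?i t * (?i s * ennreal \<bar>h t - h s\<bar>) = 0"
      by (subst (asm) nn_integral_0_iff_AE) auto
    then show ?case
      by (auto simp: indicator_def elim!: eventually_mono split: if_splits)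
  qed
  \<comment> \<open>Almost every \<open>t\<close> qualifies and the interval has positive length, so
    a single reference time exists.\<close>
  have "\<exists>t\<in>{0<..<T}. AE s in lborel. s \<in> {0<..<T} \<longrightarrow> h s = h t"
  proof (rule ccontr)
    assume "\<not> ?thesis"
    then have "AE t in lborel. t \<notin> {0<..<T}"
      using AE by (auto elim!: eventually_mono)
    then have "{0<..<T} \<in> null_sets lborel"
      by (subst (asm) AE_iff_null_sets[symmetric]) auto
    then show False
      using T by (simp add: null_sets_def)
  qed
  then show ?thesis
    using that by blast
qed

section \<open>Helicity balance\<close>

lemma bounded_linear_cross3: "bounded_linear (cross3 \<kappa>)"
  using bilinear_cross by (simp add: bilinear_def linear_conv_bounded_linear)

lemma bounded_bilinear_cross3_inner: "bounded_bilinear (\<lambda>u v. cross3 \<kappa> u \<bullet> v)"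
  by (rule bounded_bilinear.comp1[OF bounded_bilinear_inner bounded_linear_cross3])

lemma cross3_cross3_self:
  "cross3 \<kappa> (cross3 \<kappa> x) = (\<kappa> \<bullet> x) *\<^sub>R \<kappa> - (\<kappa> \<bullet> \<kappa>) *\<^sub>R x" for x :: "real^3"
  by (simp add: cross3_simps forall_3)

lemma cross3_inner_cross3_self:
  "cross3 \<kappa> x \<bullet> cross3 \<kappa> y = (\<kappa> \<bullet> \<kappa>) * (x \<bullet> y) - (\<kappa> \<bullet> x) * (\<kappa> \<bullet> y)" for x y :: "real^3"
  by (simp add: cross3_simps)

lemma cross3_inner_skew: "cross3 \<kappa> x \<bullet> y = - (x \<bullet> cross3 \<kappa> y)" for x y :: "real^3"
  by (simp add: cross3_simps)

lemma
  fixes w :: "(real^3) \<times> real \<Rightarrow> 'b::euclidean_space"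
  assumes "integrable lborel w"
  shows AE_integrable_time_slice: "AE t in lborel. integrable lborel (\<lambda>x. w (x, t))"
    and integrable_time_slice_integral: "integrable lborel (\<lambda>t. \<integral>x. w (x, t) \<partial>lborel)"
proof -
  have "integrable (lborel \<Otimes>\<^sub>M lborel) (\<lambda>(x, t). w (x, t))"
    using assms by (simp add: lborel_prod)
  from lborel_pair.AE_integrable_snd[OF this] lborel_pair.integrable_snd[OF this]
  show "AE t in lborel. integrable lborel (\<lambda>x. w (x, t))"
    "integrable lborel (\<lambda>t. \<integral>x. w (x, t) \<partial>lborel)"
    by simp_all
qed

text \<open>The exceptional set itself is not assumed measurable; Tonelli is applied to a Borel null
  set containing it.\<close>

lemma AE_time_slice:
  fixes P :: "(real^3) \<times> real \<Rightarrow> bool"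
  assumes "AE z in lborel. P z"
  shows "AE t in lborel. AE x in lborel. P (x, t)"
proof -
  obtain N where N: "{z \<in> space lborel. \<not> P z} \<subseteq> N" "N \<in> null_sets lborel"
    using assms unfolding eventually_ae_filter by blast
  have [measurable]: "N \<in> sets borel"
    using N(2) by (auto dest: null_setsD2)
  have slice: "(\<lambda>x. indicator N (x, t) :: ennreal) \<in> borel_measurable borel" for t
    by (rule time_slice_measurable) auto
  have "(\<lambda>(t, x). indicator N (x, t) :: ennreal) \<in> borel_measurable (borel \<Otimes>\<^sub>M lborel)"
    unfolding split_beta by (rule time_slice_measurable) auto
  then have slice_int: "(\<lambda>t. \<integral>\<^sup>+x. indicator N (x, t) \<partial>lborel) \<in> borel_measurable borel"
    by (rule lborel.borel_measurable_nn_integral)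
  have "(\<integral>\<^sup>+t. \<integral>\<^sup>+x. indicator N (x, t) \<partial>lborel \<partial>lborel) = (\<integral>\<^sup>+z. indicator N z \<partial>lborel)"
    by (rule nn_integral_cylinder_snd[symmetric]) measurable
  also have "\<dots> = 0"
    using N(2) by (simp add: null_sets_def)
  finally have "AE t in lborel. (\<integral>\<^sup>+x. indicator N (x, t) \<partial>lborel) = 0"
    by (subst (asm) nn_integral_0_iff_AE) (simp_all add: slice_int)
  then show ?thesis
  proof eventually_elim
    case (elim t)
    then have "AE x in lborel. indicator N (x, t) = (0 :: ennreal)"
      using slice by (subst (asm) nn_integral_0_iff_AE) auto
    then show ?case
      using N(1) by (auto elim!: eventually_mono simp: indicator_def split: if_splits)
  qed
qed

lemma integrable_coeff_time:
  fixes w :: "(real^3) \<times> real \<Rightarrow> real^3"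
  assumes w: "integrable lborel w"
  shows "integrable lborel (\<lambda>t. fourier_cos \<kappa> (\<lambda>x. w (x, t)))"
    and "integrable lborel (\<lambda>t. fourier_sin \<kappa> (\<lambda>x. w (x, t)))"
proof -
  have "integrable lborel (\<lambda>z. cos (\<kappa> \<bullet> fst z) *\<^sub>R w z)" "integrable lborel (\<lambda>z. sin (\<kappa> \<bullet> fst z) *\<^sub>R w z)"
    by (rule integrable_bilinear_bounded[OF bounded_bilinear.flip[OF bounded_bilinear_scaleR] w, of _ 1];
        simp)+
  from this[THEN integrable_time_slice_integral]
  show "integrable lborel (\<lambda>t. fourier_cos \<kappa> (\<lambda>x. w (x, t)))"
    "integrable lborel (\<lambda>t. fourier_sin \<kappa> (\<lambda>x. w (x, t)))"
    by (simp_all add: fourier_cos_def fourier_sin_def)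
qed

lemma L1_if_Lp:
  fixes w :: "(real^3) \<times> real \<Rightarrow> 'b::euclidean_space"
  assumes [measurable]: "w \<in> borel_measurable borel" and zero: "\<And>z. z \<notin> cylinder T \<Longrightarrow> w z = 0"
    and fin: "(\<integral>\<^sup>+z. ennreal (norm (w z) powr p) \<partial>lborel) < \<infinity>" and p: "1 \<le> p"
  shows "integrable lborel w"
proof (rule integrableI_bounded)
  show "(\<integral>\<^sup>+z. ennreal (norm (w z)) \<partial>lborel) < \<infinity>"
    using nn_integral_powr_finite_mono[OF assms(1) zero fin, of T 1] p by simp
qed simp

section \<open>Evolution of single Fourier modes\<close>

text \<open>The data in the form used by the balance: Borel representatives extended by zero, and
  the differential relations only at lattice frequencies. Integrating by parts against a cosine
  brings out a sine and conversely, which explains how the two coefficient families cross and where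
  the signs come from.\<close>

locale induction_evolution =
  fixes T :: real and a b \<Psi> :: "(real^3) \<times> real \<Rightarrow> real^3"
  assumes T: "0 < T"
    and meas [measurable]: "a \<in> borel_measurable borel" "b \<in> borel_measurable borel" "\<Psi> \<in> borel_measurable borel"
    and zero: "\<And>z. z \<notin> cylinder T \<Longrightarrow> a z = 0" "\<And>z. z \<notin> cylinder T \<Longrightarrow> b z = 0"
      "\<And>z. z \<notin> cylinder T \<Longrightarrow> \<Psi> z = 0"
    and fin: "(\<integral>\<^sup>+z. ennreal (norm (a z) powr (3/2)) \<partial>lborel) < \<infinity>"
      "(\<integral>\<^sup>+z. ennreal (norm (b z) powr 3) \<partial>lborel) < \<infinity>"
      "(\<integral>\<^sup>+z. ennreal (norm (\<Psi> z) powr 3) \<partial>lborel) < \<infinity>"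
    and orth: "AE z in lborel. a z \<bullet> b z = 0"
    and potential: "\<And>\<kappa>. (\<And>i. \<exists>m::int. \<kappa> $ i = 2 * pi * m) \<Longrightarrow> AE t in lborel.
      fourier_cos \<kappa> (\<lambda>x. b (x, t)) = cross3 \<kappa> (fourier_sin \<kappa> (\<lambda>x. \<Psi> (x, t))) \<and>
      fourier_sin \<kappa> (\<lambda>x. b (x, t)) = - cross3 \<kappa> (fourier_cos \<kappa> (\<lambda>x. \<Psi> (x, t))) \<and>
      \<kappa> \<bullet> fourier_cos \<kappa> (\<lambda>x. \<Psi> (x, t)) = 0 \<and> \<kappa> \<bullet> fourier_sin \<kappa> (\<lambda>x. \<Psi> (x, t)) = 0"
    and induction: "\<And>\<kappa> \<eta> \<eta>'. (\<And>i. \<exists>m::int. \<kappa> $ i = 2 * pi * m) \<Longrightarrow> interval_test_function T \<eta> \<Longrightarrow>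
      (\<And>t. (\<eta> has_real_derivative \<eta>' t) (at t)) \<Longrightarrow>
      (\<integral>t. \<eta>' t *\<^sub>R fourier_cos \<kappa> (\<lambda>x. b (x, t)) \<partial>lborel) =
        (\<integral>t. \<eta> t *\<^sub>R cross3 \<kappa> (fourier_sin \<kappa> (\<lambda>x. a (x, t))) \<partial>lborel) \<and>
      (\<integral>t. \<eta>' t *\<^sub>R fourier_sin \<kappa> (\<lambda>x. b (x, t)) \<partial>lborel) =
        - (\<integral>t. \<eta> t *\<^sub>R cross3 \<kappa> (fourier_cos \<kappa> (\<lambda>x. a (x, t))) \<partial>lborel)"
begin

lemma integrable_data: "integrable lborel a" "integrable lborel b" "integrable lborel \<Psi>"
  using L1_if_Lp[OF meas(1) zero(1) fin(1)] L1_if_Lp[OF meas(2) zero(2) fin(2)]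
    L1_if_Lp[OF meas(3) zero(3) fin(3)] by simp_all

lemma coeff_outside:
  assumes "t \<notin> {0<..<T}"
  shows "fourier_cos \<kappa> (\<lambda>x. a (x, t)) = 0" "fourier_sin \<kappa> (\<lambda>x. a (x, t)) = 0"
    "fourier_cos \<kappa> (\<lambda>x. b (x, t)) = 0" "fourier_sin \<kappa> (\<lambda>x. b (x, t)) = 0"
  using assms zero by (simp_all add: fourier_cos_def fourier_sin_def)

text \<open>By \<open>pairing_cos\<close> this and \<open>mode_flux\<close> are the pairings for the
  kernel with the single frequency \<open>\<kappa>\<close>.\<close>

definition mode_helicity :: "real^3 \<Rightarrow> real \<Rightarrow> real" where
  "mode_helicity \<kappa> t = fourier_cos \<kappa> (\<lambda>x. \<Psi> (x, t)) \<bullet> fourier_cos \<kappa> (\<lambda>x. b (x, t)) +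
    fourier_sin \<kappa> (\<lambda>x. \<Psi> (x, t)) \<bullet> fourier_sin \<kappa> (\<lambda>x. b (x, t))"

definition mode_flux :: "real^3 \<Rightarrow> real \<Rightarrow> real" where
  "mode_flux \<kappa> t = fourier_cos \<kappa> (\<lambda>x. a (x, t)) \<bullet> fourier_cos \<kappa> (\<lambda>x. b (x, t)) +
    fourier_sin \<kappa> (\<lambda>x. a (x, t)) \<bullet> fourier_sin \<kappa> (\<lambda>x. b (x, t))"

lemma mode_flux_measurable: "mode_flux \<kappa> \<in> borel_measurable borel"
  using integrable_coeff_time[OF integrable_data(1), of \<kappa>, THEN borel_measurable_integrable]
    integrable_coeff_time[OF integrable_data(2), of \<kappa>, THEN borel_measurable_integrable]
  unfolding mode_flux_def by simp

text \<open>The weak equations make the coefficients of \<open>b\<close> constants plus primitives.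
  The product \<open>cross3 \<kappa> u \<bullet> v\<close>, taken at the sine and cosine
  coefficients of \<open>b\<close>, equals \<open>N\<close> times either summand of the helicity; by
  \<open>primitive_product\<close> it changes at the rate \<open>- N\<close> times the flux.\<close>

lemma mode_balance:
  assumes \<kappa>: "\<And>i. \<exists>m::int. \<kappa> $ i = 2 * pi * m"
  shows "integrable lborel (mode_flux \<kappa>) \<and>
    (\<exists>C. AE t in lborel. t \<in> {0<..<T} \<longrightarrow> mode_helicity \<kappa> t = C - 2 * primitive (mode_flux \<kappa>) t)"
\<comment> \<open>Inverting curl divides by \<open>\<kappa> \<bullet> \<kappa>\<close>, so the zero
  frequency is separate; there \<open>potential\<close> itself forces the mean of \<open>b\<close>
  to vanish.\<close>
proof (cases "\<kappa> = 0")
  case True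
  have "AE t in lborel. mode_helicity \<kappa> t = 0 \<and> mode_flux \<kappa> t = 0"
    using potential[OF \<kappa>] by eventually_elim (simp add: mode_helicity_def mode_flux_def True)
  then have 1: "AE t in lborel. mode_helicity \<kappa> t = 0" and 2: "AE t in lborel. mode_flux \<kappa> t = 0"
    by auto
  have "integrable lborel (mode_flux \<kappa>)"
    using integrable_cong_AE[of "mode_flux \<kappa>" lborel "\<lambda>_. 0"] mode_flux_measurable 2 by simp
  moreover have "primitive (mode_flux \<kappa>) t = 0" for t
    using primitive_cong_AE[OF mode_flux_measurable _ 2, of t] by (simp add: primitive_def)
  ultimately show ?thesis
    using 1 by (auto intro!: exI[of _ 0])
next
  case False
  define N where "N = \<kappa> \<bullet> \<kappa>"
  have N: "N > 0" using False by (simp add: N_def)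
  let ?bc = "\<lambda>t. fourier_cos \<kappa> (\<lambda>x. b (x, t))" and ?bs = "\<lambda>t. fourier_sin \<kappa> (\<lambda>x. b (x, t))"
  let ?ac = "\<lambda>t. fourier_cos \<kappa> (\<lambda>x. a (x, t))" and ?as = "\<lambda>t. fourier_sin \<kappa> (\<lambda>x. a (x, t))"
  let ?pc = "\<lambda>t. fourier_cos \<kappa> (\<lambda>x. \<Psi> (x, t))" and ?ps = "\<lambda>t. fourier_sin \<kappa> (\<lambda>x. \<Psi> (x, t))"
  let ?prod = "\<lambda>u v. cross3 \<kappa> u \<bullet> v"
  define f where "f t = cross3 \<kappa> (?ac t)" for t
  define g where "g t = - cross3 \<kappa> (?as t)" for t
  have f: "integrable lborel f"
    unfolding f_def by (rule integrable_bounded_linear[OF bounded_linear_cross3 integrable_coeff_time(1)[OF integrable_data(1)]])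
  have g: "integrable lborel g"
    unfolding g_def by (intro integrable_minus integrable_bounded_linear[OF bounded_linear_cross3 integrable_coeff_time(2)[OF integrable_data(1)]])
  obtain c1 where c1: "AE t in lborel. ?bc t = indicator {0<..<T} t *\<^sub>R (c1 + primitive g t)"
  proof (rule weak_derivative_imp_primitive[OF T integrable_coeff_time(1)[OF integrable_data(2)] coeff_outside(3) g])
    show "(\<integral>t. \<eta>' t *\<^sub>R ?bc t \<partial>lborel) = - (\<integral>t. \<eta> t *\<^sub>R g t \<partial>lborel)"
      if "interval_test_function T \<eta>" "\<And>t. (\<eta> has_real_derivative \<eta>' t) (at t)" for \<eta> \<eta>'
      using induction[OF \<kappa> that] by (simp add: g_def)
  qed
  obtain c2 where c2: "AE t in lborel. ?bs t = indicator {0<..<T} t *\<^sub>R (c2 + primitive f t)"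
  proof (rule weak_derivative_imp_primitive[OF T integrable_coeff_time(2)[OF integrable_data(2)] coeff_outside(4) f])
    show "(\<integral>t. \<eta>' t *\<^sub>R ?bs t \<partial>lborel) = - (\<integral>t. \<eta> t *\<^sub>R f t \<partial>lborel)"
      if "interval_test_function T \<eta>" "\<And>t. (\<eta> has_real_derivative \<eta>' t) (at t)" for \<eta> \<eta>'
      using induction[OF \<kappa> that] by (simp add: f_def)
  qed
  let ?F = "\<lambda>s. ?prod (f s) (c1 + primitive g s) + ?prod (c2 + primitive f s) (g s)"
  note [measurable] = borel_measurable_integrable[OF f] borel_measurable_integrable[OF g]
  have F_int: "integrable lborel ?F"
  proof (rule Bochner_Integration.integrable_add)
    have bound: "norm (c + primitive h s) \<le> norm c + (\<integral>s. norm (h s) \<partial>lborel)"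
      if "integrable lborel h" for c :: "real^3" and h s
      using norm_triangle_ineq[of c "primitive h s"] norm_primitive_le[OF that, of s] by linarith
    show "integrable lborel (\<lambda>s. ?prod (f s) (c1 + primitive g s))"
      by (rule integrable_bilinear_bounded[OF bounded_bilinear_cross3_inner f _ bound[OF g]]) simp
    show "integrable lborel (\<lambda>s. ?prod (c2 + primitive f s) (g s))"
      by (rule integrable_bilinear_bounded[OF bounded_bilinear.flip[OF bounded_bilinear_cross3_inner] g _ bound[OF f]]) simp
  qed
  have flux: "AE t in lborel. ?F t = - N * mode_flux \<kappa> t"
    using c1 c2 potential[OF \<kappa>]
  proof eventually_elim
    case (elim t)
    show ?case
    proof (cases "t \<in> {0<..<T}")
      case True
      then have bc: "c1 + primitive g t = ?bc t" and bs: "c2 + primitive f t = ?bs t"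
        using elim by simp_all
      \<comment> \<open>Both coefficients are cross products with \<open>\<kappa>\<close>. This
        removes the extra terms in the two vector identities and leaves \<open>- N\<close> times the
        flux.\<close>
      have 0: "\<kappa> \<bullet> ?bc t = 0" "\<kappa> \<bullet> ?bs t = 0"
        using elim(3) by (simp_all add: dot_cross_self)
      show ?thesis
        unfolding bc bs using 0
        by (simp add: f_def g_def mode_flux_def N_def cross3_cross3_self cross3_inner_cross3_self
            inner_diff_left inner_commute algebra_simps)
    next
      case False
      then show ?thesis
        by (simp add: f_def g_def mode_flux_def coeff_outside)
    qed
  qed
  have flux_int: "integrable lborel (mode_flux \<kappa>)"
  proof -
    have "integrable lborel (\<lambda>t. - N * mode_flux \<kappa> t)"
      using integrable_cong_AE[of ?F lborel "\<lambda>t. - N * mode_flux \<kappa> t"] flux F_int mode_flux_measurable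
        borel_measurable_integrable[OF F_int] by simp
    then show ?thesis
      using N by simp
  qed
  have "primitive ?F t = - N * primitive (mode_flux \<kappa>) t" for t
    using primitive_cong_AE[of ?F "\<lambda>t. - N * mode_flux \<kappa> t" t] flux mode_flux_measurable
      borel_measurable_integrable[OF F_int]
      primitive_bounded_linear[OF bounded_linear_mult_right flux_int, of "- N" t] by simp
  then have balance: "?prod (c2 + primitive f t) (c1 + primitive g t) = ?prod c2 c1 - N * primitive (mode_flux \<kappa>) t" for t
    using primitive_product[OF bounded_bilinear_cross3_inner f g, of \<kappa> c2 t c1] by simp
  have "AE t in lborel. t \<in> {0<..<T} \<longrightarrow> mode_helicity \<kappa> t = (2 / N) * ?prod c2 c1 - 2 * primitive (mode_flux \<kappa>) t"
    using c1 c2 potential[OF \<kappa>]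
  proof eventually_elim
    case (elim t)
    show ?case
    proof
      assume "t \<in> {0<..<T}"
      then have bc: "c1 + primitive g t = ?bc t" and bs: "c2 + primitive f t = ?bs t"
        using elim by simp_all
      \<comment> \<open>The mode of the potential is orthogonal to \<open>\<kappa>\<close>, so a
        second cross product undoes the curl up to \<open>N\<close>.\<close>
      have "cross3 \<kappa> (?bs t) = N *\<^sub>R ?pc t"
        using elim(3) by (simp add: cross3_cross3_self N_def)
      then have 1: "?prod (?bs t) (?bc t) = N * (?pc t \<bullet> ?bc t)"
        by simp
      have "cross3 \<kappa> (?bc t) = - N *\<^sub>R ?ps t"
        using elim(3) by (simp add: cross3_cross3_self N_def)
      \<comment> \<open>Skewness of the cross product carries it to the other factor, so the same
        product also gives the sine summand; hence the factor 2.\<close>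
      then have 2: "?prod (?bs t) (?bc t) = N * (?ps t \<bullet> ?bs t)"
        unfolding cross3_inner_skew[of \<kappa> "?bs t"] by (simp add: inner_commute)
      have "N * mode_helicity \<kappa> t = 2 * ?prod (?bs t) (?bc t)"
        using 1 2 unfolding mode_helicity_def distrib_left by linarith
      also have "\<dots> = 2 * (?prod c2 c1 - N * primitive (mode_flux \<kappa>) t)"
        using balance[of t] unfolding bc bs by simp
      finally show "mode_helicity \<kappa> t = (2 / N) * ?prod c2 c1 - 2 * primitive (mode_flux \<kappa>) t"
        using N by (simp add: field_simps)
    qed
  qed
  with flux_int show ?thesis by blast
qed

lemma AE_slices:
  "AE t in lborel. integrable lborel (\<lambda>x. a (x, t)) \<and> integrable lborel (\<lambda>x. b (x, t)) \<and> integrable lborel (\<lambda>x. \<Psi> (x, t))"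
  using integrable_data[THEN AE_integrable_time_slice] by auto

definition helicity :: "(real^3 \<Rightarrow> real) \<Rightarrow> real \<Rightarrow> real" where
  "helicity f t = pairing f (\<lambda>x. \<Psi> (x, t)) (\<lambda>x. b (x, t))"

definition flux :: "(real^3 \<Rightarrow> real) \<Rightarrow> real \<Rightarrow> real" where
  "flux f t = pairing f (\<lambda>x. a (x, t)) (\<lambda>x. b (x, t))"

lemma convolution_time_measurable:
  fixes w :: "(real^3) \<times> real \<Rightarrow> real^3"
  assumes "trig_poly f" and [measurable]: "w \<in> borel_measurable borel"
  shows "(\<lambda>z. convolution f (\<lambda>y. w (y, snd z)) (fst z)) \<in> borel_measurable borel"
proof -
  have fst3: "(\<lambda>p::((real^3) \<times> real) \<times> (real^3). fst (fst p)) \<in> borel_measurable (borel \<Otimes>\<^sub>M lborel)"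
    and snd3: "(\<lambda>p::((real^3) \<times> real) \<times> (real^3). snd (fst p)) \<in> borel_measurable (borel \<Otimes>\<^sub>M lborel)"
    by (rule measurable_compose[OF measurable_fst borel_measurable_fst_snd(1)]
        measurable_compose[OF measurable_fst borel_measurable_fst_snd(2)])+
  have snd2: "(\<lambda>p::((real^3) \<times> real) \<times> (real^3). snd p) \<in> borel_measurable (borel \<Otimes>\<^sub>M lborel)"
    using measurable_snd[of borel "lborel :: (real^3) measure"] by simp
  have "(\<lambda>p. f (fst (fst p) - snd p) *\<^sub>R w (snd p, snd (fst p))) \<in> borel_measurable (borel \<Otimes>\<^sub>M (lborel :: (real^3) measure))"
    by (intro borel_measurable_scaleR time_slice_measurable[OF assms(2) snd2 snd3]
        measurable_compose[OF borel_measurable_diff[OF fst3 snd2] trig_poly_measurable[OF assms(1)]])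
  then have "(\<lambda>(z, y). f (fst z - y) *\<^sub>R w (y, snd z)) \<in> borel_measurable (borel \<Otimes>\<^sub>M (lborel :: (real^3) measure))"
    by (simp add: split_beta)
  then show ?thesis
    unfolding convolution_def by (rule lborel.borel_measurable_lebesgue_integral)
qed

lemma flux_measurable:
  assumes "trig_poly f"
  shows "flux f \<in> borel_measurable borel"
proof -
  have "(\<lambda>z. a z \<bullet> convolution f (\<lambda>y. b (y, snd z)) (fst z)) \<in> borel_measurable borel"
    using convolution_time_measurable[OF assms meas(2)] by measurable
  then have "(\<lambda>z. a z \<bullet> convolution f (\<lambda>y. b (y, snd z)) (fst z)) \<in> borel_measurable (lborel \<Otimes>\<^sub>M lborel)"
    by (simp add: lborel_prod)
  from measurable_pair_swap[OF this]
  have "(\<lambda>(t, x). a (x, t) \<bullet> convolution f (\<lambda>y. b (y, t)) x) \<in> borel_measurable (lborel \<Otimes>\<^sub>M lborel)"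
    by simp
  then have "(\<lambda>t. \<integral>x. a (x, t) \<bullet> convolution f (\<lambda>y. b (y, t)) x \<partial>lborel) \<in> borel_measurable lborel"
    by (rule lborel.borel_measurable_lebesgue_integral)
  then show ?thesis
    by (simp add: flux_def[abs_def] pairing_def)
qed

text \<open>Both pairings are linear in the kernel, so the induction reduces everything to one
  frequency; the constants of integration combine in the same linear way.\<close>

lemma balance:
  assumes "trig_poly f"
  shows "integrable lborel (flux f) \<and>
    (\<exists>C. AE t in lborel. t \<in> {0<..<T} \<longrightarrow> helicity f t = C - 2 * primitive (flux f) t)"
  using assms
proof (induction rule: trig_poly.induct)
  case (cos \<kappa>)
  let ?f = "\<lambda>z. cos (\<kappa> \<bullet> z)"
  have tp: "trig_poly ?f" by (rule trig_poly.cos[OF cos])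
  obtain C where m: "integrable lborel (mode_flux \<kappa>)"
    "AE t in lborel. t \<in> {0<..<T} \<longrightarrow> mode_helicity \<kappa> t = C - 2 * primitive (mode_flux \<kappa>) t"
    using mode_balance[OF cos] by blast
  have eq: "AE t in lborel. flux ?f t = mode_flux \<kappa> t"
    using AE_slices by eventually_elim (simp add: flux_def mode_flux_def pairing_cos)
  have int: "integrable lborel (flux ?f)"
    using integrable_cong_AE[OF _ _ eq] m(1) flux_measurable[OF tp] mode_flux_measurable by simp
  have "primitive (flux ?f) t = primitive (mode_flux \<kappa>) t" for t
    using eq flux_measurable[OF tp] mode_flux_measurable by (intro primitive_cong_AE)
  moreover have "AE t in lborel. helicity ?f t = mode_helicity \<kappa> t"
    using AE_slices by eventually_elim (simp add: helicity_def mode_helicity_def pairing_cos)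
  ultimately have "AE t in lborel. t \<in> {0<..<T} \<longrightarrow> helicity ?f t = C - 2 * primitive (flux ?f) t"
    using m(2) by auto
  with int show ?case by blast
next
  case (add f g)
  let ?f = "\<lambda>z. f z + g z"
  have tp: "trig_poly ?f" using add by (intro trig_poly.add)
  obtain C D where CD: "AE t in lborel. t \<in> {0<..<T} \<longrightarrow> helicity f t = C - 2 * primitive (flux f) t"
    "AE t in lborel. t \<in> {0<..<T} \<longrightarrow> helicity g t = D - 2 * primitive (flux g) t"
    and int: "integrable lborel (flux f)" "integrable lborel (flux g)"
    using add by blast
  have eq: "AE t in lborel. flux ?f t = flux f t + flux g t"
    using AE_slices by eventually_elim (simp add: flux_def pairing_add add)
  have int': "integrable lborel (flux ?f)"
    using integrable_cong_AE[OF _ _ eq] int flux_measurable[OF tp] by simp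
  have prim: "primitive (flux ?f) t = primitive (flux f) t + primitive (flux g) t" for t
    unfolding primitive_add[OF int, symmetric]
    using eq flux_measurable[OF tp] flux_measurable add by (intro primitive_cong_AE) auto
  have "AE t in lborel. helicity ?f t = helicity f t + helicity g t"
    using AE_slices by eventually_elim (simp add: helicity_def pairing_add add)
  with CD have "AE t in lborel. t \<in> {0<..<T} \<longrightarrow> helicity ?f t = (C + D) - 2 * primitive (flux ?f) t"
    unfolding prim by eventually_elim auto
  with int' show ?case by blast
next
  case (scale f c)
  have eq: "flux (\<lambda>z. c * f z) = (\<lambda>t. c * flux f t)" "helicity (\<lambda>z. c * f z) = (\<lambda>t. c * helicity f t)"
    by (auto simp: flux_def helicity_def pairing_scale)
  obtain C where C: "AE t in lborel. t \<in> {0<..<T} \<longrightarrow> helicity f t = C - 2 * primitive (flux f) t"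
    and int: "integrable lborel (flux f)"
    using scale by blast
  have "primitive (\<lambda>t. c * flux f t) t = c * primitive (flux f) t" for t
    by (rule primitive_bounded_linear[OF bounded_linear_mult_right int])
  then have "AE t in lborel. t \<in> {0<..<T} \<longrightarrow> c * helicity f t = c * C - 2 * primitive (\<lambda>t. c * flux f t) t"
    using C by (auto elim!: eventually_mono simp: algebra_simps)
  then show ?case
    unfolding eq using int by auto
qed

section \<open>Removing the kernel\<close>

lemma L3_norm_power: "(\<integral>\<^sup>+z. ennreal (norm (b z) ^ 3) \<partial>lborel) < \<infinity>"
proof -
  have "norm (b z) powr 3 = norm (b z) ^ 3" for z
    by (cases "b z = 0") simp_all
  then show ?thesis
    using fin(2) by simp
qed

text \<open>Puts \<open>\<Psi>\<close> in the same class as \<open>a\<close>, so one defect estimate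
  serves for helicity and for flux.\<close>

lemma potential_L_3_2: "(\<integral>\<^sup>+z. ennreal (norm (\<Psi> z) powr (3/2)) \<partial>lborel) < \<infinity>"
  by (rule nn_integral_powr_finite_mono[OF meas(3) zero(3) fin(3)]) auto

lemma integrable_inner_b:
  fixes w :: "(real^3) \<times> real \<Rightarrow> real^3"
  assumes [measurable]: "w \<in> borel_measurable borel"
    and w: "(\<integral>\<^sup>+z. ennreal (norm (w z) powr (3/2)) \<partial>lborel) < \<infinity>"
  shows "integrable lborel (\<lambda>z. w z \<bullet> b z)"
proof (rule integrableI_bounded)
  have "ennreal (norm (w z \<bullet> b z)) \<le> ennreal (norm (w z) powr (3/2)) + ennreal (norm (b z) ^ 3)" for z
  proof -
    have "norm (w z \<bullet> b z) \<le> norm (w z) * norm (b z)"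
      using Cauchy_Schwarz_ineq2 by simp
    also have "\<dots> \<le> norm (w z) powr (3/2) + norm (b z) ^ 3"
      using young_3_2_3[of "norm (w z)" "norm (b z)" 1] by simp
    finally have "ennreal (norm (w z \<bullet> b z)) \<le> ennreal (norm (w z) powr (3/2) + norm (b z) ^ 3)"
      by (rule ennreal_leI)
    then show ?thesis by (simp add: ennreal_plus)
  qed
  then have "(\<integral>\<^sup>+z. ennreal (norm (w z \<bullet> b z)) \<partial>lborel) \<le>
      (\<integral>\<^sup>+z. ennreal (norm (w z) powr (3/2)) + ennreal (norm (b z) ^ 3) \<partial>lborel)"
    by (intro nn_integral_mono)
  also have "\<dots> < \<infinity>"
    using w L3_norm_power by (simp add: nn_integral_add less_top)
  finally show "(\<integral>\<^sup>+z. ennreal (norm (w z \<bullet> b z)) \<partial>lborel) < \<infinity>" .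
qed simp

text \<open>The part of \<open>translation_defect\<close> at a fixed time: it bounds the error for
  almost every time, and its time integral is known to tend to zero.\<close>

definition slice_defect :: "nat \<Rightarrow> ((real^3) \<times> real \<Rightarrow> real^3) \<Rightarrow> real \<Rightarrow> ennreal" where
  "slice_defect n w t = (\<integral>\<^sup>+x. ennreal (norm (w (x, t))) *
     (\<integral>\<^sup>+y. ennreal (norm (b (y, t) - b (x, t))) * periodization n x y \<partial>lborel) \<partial>lborel)"

lemma
  fixes w :: "(real^3) \<times> real \<Rightarrow> real^3"
  assumes w [measurable]: "w \<in> borel_measurable borel"
  shows slice_defect_measurable: "slice_defect n w \<in> borel_measurable borel"
    and slice_defect_integral: "(\<integral>\<^sup>+t. slice_defect n w t \<partial>lborel) = translation_defect n (\<lambda>z. norm (w z)) b"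
proof -
  have m: "(\<lambda>z. ennreal (norm (w z)) * (\<integral>\<^sup>+y. ennreal (norm (b (y, snd z) - b z)) * periodization n (fst z) y \<partial>lborel))
      \<in> borel_measurable borel"
    by measurable
  from nn_integral_cylinder_snd[OF m]
  show "(\<integral>\<^sup>+t. slice_defect n w t \<partial>lborel) = translation_defect n (\<lambda>z. norm (w z)) b"
    by (simp add: translation_defect_def slice_defect_def)
  show "slice_defect n w \<in> borel_measurable borel"
    unfolding slice_defect_def by measurable
qed

lemma pairing_slice_defect:
  fixes w :: "(real^3) \<times> real \<Rightarrow> real^3"
  assumes [measurable]: "w \<in> borel_measurable borel" and zero_w: "\<And>z. z \<notin> cylinder T \<Longrightarrow> w z = 0"
    and w_int: "integrable lborel w" and w: "(\<integral>\<^sup>+z. ennreal (norm (w z) powr (3/2)) \<partial>lborel) < \<infinity>"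
  shows "AE t in lborel. \<forall>n. ennreal \<bar>pairing (torus_kernel n) (\<lambda>x. w (x, t)) (\<lambda>x. b (x, t)) -
    (\<integral>x. w (x, t) \<bullet> b (x, t) \<partial>lborel)\<bar> \<le> slice_defect n w t"
  using AE_slices AE_integrable_time_slice[OF w_int] AE_integrable_time_slice[OF integrable_inner_b[OF assms(1) w]]
proof eventually_elim
  case (elim t)
  show ?case
    unfolding slice_defect_def
    by (intro allI pairing_torus_kernel_defect) (use elim zero(2) zero_w in auto)
qed

lemma helicity_defect_integral_tendsto:
  fixes w :: "(real^3) \<times> real \<Rightarrow> real^3"
  assumes [measurable]: "w \<in> borel_measurable borel" and "\<And>z. z \<notin> cylinder T \<Longrightarrow> w z = 0"
    and "(\<integral>\<^sup>+z. ennreal (norm (w z) powr (3/2)) \<partial>lborel) < \<infinity>"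
  shows "(\<lambda>n. \<integral>\<^sup>+t. slice_defect n w t \<partial>lborel) \<longlonglongrightarrow> 0"
  unfolding slice_defect_integral[OF assms(1)]
  by (rule translation_defect_tendsto_0[where T = T]) (use assms L3_norm_power in auto)

text \<open>The primitive of the smoothed flux is bounded, uniformly in time, by the integral of its
  absolute value, which tends to zero. The true helicity is therefore close in mean to the constants
  \<open>C n\<close>, and \<open>AE_const_if_L1_close\<close> applies.\<close>

lemma helicity_constant:
  obtains C where "AE t in lborel. t \<in> {0<..<T} \<longrightarrow> (\<integral>x. \<Psi> (x, t) \<bullet> b (x, t) \<partial>lborel) = C"
proof -
  define h where "h t = (\<integral>x. \<Psi> (x, t) \<bullet> b (x, t) \<partial>lborel)" for t
  have h_meas [measurable]: "h \<in> borel_measurable borel"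
    using borel_measurable_integrable[OF integrable_time_slice_integral[OF integrable_inner_b[OF meas(3) potential_L_3_2]]]
    by (simp add: h_def[abs_def])
  have bal: "\<forall>n. \<exists>C. AE t in lborel. t \<in> {0<..<T} \<longrightarrow>
      helicity (torus_kernel n) t = C - 2 * primitive (flux (torus_kernel n)) t"
    using balance[OF trig_poly_torus_kernel] by blast
  obtain C where C: "\<And>n. AE t in lborel. t \<in> {0<..<T} \<longrightarrow>
      helicity (torus_kernel n) t = C n - 2 * primitive (flux (torus_kernel n)) t"
    using choice[OF bal] by blast
  define D where "D n = (\<integral>\<^sup>+t. slice_defect n a t \<partial>lborel)" for n
  have prim: "ennreal \<bar>primitive (flux (torus_kernel n)) t\<bar> \<le> D n" for n t
  proof -
    have int: "integrable lborel (flux (torus_kernel n))"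
      using balance[OF trig_poly_torus_kernel] by blast
    have defect: "AE t in lborel. \<forall>n. ennreal \<bar>pairing (torus_kernel n) (\<lambda>x. a (x, t)) (\<lambda>x. b (x, t)) -
        (\<integral>x. a (x, t) \<bullet> b (x, t) \<partial>lborel)\<bar> \<le> slice_defect n a t"
      by (rule pairing_slice_defect[OF meas(1) zero(1) integrable_data(1) fin(1)])
    \<comment> \<open>Orthogonality enters here: with limit zero, the smoothed flux is bounded by
      the defect alone.\<close>
    have "AE t in lborel. (\<integral>x. a (x, t) \<bullet> b (x, t) \<partial>lborel) = 0"
      using AE_time_slice[OF orth] by eventually_elim (rule integral_eq_zero_AE)
    then have "AE t in lborel. ennreal \<bar>flux (torus_kernel n) t\<bar> \<le> slice_defect n a t"
      using defect
      by eventually_elim (auto simp: flux_def dest: spec[of _ n])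
    then have "(\<integral>\<^sup>+t. ennreal \<bar>flux (torus_kernel n) t\<bar> \<partial>lborel) \<le> D n"
      unfolding D_def by (intro nn_integral_mono_AE)
    moreover have "(\<integral>\<^sup>+t. ennreal (norm (flux (torus_kernel n) t)) \<partial>lborel) = ennreal (\<integral>t. norm (flux (torus_kernel n) t) \<partial>lborel)"
      using int by (intro nn_integral_eq_integral integrable_norm) auto
    moreover have "ennreal (norm (primitive (flux (torus_kernel n)) t)) \<le> ennreal (\<integral>t. norm (flux (torus_kernel n) t) \<partial>lborel)"
      by (intro ennreal_leI norm_primitive_le int)
    ultimately show ?thesis
      unfolding real_norm_def by (metis order.trans)
  qed
  have le: "(\<integral>\<^sup>+t. indicator {0<..<T} t * ennreal \<bar>h t - C n\<bar> \<partial>lborel) \<le>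
      (\<integral>\<^sup>+t. slice_defect n \<Psi> t \<partial>lborel) + ennreal T * (D n + D n)" for n
  proof -
    have defect: "AE t in lborel. \<forall>n. ennreal \<bar>pairing (torus_kernel n) (\<lambda>x. \<Psi> (x, t)) (\<lambda>x. b (x, t)) -
        (\<integral>x. \<Psi> (x, t) \<bullet> b (x, t) \<partial>lborel)\<bar> \<le> slice_defect n \<Psi> t"
      by (rule pairing_slice_defect[OF meas(3) zero(3) integrable_data(3) potential_L_3_2])
    have "AE t in lborel. indicator {0<..<T} t * ennreal \<bar>h t - C n\<bar> \<le>
        slice_defect n \<Psi> t + (D n + D n) * indicator {0<..<T} t"
      using C[of n] defect
    proof eventually_elim
      case (elim t)
      show ?case
      proof (cases "t \<in> {0<..<T}")
        case True
        let ?H = "helicity (torus_kernel n) t" and ?P = "primitive (flux (torus_kernel n)) t"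
        have "?H = C n - 2 * ?P"
          using elim(1) True by blast
        then have "\<bar>h t - C n\<bar> \<le> \<bar>?H - h t\<bar> + (\<bar>?P\<bar> + \<bar>?P\<bar>)"
          by linarith
        then have "ennreal \<bar>h t - C n\<bar> \<le> ennreal (\<bar>?H - h t\<bar> + (\<bar>?P\<bar> + \<bar>?P\<bar>))"
          by (rule ennreal_leI)
        also have "\<dots> = ennreal \<bar>?H - h t\<bar> + (ennreal \<bar>?P\<bar> + ennreal \<bar>?P\<bar>)"
          by (subst ennreal_plus, simp, simp, subst ennreal_plus, simp_all only: abs_ge_zero)
        also have "\<dots> \<le> slice_defect n \<Psi> t + (D n + D n)"
          using elim(2) by (intro add_mono prim) (simp add: helicity_def h_def)
        finally show ?thesis
          using True by simp
      qed simp
    qed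
    then have "(\<integral>\<^sup>+t. indicator {0<..<T} t * ennreal \<bar>h t - C n\<bar> \<partial>lborel) \<le>
        (\<integral>\<^sup>+t. slice_defect n \<Psi> t + (D n + D n) * indicator {0<..<T} t \<partial>lborel)"
      by (rule nn_integral_mono_AE)
    also have "\<dots> = (\<integral>\<^sup>+t. slice_defect n \<Psi> t \<partial>lborel) + ennreal T * (D n + D n)"
      using slice_defect_measurable[OF meas(3)] T by (simp add: nn_integral_add nn_integral_cmult mult.commute)
    finally show ?thesis .
  qed
  have D: "D \<longlonglongrightarrow> 0"
    unfolding D_def by (rule helicity_defect_integral_tendsto[OF meas(1) zero(1) fin(1)])
  have "(\<lambda>n. (\<integral>\<^sup>+t. slice_defect n \<Psi> t \<partial>lborel) + ennreal T * (D n + D n)) \<longlonglongrightarrow> 0 + ennreal T * (0 + 0)"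
    by (intro tendsto_add ennreal_tendsto_cmult D helicity_defect_integral_tendsto[OF meas(3) zero(3) potential_L_3_2] tendsto_const) auto
  then have "(\<lambda>n. (\<integral>\<^sup>+t. slice_defect n \<Psi> t \<partial>lborel) + ennreal T * (D n + D n)) \<longlonglongrightarrow> 0"
    by simp
  then have "(\<lambda>n. \<integral>\<^sup>+t. indicator {0<..<T} t * ennreal \<bar>h t - C n\<bar> \<partial>lborel) \<longlonglongrightarrow> 0"
    by (rule tendsto_sandwich[OF _ _ tendsto_const, rotated 2]) (use le in auto)
  then obtain c where "AE t in lborel. t \<in> {0<..<T} \<longrightarrow> h t = c"
    by (rule AE_const_if_L1_close[OF T h_meas])
  then show ?thesis
    unfolding h_def by (rule that)
qed

end

section \<open>Fourier form of the equations\<close>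

text \<open>Slicing uses that the product of \<open>lborel\<close> with \<open>lborel\<close> is
  \<open>lborel\<close>, so Lebesgue measurable data are replaced by Borel representatives,
  coordinate by coordinate. Extension by zero turns integrals over \<open>A\<close> into integrals
  over the whole space.\<close>

lemma borel_version:
  fixes f :: "'a::euclidean_space \<Rightarrow> 'b::euclidean_space"
  assumes A: "A \<in> sets borel" and f: "f \<in> borel_measurable (lebesgue_on A)"
  obtains g where "g \<in> borel_measurable borel" "\<And>z. z \<notin> A \<Longrightarrow> g z = 0"
    "AE z in lborel. z \<in> A \<longrightarrow> f z = g z"
proof -
  have "(\<lambda>z. indicator A z *\<^sub>R f z) \<in> borel_measurable lebesgue"
    using f A by (subst (asm) borel_measurable_restrict_space_iff) auto
  then have "\<exists>g'\<in>borel_measurable lborel. AE z in lborel. (indicator A z *\<^sub>R f z) \<bullet> i = g' z" for i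
    by (intro completion_ex_borel_measurable_real borel_measurable_inner) auto
  then obtain g' where g': "\<And>i. g' i \<in> borel_measurable borel"
    "\<And>i. AE z in lborel. (indicator A z *\<^sub>R f z) \<bullet> i = g' i z"
    by (metis measurable_lborel2)
  define g where "g z = indicator A z *\<^sub>R (\<Sum>i\<in>Basis. g' i z *\<^sub>R i)" for z
  have "AE z in lborel. \<forall>i\<in>Basis. (indicator A z *\<^sub>R f z) \<bullet> i = g' i z"
    using g'(2) by (simp add: AE_ball_countable countable_finite)
  then have "AE z in lborel. z \<in> A \<longrightarrow> f z = g z"
  proof eventually_elim
    case (elim z)
    show ?case
    proof
      assume "z \<in> A"
      then have "g z = (\<Sum>i\<in>Basis. (f z \<bullet> i) *\<^sub>R i)"
        using elim by (simp add: g_def)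
      then show "f z = g z"
        by (simp add: euclidean_representation)
    qed
  qed
  moreover have "g \<in> borel_measurable borel"
    unfolding g_def using g'(1) A by measurable
  ultimately show ?thesis
    by (intro that[of g]) (auto simp: g_def)
qed

text \<open>Measurability of the left integrand is inherited from \<open>g\<close>, because
  \<open>lebesgue\<close> is complete.\<close>

lemma integral_lebesgue_on_borel_version:
  fixes f g :: "'a::euclidean_space \<Rightarrow> 'b::euclidean_space"
  assumes A: "A \<in> sets borel" and g: "g \<in> borel_measurable borel" "\<And>z. z \<notin> A \<Longrightarrow> g z = 0"
    and ae: "AE z in lborel. z \<in> A \<longrightarrow> f z = g z"
  shows "(LINT z|lebesgue_on A. f z) = (\<integral>z. g z \<partial>lborel)"
proof -
  have gl: "g \<in> borel_measurable lebesgue"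
    using g(1) by (simp add: measurable_completion)
  have ae': "AE z in lebesgue. g z = indicator A z *\<^sub>R f z"
    unfolding AE_completion_iff using ae by eventually_elim (auto simp: indicator_def g(2))
  have "(LINT z|lebesgue_on A. f z) = (LINT z|lebesgue. indicator A z *\<^sub>R f z)"
    using A by (intro integral_restrict_space) auto
  also have "\<dots> = (LINT z|lebesgue. g z)"
    using ae' gl borel_measurable_AE[OF gl ae'] by (intro integral_cong_AE) auto
  also have "\<dots> = (\<integral>z. g z \<partial>lborel)"
    using g(1) by (intro integral_completion) auto
  finally show ?thesis .
qed

lemma AE_lebesgue_on_iff:
  assumes "A \<in> sets borel"
  shows "(AE z in lebesgue_on A. P z) \<longleftrightarrow> (AE z in lborel. z \<in> A \<longrightarrow> P z)"
  using assms by (subst AE_restrict_space_iff) (auto simp: AE_completion_iff)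

lemma Lp_on_borel_version:
  fixes f :: "'a::euclidean_space \<Rightarrow> 'b::euclidean_space"
  assumes A: "A \<in> sets borel" and f: "Lp_on p A f" and p: "0 < p"
  obtains g where "g \<in> borel_measurable borel" "\<And>z. z \<notin> A \<Longrightarrow> g z = 0"
    "AE z in lborel. z \<in> A \<longrightarrow> f z = g z" "(\<integral>\<^sup>+z. ennreal (norm (g z) powr p) \<partial>lborel) < \<infinity>"
proof -
  obtain g where g: "g \<in> borel_measurable borel" "\<And>z. z \<notin> A \<Longrightarrow> g z = 0"
    "AE z in lborel. z \<in> A \<longrightarrow> f z = g z"
    using borel_version[OF A] f unfolding Lp_on_def by blast
  have "integrable (lebesgue_on A) (\<lambda>z. norm (f z) powr p)"
    using f by (simp add: Lp_on_def)
  then have "(\<integral>\<^sup>+z. ennreal (norm (norm (f z) powr p)) \<partial>lebesgue_on A) < \<infinity>"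
    unfolding integrable_iff_bounded by (rule conjunct2)
  moreover have "(\<integral>\<^sup>+z. ennreal (norm (norm (f z) powr p)) \<partial>lebesgue_on A) =
      (\<integral>\<^sup>+z. ennreal (norm (norm (f z) powr p)) * indicator A z \<partial>lebesgue)"
    using A by (intro nn_integral_restrict_space) auto
  moreover have "\<dots> = (\<integral>\<^sup>+z. ennreal (norm (g z) powr p) \<partial>lebesgue)"
  proof (rule nn_integral_cong_AE)
    show "AE z in lebesgue. ennreal (norm (norm (f z) powr p)) * indicator A z = ennreal (norm (g z) powr p)"
      unfolding AE_completion_iff using g(3)
      by eventually_elim (auto simp: indicator_def g(2))
  qed
  ultimately have "(\<integral>\<^sup>+z. ennreal (norm (g z) powr p) \<partial>lborel) < \<infinity>"
    by (simp only: nn_integral_completion)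
  with g show ?thesis by (rule that)
qed

section \<open>Waves as test functions\<close>

lemma torus_wave:
  fixes \<kappa> :: "real^3"
  assumes \<kappa>: "\<And>i. \<exists>m::int. \<kappa> $ i = 2 * pi * m"
  shows "cos (\<kappa> \<bullet> (x + axis i 1)) = cos (\<kappa> \<bullet> x)" "sin (\<kappa> \<bullet> (x + axis i 1)) = sin (\<kappa> \<bullet> x)"
proof -
  obtain m :: int where m: "\<kappa> $ i = 2 * pi * m"
    using \<kappa> by blast
  have "\<kappa> \<bullet> (x + axis i 1) = \<kappa> \<bullet> x + 2 * pi * m"
    by (simp add: inner_add_right inner_axis m)
  then show "cos (\<kappa> \<bullet> (x + axis i 1)) = cos (\<kappa> \<bullet> x)" "sin (\<kappa> \<bullet> (x + axis i 1)) = sin (\<kappa> \<bullet> x)"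
    by (simp_all add: cos_add sin_add)
qed

lemma C_infinity_wave:
  "C_infinity (\<lambda>x::real^3. cos (\<kappa> \<bullet> x))" "C_infinity (\<lambda>x::real^3. sin (\<kappa> \<bullet> x))"
  using C_infinity_compose_linear[OF bounded_linear_inner_right C_infinity_cos, of \<kappa> 0]
    C_infinity_compose_linear[OF bounded_linear_inner_right C_infinity_sin, of \<kappa> 0] by simp_all

lemma torus_test_function_wave:
  assumes "\<And>i. \<exists>m::int. \<kappa> $ i = 2 * pi * m"
  shows "torus_test_function (\<lambda>x. cos (\<kappa> \<bullet> x))" "torus_test_function (\<lambda>x. sin (\<kappa> \<bullet> x))"
  using C_infinity_wave torus_wave[OF assms] by (simp_all add: torus_test_function_def)

lemma frechet_derivative_wave:
  "frechet_derivative (\<lambda>x. cos (\<kappa> \<bullet> x)) (at x) (axis j 1) = - (\<kappa> $ j * sin (\<kappa> \<bullet> x))"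
  "frechet_derivative (\<lambda>x. sin (\<kappa> \<bullet> x)) (at x) (axis j 1) = \<kappa> $ j * cos (\<kappa> \<bullet> x)" for \<kappa> :: "real^3"
proof -
  have "((\<lambda>x. cos (\<kappa> \<bullet> x)) has_derivative (\<lambda>v. - sin (\<kappa> \<bullet> x) * (\<kappa> \<bullet> v))) (at x)"
    "((\<lambda>x. sin (\<kappa> \<bullet> x)) has_derivative (\<lambda>v. cos (\<kappa> \<bullet> x) * (\<kappa> \<bullet> v))) (at x)"
    by (auto intro!: derivative_eq_intros simp: mult.commute)
  then show "frechet_derivative (\<lambda>x. cos (\<kappa> \<bullet> x)) (at x) (axis j 1) = - (\<kappa> $ j * sin (\<kappa> \<bullet> x))"
    "frechet_derivative (\<lambda>x. sin (\<kappa> \<bullet> x)) (at x) (axis j 1) = \<kappa> $ j * cos (\<kappa> \<bullet> x)"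
    by (simp_all add: frechet_derivative_at[symmetric] inner_axis mult.commute)
qed

text \<open>Separated test functions isolate one frequency in space and leave a weak ordinary
  differential equation in time.\<close>

lemma cylinder_test_function_wave:
  assumes \<kappa>: "\<And>i. \<exists>m::int. \<kappa> $ i = 2 * pi * m" and \<eta>: "interval_test_function T \<eta>"
  shows "cylinder_test_function T (\<lambda>z. \<eta> (snd z) * cos (\<kappa> \<bullet> fst z))"
    "cylinder_test_function T (\<lambda>z. \<eta> (snd z) * sin (\<kappa> \<bullet> fst z))"
proof -
  obtain r s where rs: "C_infinity \<eta>" "0 < r" "r \<le> s" "s < T" "\<And>t. t \<notin> {r..s} \<Longrightarrow> \<eta> t = 0"
    using interval_test_functionE[OF \<eta>] by blast
  have lin: "bounded_linear (\<lambda>z::(real^3) \<times> real. \<kappa> \<bullet> fst z)"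
    by (rule bounded_linear_compose[OF bounded_linear_inner_right bounded_linear_fst])
  have "C_infinity (\<lambda>z::(real^3) \<times> real. \<eta> (snd z))"
    using C_infinity_compose_linear[OF bounded_linear_snd rs(1), of 0] by simp
  moreover have "C_infinity (\<lambda>z::(real^3) \<times> real. cos (\<kappa> \<bullet> fst z))" "C_infinity (\<lambda>z::(real^3) \<times> real. sin (\<kappa> \<bullet> fst z))"
    using C_infinity_compose_linear[OF lin C_infinity_cos, of 0] C_infinity_compose_linear[OF lin C_infinity_sin, of 0]
    by simp_all
  moreover have "\<eta> t * c = 0" if "t \<notin> {r..s}" for t c
    using rs(5)[OF that] by simp
  ultimately show "cylinder_test_function T (\<lambda>z. \<eta> (snd z) * cos (\<kappa> \<bullet> fst z))"
    "cylinder_test_function T (\<lambda>z. \<eta> (snd z) * sin (\<kappa> \<bullet> fst z))"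
    unfolding cylinder_test_function_def using rs(2-4) torus_wave[OF \<kappa>]
    by (intro conjI C_infinity_mult exI[of _ r] exI[of _ s]; simp del: atLeastAtMost_iff)+
qed

lemma frechet_derivative_cylinder_wave:
  fixes \<kappa> :: "real^3" and \<eta> :: "real \<Rightarrow> real"
  assumes \<eta>: "\<And>t. (\<eta> has_real_derivative \<eta>' t) (at t)"
  defines "C \<equiv> \<lambda>z::(real^3) \<times> real. \<eta> (snd z) * cos (\<kappa> \<bullet> fst z)"
    and "S \<equiv> \<lambda>z::(real^3) \<times> real. \<eta> (snd z) * sin (\<kappa> \<bullet> fst z)"
  shows "frechet_derivative C (at z) dir_t = \<eta>' (snd z) * cos (\<kappa> \<bullet> fst z)"
    "frechet_derivative S (at z) dir_t = \<eta>' (snd z) * sin (\<kappa> \<bullet> fst z)"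
    "frechet_derivative C (at z) (dir_x j) = - (\<kappa> $ j * (\<eta> (snd z) * sin (\<kappa> \<bullet> fst z)))"
    "frechet_derivative S (at z) (dir_x j) = \<kappa> $ j * (\<eta> (snd z) * cos (\<kappa> \<bullet> fst z))"
proof -
  have d: "((\<lambda>z. \<eta> (snd z)) has_derivative (\<lambda>v. \<eta>' (snd z) * snd v)) (at z)" for z :: "(real^3) \<times> real"
    by (rule has_derivative_compose[OF has_derivative_snd[OF has_derivative_ident] \<eta>[unfolded has_field_derivative_def]])
  have c: "((\<lambda>z. cos (\<kappa> \<bullet> fst z)) has_derivative (\<lambda>v. - sin (\<kappa> \<bullet> fst z) * (\<kappa> \<bullet> fst v))) (at z)"
    and s: "((\<lambda>z. sin (\<kappa> \<bullet> fst z)) has_derivative (\<lambda>v. cos (\<kappa> \<bullet> fst z) * (\<kappa> \<bullet> fst v))) (at z)" for z :: "(real^3) \<times> real"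
    by (auto intro!: derivative_eq_intros simp: mult.commute)
  note dC = frechet_derivative_at[OF has_derivative_mult[OF d c], symmetric]
    and dS = frechet_derivative_at[OF has_derivative_mult[OF d s], symmetric]
  show "frechet_derivative C (at z) dir_t = \<eta>' (snd z) * cos (\<kappa> \<bullet> fst z)"
    "frechet_derivative S (at z) dir_t = \<eta>' (snd z) * sin (\<kappa> \<bullet> fst z)"
    "frechet_derivative C (at z) (dir_x j) = - (\<kappa> $ j * (\<eta> (snd z) * sin (\<kappa> \<bullet> fst z)))"
    "frechet_derivative S (at z) (dir_x j) = \<kappa> $ j * (\<eta> (snd z) * cos (\<kappa> \<bullet> fst z))"
    unfolding C_def S_def dC dS by (simp_all add: inner_axis)
qed

text \<open>The matrix with entries \<open>\<kappa> $ j * p $ i\<close> is the gradient of a single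
  mode up to phase; curl and divergence then become cross and inner product with
  \<open>\<kappa>\<close>.\<close>

lemma curl_of_grad_cross:
  fixes \<kappa> p :: "real^3"
  shows "curl_of_grad (\<chi> i j. \<kappa> $ j * p $ i) = cross3 \<kappa> p" "trace (\<chi> i j. \<kappa> $ j * p $ i) = \<kappa> \<bullet> p"
  by (simp_all add: curl_of_grad_def cross3_def trace_def inner_vec_def algebra_simps)

lemma bounded_linear_curl_of_grad: "bounded_linear curl_of_grad"
proof -
  have "linear curl_of_grad"
    by (rule linearI) (simp_all add: curl_of_grad_def vec_eq_iff forall_3 algebra_simps)
  then show ?thesis by (simp add: linear_conv_bounded_linear)
qed

lemma bounded_linear_trace: "bounded_linear (trace :: real^3^3 \<Rightarrow> real)"
proof -
  have "linear (trace :: real^3^3 \<Rightarrow> real)"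
    by (rule linearI) (simp_all add: trace_def sum.distrib sum_distrib_left)
  then show ?thesis by (simp add: linear_conv_bounded_linear)
qed

text \<open>The weak gradient identity on a single time slice, tested with the waves, is the Fourier
  form of the equations \<open>curl \<Psi> = b\<close> and \<open>div \<Psi> = 0\<close>.\<close>

lemma weak_gradient_modes:
  fixes w v :: "real^3 \<Rightarrow> real^3" and G :: "real^3 \<Rightarrow> real^3^3"
  assumes \<kappa>: "\<And>i. \<exists>m::int. \<kappa> $ i = 2 * pi * m"
    and w: "integrable lborel w" and G: "integrable lborel G" and v: "v \<in> borel_measurable borel"
    and weak: "\<And>\<phi> i j. torus_test_function \<phi> \<Longrightarrow>
      (\<integral>x. w x $ i * frechet_derivative \<phi> (at x) (axis j 1) \<partial>lborel) = - (\<integral>x. G x $ i $ j * \<phi> x \<partial>lborel)"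
    and curl: "AE x in lborel. curl_of_grad (G x) = v x" and tr: "AE x in lborel. trace (G x) = 0"
  shows "fourier_cos \<kappa> v = cross3 \<kappa> (fourier_sin \<kappa> w) \<and> fourier_sin \<kappa> v = - cross3 \<kappa> (fourier_cos \<kappa> w) \<and>
    \<kappa> \<bullet> fourier_cos \<kappa> w = 0 \<and> \<kappa> \<bullet> fourier_sin \<kappa> w = 0"
proof -
  have intG: "integrable lborel (\<lambda>x. cos (\<kappa> \<bullet> x) *\<^sub>R G x)" "integrable lborel (\<lambda>x. sin (\<kappa> \<bullet> x) *\<^sub>R G x)"
    by (rule integrable_bilinear_bounded[OF bounded_bilinear.flip[OF bounded_bilinear_scaleR] G, of _ 1]; simp)+
  define Gc where "Gc = (\<integral>x. cos (\<kappa> \<bullet> x) *\<^sub>R G x \<partial>lborel)"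
  define Gs where "Gs = (\<integral>x. sin (\<kappa> \<bullet> x) *\<^sub>R G x \<partial>lborel)"
  have entry: "bounded_linear (\<lambda>A::real^3^3. A $ i $ j)" for i j
    by (rule bounded_linear_compose[OF bounded_linear_vec_nth bounded_linear_vec_nth])
  have Gc: "Gc $ i $ j = (\<integral>x. G x $ i $ j * cos (\<kappa> \<bullet> x) \<partial>lborel)"
    and Gs: "Gs $ i $ j = (\<integral>x. G x $ i $ j * sin (\<kappa> \<bullet> x) \<partial>lborel)" for i j
    unfolding Gc_def Gs_def integral_bounded_linear[OF entry intG(1), symmetric]
      integral_bounded_linear[OF entry intG(2), symmetric]
    by (simp_all add: mult.commute)
  have wc: "fourier_cos \<kappa> w $ i = (\<integral>x. w x $ i * cos (\<kappa> \<bullet> x) \<partial>lborel)"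
    and ws: "fourier_sin \<kappa> w $ i = (\<integral>x. w x $ i * sin (\<kappa> \<bullet> x) \<partial>lborel)" for i
    unfolding fourier_cos_def fourier_sin_def
      integral_bounded_linear[OF bounded_linear_vec_nth integrable_coeff(1)[OF w], symmetric]
      integral_bounded_linear[OF bounded_linear_vec_nth integrable_coeff(2)[OF w], symmetric]
    by (simp_all add: mult.commute)
  \<comment> \<open>Differentiating the cosine gives minus a sine and differentiating the sine gives
    a cosine; together with the sign of the weak gradient this leaves one minus, in the second
    identity.\<close>
  have "Gc $ i $ j = \<kappa> $ j * fourier_sin \<kappa> w $ i" "Gs $ i $ j = - (\<kappa> $ j * fourier_cos \<kappa> w $ i)" for i j
    using weak[OF torus_test_function_wave(1)[OF \<kappa>], of i j] weak[OF torus_test_function_wave(2)[OF \<kappa>], of i j]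
    by (simp_all add: frechet_derivative_wave Gc Gs wc ws mult.left_commute)
  then have GcGs: "Gc = (\<chi> i j. \<kappa> $ j * fourier_sin \<kappa> w $ i)" "Gs = (\<chi> i j. \<kappa> $ j * (- fourier_cos \<kappa> w) $ i)"
    by (simp_all add: vec_eq_iff)
  have meas: "(\<lambda>x. curl_of_grad (G x)) \<in> borel_measurable borel"
    using integrable_bounded_linear[OF bounded_linear_curl_of_grad G] by auto
  have "fourier_cos \<kappa> v = (\<integral>x. curl_of_grad (cos (\<kappa> \<bullet> x) *\<^sub>R G x) \<partial>lborel)"
    "fourier_sin \<kappa> v = (\<integral>x. curl_of_grad (sin (\<kappa> \<bullet> x) *\<^sub>R G x) \<partial>lborel)"
    unfolding fourier_cos_def fourier_sin_def linear_scale[OF bounded_linear.linear[OF bounded_linear_curl_of_grad]]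
    using curl meas v by (auto intro!: integral_cong_AE)
  then have "fourier_cos \<kappa> v = curl_of_grad Gc" "fourier_sin \<kappa> v = curl_of_grad Gs"
    unfolding Gc_def Gs_def using integral_bounded_linear[OF bounded_linear_curl_of_grad] intG by auto
  moreover have "trace Gc = 0" "trace Gs = 0"
    unfolding Gc_def Gs_def integral_bounded_linear[OF bounded_linear_trace intG(1), symmetric]
      integral_bounded_linear[OF bounded_linear_trace intG(2), symmetric]
      linear_scale[OF bounded_linear.linear[OF bounded_linear_trace]]
    using tr by (auto intro!: integral_eq_zero_AE)
  ultimately show ?thesis
    unfolding GcGs curl_of_grad_cross by simp
qed

lemma cylinder_integral_time_first:
  fixes w :: "(real^3) \<times> real \<Rightarrow> real^3"
  assumes w: "integrable lborel w" and \<theta>: "\<theta> \<in> borel_measurable borel" "\<And>t. \<bar>\<theta> t\<bar> \<le> B"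
    and p: "p \<in> borel_measurable borel" "\<And>x. \<bar>p x\<bar> \<le> 1"
  shows "integrable lborel (\<lambda>z. (\<theta> (snd z) * p (fst z)) *\<^sub>R w z)"
    and "(\<integral>z. (\<theta> (snd z) * p (fst z)) *\<^sub>R w z \<partial>lborel) =
      (\<integral>t. \<theta> t *\<^sub>R (\<integral>x. p x *\<^sub>R w (x, t) \<partial>lborel) \<partial>lborel)"
proof -
  have B: "0 \<le> B"
    using \<theta>(2)[of 0] by linarith
  have m: "(\<lambda>z::(real^3) \<times> real. \<theta> (snd z) * p (fst z)) \<in> borel_measurable borel"
    by (intro borel_measurable_times measurable_compose[OF borel_measurable_fst_snd(1) p(1)]
        measurable_compose[OF borel_measurable_fst_snd(2) \<theta>(1)])
  have "\<bar>\<theta> t * p x\<bar> \<le> B * 1" for t x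
    unfolding abs_mult using \<theta>(2) p(2) B by (intro mult_mono) auto
  then show int: "integrable lborel (\<lambda>z. (\<theta> (snd z) * p (fst z)) *\<^sub>R w z)"
    by (intro integrable_bilinear_bounded[OF bounded_bilinear.flip[OF bounded_bilinear_scaleR] w, of _ B])
      (use m in simp_all)
  have "integrable (lborel \<Otimes>\<^sub>M lborel) (\<lambda>(x, t). (\<theta> t * p x) *\<^sub>R w (x, t))"
    using int by (simp add: lborel_prod case_prod_beta')
  from lborel_pair.integral_snd[OF this]
  show "(\<integral>z. (\<theta> (snd z) * p (fst z)) *\<^sub>R w z \<partial>lborel) =
      (\<integral>t. \<theta> t *\<^sub>R (\<integral>x. p x *\<^sub>R w (x, t) \<partial>lborel) \<partial>lborel)"
    by (simp add: lborel_prod case_prod_beta' flip: scaleR_scaleR)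
qed

lemma dist_deriv_borel_version:
  fixes w w' :: "(real^3) \<times> real \<Rightarrow> real^3"
  assumes w': "w' \<in> borel_measurable borel" "\<And>z. z \<notin> cylinder T \<Longrightarrow> w' z = 0"
    and ae: "AE z in lborel. z \<in> cylinder T \<longrightarrow> w z = w' z"
    and \<psi>: "\<And>z. frechet_derivative \<phi> (at z) v = c * \<psi> z" "\<psi> \<in> borel_measurable borel"
    and int: "integrable lborel (\<lambda>z. \<psi> z *\<^sub>R w' z)"
  shows "dist_deriv T v (\<lambda>z. w z $ i) \<phi> = - (c * (\<integral>z. \<psi> z *\<^sub>R w' z \<partial>lborel) $ i)"
proof -
  have "(LINT z|lebesgue_on (cylinder T). w z $ i * frechet_derivative \<phi> (at z) v) =
      (\<integral>z. c * (\<psi> z *\<^sub>R w' z) $ i \<partial>lborel)"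
  proof (rule integral_lebesgue_on_borel_version)
    show "AE z in lborel. z \<in> cylinder T \<longrightarrow> w z $ i * frechet_derivative \<phi> (at z) v = c * (\<psi> z *\<^sub>R w' z) $ i"
      using ae by eventually_elim (simp add: \<psi>(1))
    have "(\<lambda>z. (\<psi> z *\<^sub>R w' z) $ i) \<in> borel_measurable borel"
      using borel_measurable_integrable[OF integrable_bounded_linear[OF bounded_linear_vec_nth int]] by simp
    then show "(\<lambda>z. c * (\<psi> z *\<^sub>R w' z) $ i) \<in> borel_measurable borel"
      by simp
  qed (use w'(2) in \<open>auto intro: cylinder_sets\<close>)
  also have "\<dots> = c * (\<integral>z. \<psi> z *\<^sub>R w' z \<partial>lborel) $ i"
    using integral_bounded_linear[OF bounded_linear_vec_nth int, of i] by simp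
  finally show ?thesis
    by (simp add: dist_deriv_def)
qed

text \<open>The equation is tested with the time factor \<open>\<eta>\<close> times a cosine or a
  sine: the time derivative falls on \<open>\<eta>\<close>, the curl turns into
  \<open>cross3 \<kappa>\<close> and exchanges cosine and sine. Fubini then takes the spatial
  integrals first.\<close>

lemma induction_equation_modes:
  fixes a b a' b' :: "(real^3) \<times> real \<Rightarrow> real^3"
  assumes a': "a' \<in> borel_measurable borel" "\<And>z. z \<notin> cylinder T \<Longrightarrow> a' z = 0"
      "AE z in lborel. z \<in> cylinder T \<longrightarrow> a z = a' z" "integrable lborel a'"
    and b': "b' \<in> borel_measurable borel" "\<And>z. z \<notin> cylinder T \<Longrightarrow> b' z = 0"
      "AE z in lborel. z \<in> cylinder T \<longrightarrow> b z = b' z" "integrable lborel b'"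
    and eq: "\<And>\<phi>. cylinder_test_function T \<phi> \<Longrightarrow> dist_dt T b \<phi> + dist_curl T a \<phi> = 0"
    and \<kappa>: "\<And>i. \<exists>m::int. \<kappa> $ i = 2 * pi * m"
    and \<eta>: "interval_test_function T \<eta>" and der: "\<And>t. (\<eta> has_real_derivative \<eta>' t) (at t)"
  shows "(\<integral>t. \<eta>' t *\<^sub>R fourier_cos \<kappa> (\<lambda>x. b' (x, t)) \<partial>lborel) =
        (\<integral>t. \<eta> t *\<^sub>R cross3 \<kappa> (fourier_sin \<kappa> (\<lambda>x. a' (x, t))) \<partial>lborel) \<and>
      (\<integral>t. \<eta>' t *\<^sub>R fourier_sin \<kappa> (\<lambda>x. b' (x, t)) \<partial>lborel) =
        - (\<integral>t. \<eta> t *\<^sub>R cross3 \<kappa> (fourier_cos \<kappa> (\<lambda>x. a' (x, t))) \<partial>lborel)"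
proof -
  have \<eta>': "interval_test_function T \<eta>'"
    using interval_test_function_DERIV[OF \<eta>] der DERIV_unique by (metis ext)
  have bounded: "\<theta> \<in> borel_measurable borel \<and> (\<exists>B. \<forall>t. \<bar>\<theta> t\<bar> \<le> B)" if \<theta>: "interval_test_function T \<theta>" for \<theta>
  proof -
    obtain r s where rs: "C_infinity \<theta>" "\<And>t. t \<notin> {r..s} \<Longrightarrow> \<theta> t = 0"
      using interval_test_functionE[OF \<theta>] by metis
    have cont: "continuous_on UNIV \<theta>"
      using rs(1) by (rule C_infinity_imp_continuous)
    obtain B where "\<And>t. \<bar>\<theta> t\<bar> \<le> B"
      using bounded_compact_support[OF cont rs(2)] by blast
    then show ?thesis
      using borel_measurable_continuous_onI[OF cont] by blast
  qed
  obtain B B' where B: "\<And>t. \<bar>\<eta> t\<bar> \<le> B" "\<And>t. \<bar>\<eta>' t\<bar> \<le> B'"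
    using bounded[OF \<eta>] bounded[OF \<eta>'] by blast
  have m: "\<eta> \<in> borel_measurable borel" "\<eta>' \<in> borel_measurable borel"
    using bounded[OF \<eta>] bounded[OF \<eta>'] by blast+
  have cs: "(\<lambda>x::real^3. cos (\<kappa> \<bullet> x)) \<in> borel_measurable borel" "(\<lambda>x::real^3. sin (\<kappa> \<bullet> x)) \<in> borel_measurable borel"
    "\<bar>cos (\<kappa> \<bullet> x)\<bar> \<le> 1" "\<bar>sin (\<kappa> \<bullet> x)\<bar> \<le> 1" for x
    by simp_all
  have wave_meas: "(\<lambda>z::(real^3) \<times> real. \<theta> (snd z) * p (fst z)) \<in> borel_measurable borel"
    if "\<theta> \<in> borel_measurable borel" "p \<in> borel_measurable borel" for \<theta> and p :: "real^3 \<Rightarrow> real"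
    by (intro borel_measurable_times measurable_compose[OF borel_measurable_fst_snd(1) that(2)]
        measurable_compose[OF borel_measurable_fst_snd(2) that(1)])
  let ?C = "\<lambda>z::(real^3) \<times> real. \<eta> (snd z) * cos (\<kappa> \<bullet> fst z)"
  let ?S = "\<lambda>z::(real^3) \<times> real. \<eta> (snd z) * sin (\<kappa> \<bullet> fst z)"
  let ?C' = "\<lambda>z::(real^3) \<times> real. \<eta>' (snd z) * cos (\<kappa> \<bullet> fst z)"
  let ?S' = "\<lambda>z::(real^3) \<times> real. \<eta>' (snd z) * sin (\<kappa> \<bullet> fst z)"
  note fr = frechet_derivative_cylinder_wave[OF der]
  note int_Ca = cylinder_integral_time_first[OF a'(4) m(1) B(1) cs(1,3)]
    and int_Sa = cylinder_integral_time_first[OF a'(4) m(1) B(1) cs(2,4)]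
    and int_Cb = cylinder_integral_time_first[OF b'(4) m(2) B(2) cs(1,3)]
    and int_Sb = cylinder_integral_time_first[OF b'(4) m(2) B(2) cs(2,4)]
  have dt: "dist_dt T b ?C = - (\<integral>z. ?C' z *\<^sub>R b' z \<partial>lborel)"
    "dist_dt T b ?S = - (\<integral>z. ?S' z *\<^sub>R b' z \<partial>lborel)"
    using dist_deriv_borel_version[OF b'(1-3), of ?C dir_t 1 ?C'] dist_deriv_borel_version[OF b'(1-3), of ?S dir_t 1 ?S']
      int_Cb(1) int_Sb(1) wave_meas[OF m(2) cs(1)] wave_meas[OF m(2) cs(2)]
    by (simp_all add: dist_dt_def fr vec_eq_iff)
  have dx: "dist_deriv T (dir_x j) (\<lambda>z. a z $ i) ?C = \<kappa> $ j * (\<integral>z. ?S z *\<^sub>R a' z \<partial>lborel) $ i"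
    "dist_deriv T (dir_x j) (\<lambda>z. a z $ i) ?S = \<kappa> $ j * (- (\<integral>z. ?C z *\<^sub>R a' z \<partial>lborel)) $ i" for i j
    using dist_deriv_borel_version[OF a'(1-3), of ?C "dir_x j" "- (\<kappa> $ j)" ?S i]
      dist_deriv_borel_version[OF a'(1-3), of ?S "dir_x j" "\<kappa> $ j" ?C i]
      int_Ca(1) int_Sa(1) wave_meas[OF m(1) cs(1)] wave_meas[OF m(1) cs(2)]
    by (simp_all add: fr)
  have curl: "dist_curl T a ?C = cross3 \<kappa> (\<integral>z. ?S z *\<^sub>R a' z \<partial>lborel)"
    "dist_curl T a ?S = cross3 \<kappa> (- (\<integral>z. ?C z *\<^sub>R a' z \<partial>lborel))"
    unfolding dist_curl_def dist_grad_def dx curl_of_grad_cross by simp_all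
  have 1: "(\<integral>z. ?C' z *\<^sub>R b' z \<partial>lborel) = cross3 \<kappa> (\<integral>z. ?S z *\<^sub>R a' z \<partial>lborel)"
    using eq[OF cylinder_test_function_wave(1)[OF \<kappa> \<eta>]] unfolding dt curl by simp
  have 2: "(\<integral>z. ?S' z *\<^sub>R b' z \<partial>lborel) = - cross3 \<kappa> (\<integral>z. ?C z *\<^sub>R a' z \<partial>lborel)"
    using eq[OF cylinder_test_function_wave(2)[OF \<kappa> \<eta>]]
    unfolding dt curl add_eq_0_iff minus_minus cross_minus_right by (rule sym)
  have cross: "(\<integral>t. \<eta> t *\<^sub>R cross3 \<kappa> (h t) \<partial>lborel) = cross3 \<kappa> (\<integral>t. \<eta> t *\<^sub>R h t \<partial>lborel)"
    if h: "integrable lborel h" for h :: "real \<Rightarrow> real^3"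
  proof -
    have "integrable lborel (\<lambda>t. \<eta> t *\<^sub>R h t)"
      by (rule integrable_bilinear_bounded[OF bounded_bilinear.flip[OF bounded_bilinear_scaleR] h, of _ B])
        (use m(1) B(1) in simp_all)
    from integral_bounded_linear[OF bounded_linear_cross3 this, of \<kappa>] show ?thesis
      by (simp add: cross_mult_right)
  qed
  show ?thesis
    using 1 2
    unfolding int_Ca(2) int_Sa(2) int_Cb(2) int_Sb(2) fourier_cos_def[symmetric] fourier_sin_def[symmetric]
      cross[OF integrable_coeff_time(1)[OF a'(4)]] cross[OF integrable_coeff_time(2)[OF a'(4)]]
    by blast
qed

text \<open>The weak gradient identity holds on almost every time slice, the curl and trace
  identities almost everywhere on the cylinder. Slicing the latter brings all of them to one time,
  where \<open>weak_gradient_modes\<close> applies.\<close>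

lemma potential_modes:
  fixes b \<Psi> b' \<Psi>' :: "(real^3) \<times> real \<Rightarrow> real^3"
  assumes b': "b' \<in> borel_measurable borel" "\<And>z. z \<notin> cylinder T \<Longrightarrow> b' z = 0"
      "AE z in lborel. z \<in> cylinder T \<longrightarrow> b z = b' z"
    and \<Psi>': "\<Psi>' \<in> borel_measurable borel" "\<And>z. z \<notin> cylinder T \<Longrightarrow> \<Psi>' z = 0"
      "AE z in lborel. z \<in> cylinder T \<longrightarrow> \<Psi> z = \<Psi>' z" "integrable lborel \<Psi>'"
    and pot: "vector_potential T b \<Psi>"
    and \<kappa>: "\<And>i. \<exists>m::int. \<kappa> $ i = 2 * pi * m"
  shows "AE t in lborel.
      fourier_cos \<kappa> (\<lambda>x. b' (x, t)) = cross3 \<kappa> (fourier_sin \<kappa> (\<lambda>x. \<Psi>' (x, t))) \<and>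
      fourier_sin \<kappa> (\<lambda>x. b' (x, t)) = - cross3 \<kappa> (fourier_cos \<kappa> (\<lambda>x. \<Psi>' (x, t))) \<and>
      \<kappa> \<bullet> fourier_cos \<kappa> (\<lambda>x. \<Psi>' (x, t)) = 0 \<and> \<kappa> \<bullet> fourier_sin \<kappa> (\<lambda>x. \<Psi>' (x, t)) = 0"
proof -
  obtain G where G: "Lp_on 3 (cylinder T) G"
    and weak: "AE t in lebesgue_on {0<..<T}. weak_gradient_on_torus (\<lambda>x. \<Psi> (x, t)) (\<lambda>x. G (x, t))"
    and curl: "AE z in lebesgue_on (cylinder T). curl_of_grad (G z) = b z"
    and tr: "AE z in lebesgue_on (cylinder T). trace (G z) = 0"
    using pot unfolding vector_potential_def Lp_W1p_with_gradient_def by blast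
  obtain G' where G': "G' \<in> borel_measurable borel" "\<And>z. z \<notin> cylinder T \<Longrightarrow> G' z = 0"
    "AE z in lborel. z \<in> cylinder T \<longrightarrow> G z = G' z" "(\<integral>\<^sup>+z. ennreal (norm (G' z) powr 3) \<partial>lborel) < \<infinity>"
    by (rule Lp_on_borel_version[OF cylinder_sets G], simp, rule that)
  have G'_int: "integrable lborel G'"
    by (rule L1_if_Lp[OF G'(1,2,4)]) auto
  have "AE z in lborel. (z \<in> cylinder T \<longrightarrow> \<Psi> z = \<Psi>' z \<and> G z = G' z) \<and> curl_of_grad (G' z) = b' z \<and> trace (G' z) = 0"
    using \<Psi>'(3) G'(3) b'(3) curl[unfolded AE_lebesgue_on_iff[OF cylinder_sets]] tr[unfolded AE_lebesgue_on_iff[OF cylinder_sets]]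
  proof eventually_elim
    case (elim z)
    \<comment> \<open>Outside the cylinder the representatives are zero, so the two identities
      extend there.\<close>
    have [simp]: "curl_of_grad 0 = 0" "trace (0 :: real^3^3) = 0"
      by (simp_all add: curl_of_grad_def trace_def vec_eq_iff forall_3)
    show ?case
      using elim b'(2)[of z] G'(2)[of z] by (cases "z \<in> cylinder T") auto
  qed
  from AE_time_slice[OF this] AE_integrable_time_slice[OF \<Psi>'(4)] AE_integrable_time_slice[OF G'_int]
    weak[unfolded AE_lebesgue_on_iff[OF borel_open[OF open_greaterThanLessThan]]]
  show ?thesis
  proof eventually_elim
    case (elim t)
    show ?case
    proof (cases "t \<in> {0<..<T}")
      case True
      show ?thesis
      proof (rule weak_gradient_modes[OF \<kappa> elim(2,3)])
        show "(\<lambda>x. b' (x, t)) \<in> borel_measurable borel"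
          by (rule time_slice_measurable[OF b'(1)]) auto
        show "AE x in lborel. curl_of_grad (G' (x, t)) = b' (x, t)"
          using elim(1) by eventually_elim auto
        show "AE x in lborel. trace (G' (x, t)) = 0"
          using elim(1) by eventually_elim auto
        fix \<phi> i j
        assume \<phi>: "torus_test_function \<phi>"
        have smooth: "C_infinity \<phi>"
          using \<phi> by (simp add: torus_test_function_def)
        have \<phi>_meas: "\<phi> \<in> borel_measurable borel"
          using smooth by (intro borel_measurable_continuous_onI C_infinity_imp_continuous)
        have "axis j 1 \<in> (Basis :: (real^3) set)"
          by (simp add: axis_in_Basis_iff)
        then have "C_infinity (\<lambda>x. frechet_derivative \<phi> (at x) (axis j 1))"
          using smooth[unfolded C_infinity_iff[of \<phi>]] by blast
        then have \<phi>'_meas: "(\<lambda>x. frechet_derivative \<phi> (at x) (axis j 1)) \<in> borel_measurable borel"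
          by (intro borel_measurable_continuous_onI C_infinity_imp_continuous)
        have \<Psi>_meas: "(\<lambda>x. \<Psi>' (x, t) $ i) \<in> borel_measurable borel"
          using borel_measurable_integrable[OF integrable_bounded_linear[OF bounded_linear_vec_nth elim(2)]] by simp
        have entry: "bounded_linear (\<lambda>A::real^3^3. A $ i $ j)"
          by (rule bounded_linear_compose[OF bounded_linear_vec_nth bounded_linear_vec_nth])
        have G_meas: "(\<lambda>x. G' (x, t) $ i $ j) \<in> borel_measurable borel"
          using borel_measurable_integrable[OF integrable_bounded_linear[OF entry elim(3)]] by simp
        have slices: "AE x in lborel. x \<in> torus3 \<longrightarrow> \<Psi> (x, t) = \<Psi>' (x, t) \<and> G (x, t) = G' (x, t)"
          using elim(1) by eventually_elim (use True in auto)
        have "(LINT x|lebesgue_on torus3. \<Psi> (x, t) $ i * frechet_derivative \<phi> (at x) (axis j 1)) =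
            (\<integral>x. \<Psi>' (x, t) $ i * frechet_derivative \<phi> (at x) (axis j 1) \<partial>lborel)"
        proof (rule integral_lebesgue_on_borel_version)
          show "AE x in lborel. x \<in> torus3 \<longrightarrow> \<Psi> (x, t) $ i * frechet_derivative \<phi> (at x) (axis j 1) =
              \<Psi>' (x, t) $ i * frechet_derivative \<phi> (at x) (axis j 1)"
            using slices by eventually_elim auto
          show "(\<lambda>x. \<Psi>' (x, t) $ i * frechet_derivative \<phi> (at x) (axis j 1)) \<in> borel_measurable borel"
            by (rule borel_measurable_times[OF \<Psi>_meas \<phi>'_meas])
        qed (simp_all add: \<Psi>'(2))
        moreover have "(LINT x|lebesgue_on torus3. G (x, t) $ i $ j * \<phi> x) = (\<integral>x. G' (x, t) $ i $ j * \<phi> x \<partial>lborel)"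
        proof (rule integral_lebesgue_on_borel_version)
          show "AE x in lborel. x \<in> torus3 \<longrightarrow> G (x, t) $ i $ j * \<phi> x = G' (x, t) $ i $ j * \<phi> x"
            using slices by eventually_elim auto
          show "(\<lambda>x. G' (x, t) $ i $ j * \<phi> x) \<in> borel_measurable borel"
            by (rule borel_measurable_times[OF G_meas \<phi>_meas])
        qed (simp_all add: G'(2))
        ultimately show "(\<integral>x. \<Psi>' (x, t) $ i * frechet_derivative \<phi> (at x) (axis j 1) \<partial>lborel) =
            - (\<integral>x. G' (x, t) $ i $ j * \<phi> x \<partial>lborel)"
          using elim(4) True \<phi> unfolding weak_gradient_on_torus_def by simp
      qed
    next
      case False
      then show ?thesis
        by (simp add: fourier_cos_def fourier_sin_def b'(2) \<Psi>'(2))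
    qed
  qed
qed

theorem theorem1p3:
  fixes T :: real
    and u b a \<Psi> :: "(real^3) \<times> real \<Rightarrow> real^3"
    and S :: "(real^3) \<times> real \<Rightarrow> real^3^3"
  assumes "T > 0"
    and "Lp_on 3 (cylinder T) u"
    and "Lp_on 3 (cylinder T) b"
    and "L1_loc_on (cylinder T) S"
    and "AE z in lebesgue_on (cylinder T). S z \<in> symmetric_matrices"
    and "Lp_on (3/2) (cylinder T) a"
    and "\<And>\<phi>. cylinder_test_function T \<phi> \<Longrightarrow> dist_div T u \<phi> = 0"
    and "\<And>\<phi>. cylinder_test_function T \<phi> \<Longrightarrow> dist_div T b \<phi> = 0"
    and "\<And>\<phi>. cylinder_test_function T \<phi> \<Longrightarrow> dist_dt T u \<phi> + dist_div_matrix T S \<phi> = 0"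
    and "\<And>\<phi>. cylinder_test_function T \<phi> \<Longrightarrow> dist_dt T b \<phi> + dist_curl T a \<phi> = 0"
    and "mean_zero T u"
    and "mean_zero T b"
    and "AE z in lebesgue_on (cylinder T).
           (u z, b z, S z, a z) \<in> Lambda_convex_hull constraint_set"
    and "vector_potential T b \<Psi>"
  shows "\<exists>c. AE t in lebesgue_on {0<..<T}. magnetic_helicity \<Psi> b t = c"
proof -
  obtain b' where b': "b' \<in> borel_measurable borel" "\<And>z. z \<notin> cylinder T \<Longrightarrow> b' z = 0"
    "AE z in lborel. z \<in> cylinder T \<longrightarrow> b z = b' z" "(\<integral>\<^sup>+z. ennreal (norm (b' z) powr 3) \<partial>lborel) < \<infinity>"
    by (rule Lp_on_borel_version[OF cylinder_sets assms(3)], simp, rule that)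
  obtain a' where a': "a' \<in> borel_measurable borel" "\<And>z. z \<notin> cylinder T \<Longrightarrow> a' z = 0"
    "AE z in lborel. z \<in> cylinder T \<longrightarrow> a z = a' z" "(\<integral>\<^sup>+z. ennreal (norm (a' z) powr (3/2)) \<partial>lborel) < \<infinity>"
    by (rule Lp_on_borel_version[OF cylinder_sets assms(6)], simp, rule that)
  have L3: "Lp_on 3 (cylinder T) \<Psi>"
    using assms(14) unfolding vector_potential_def Lp_W1p_with_gradient_def by blast
  obtain \<Psi>' where \<Psi>': "\<Psi>' \<in> borel_measurable borel" "\<And>z. z \<notin> cylinder T \<Longrightarrow> \<Psi>' z = 0"
    "AE z in lborel. z \<in> cylinder T \<longrightarrow> \<Psi> z = \<Psi>' z" "(\<integral>\<^sup>+z. ennreal (norm (\<Psi>' z) powr 3) \<partial>lborel) < \<infinity>"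
    by (rule Lp_on_borel_version[OF cylinder_sets L3], simp, rule that)
  \<comment> \<open>On the bounded cylinder every exponent from 1 on gives integrability, which the
    Fourier coefficients and the slicing rely on.\<close>
  have int: "integrable lborel a'" "integrable lborel b'" "integrable lborel \<Psi>'"
    by (rule L1_if_Lp[OF a'(1,2,4)] L1_if_Lp[OF b'(1,2,4)] L1_if_Lp[OF \<Psi>'(1,2,4)]; simp)+
  interpret induction_evolution T a' b' \<Psi>'
  proof
    show "AE z in lborel. a' z \<bullet> b' z = 0"
      using a'(3) b'(3) assms(13)[unfolded AE_lebesgue_on_iff[OF cylinder_sets]]
    proof eventually_elim
      case (elim z)
      show ?case
      proof (cases "z \<in> cylinder T")
        case True
        then have "a z \<bullet> b z = 0"
          using elim(3) inner_eq_zero_on_hull by blast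
        then show ?thesis
          using elim True by simp
      qed (simp add: a'(2))
    qed
    show "AE t in lborel.
      fourier_cos \<kappa> (\<lambda>x. b' (x, t)) = cross3 \<kappa> (fourier_sin \<kappa> (\<lambda>x. \<Psi>' (x, t))) \<and>
      fourier_sin \<kappa> (\<lambda>x. b' (x, t)) = - cross3 \<kappa> (fourier_cos \<kappa> (\<lambda>x. \<Psi>' (x, t))) \<and>
      \<kappa> \<bullet> fourier_cos \<kappa> (\<lambda>x. \<Psi>' (x, t)) = 0 \<and> \<kappa> \<bullet> fourier_sin \<kappa> (\<lambda>x. \<Psi>' (x, t)) = 0"
      if "\<And>i. \<exists>m::int. \<kappa> $ i = 2 * pi * m" for \<kappa>
      by (rule potential_modes[OF b'(1-3) \<Psi>'(1-3) int(3) assms(14) that])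
    show "(\<integral>t. \<eta>' t *\<^sub>R fourier_cos \<kappa> (\<lambda>x. b' (x, t)) \<partial>lborel) =
        (\<integral>t. \<eta> t *\<^sub>R cross3 \<kappa> (fourier_sin \<kappa> (\<lambda>x. a' (x, t))) \<partial>lborel) \<and>
      (\<integral>t. \<eta>' t *\<^sub>R fourier_sin \<kappa> (\<lambda>x. b' (x, t)) \<partial>lborel) =
        - (\<integral>t. \<eta> t *\<^sub>R cross3 \<kappa> (fourier_cos \<kappa> (\<lambda>x. a' (x, t))) \<partial>lborel)"
      if "\<And>i. \<exists>m::int. \<kappa> $ i = 2 * pi * m" "interval_test_function T \<eta>"
        "\<And>t. (\<eta> has_real_derivative \<eta>' t) (at t)" for \<kappa> \<eta> \<eta>'
      by (rule induction_equation_modes[OF a'(1-3) int(1) b'(1-3) int(2) assms(10) that])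
  qed (fact assms(1) a' b' \<Psi>')+
  obtain C where C: "AE t in lborel. t \<in> {0<..<T} \<longrightarrow> (\<integral>x. \<Psi>' (x, t) \<bullet> b' (x, t) \<partial>lborel) = C"
    by (rule helicity_constant)
  \<comment> \<open>Helicity is an integral over one time slice, so agreement of the representatives
    is needed slice by slice; \<open>AE_time_slice\<close> supplies it for almost every
    time.\<close>
  have "AE z in lborel. z \<in> cylinder T \<longrightarrow> \<Psi> z = \<Psi>' z \<and> b z = b' z"
    using \<Psi>'(3) b'(3) by eventually_elim simp
  from AE_time_slice[OF this] C
  have "AE t in lborel. t \<in> {0<..<T} \<longrightarrow> magnetic_helicity \<Psi> b t = C"
  proof eventually_elim
    case (elim t)
    show ?case
    proof
      assume t: "t \<in> {0<..<T}"
      have "magnetic_helicity \<Psi> b t = (\<integral>x. \<Psi>' (x, t) \<bullet> b' (x, t) \<partial>lborel)"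
        unfolding magnetic_helicity_def
      proof (rule integral_lebesgue_on_borel_version)
        show "AE x in lborel. x \<in> torus3 \<longrightarrow> \<Psi> (x, t) \<bullet> b (x, t) = \<Psi>' (x, t) \<bullet> b' (x, t)"
          using elim(1) by eventually_elim (use t in auto)
        show "(\<lambda>x. \<Psi>' (x, t) \<bullet> b' (x, t)) \<in> borel_measurable borel"
          by (intro borel_measurable_inner time_slice_measurable[OF b'(1)] time_slice_measurable[OF \<Psi>'(1)]) auto
      qed (simp_all add: \<Psi>'(2))
      then show "magnetic_helicity \<Psi> b t = C"
        using elim(2) t by simp
    qed
  qed
  then show ?thesis
    by (subst AE_lebesgue_on_iff) auto
qed

end
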